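(* Let $\ell\ge3$ and $0\le t\le\ell$ be integers, and let $C$ be an oriented cycle obtained by reversing the orientation of $t$ edges of the directed cycle $C_\ell$, with $\mathcal{C}(P_3,C)=\mathcal{C}(P_5,C)=0$ and $\mathcal{C}(2P_3,C)\ne0$. Let $k$ be the minimum positive integer such that $\mathcal{C}(P_{2k+1},C)\ne0$, if it exists. (i) If $\mathcal{C}(2P_3,C)>0$, and either $k$ does not exist or $(-1)^k\mathcal{C}(P_{2k+1},C)>0$, and one of the following holds: $\ell$ is odd; or $\ell\equiv0\pmod4$ and $t$ is even; or $\ell\equiv2\pmod4$ and $t$ is odd; then $C$ is locally tournament Sidorenko (LTS). (ii) If $\mathcal{C}(2P_3,C)<0$, and either $k$ does not exist or $(-1)^k\mathcal{C}(P_{2k+1},C)<0$, and one of the following holds: $\ell$ is odd; or $\ell\equiv0\pmod4$ and $t$ is odd; or $\ell\equiv2\pmod4$ and $t$ is even; then $C$ is locally tournament anti-Sidorenko (LTAS). (iii) Otherwise, $C$ is neither LTS nor LTAS.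
   Context: $C_\ell$ is the cycle of length $\ell$ with all edges oriented clockwise. $P_m$ is the directed path on $m$ vertices with all edges oriented left to right; $2P_3$ is the vertex-disjoint union of two copies of $P_3$. For $G=P_{2k+1}$ ($k\ge1$) or $G=2P_3$ and a digraph $D$, the signed count $\mathcal{C}(G,D)$ is the sum of $(-1)^{r(D')}$ over all (not necessarily induced) subgraphs $D'$ of $D$ without isolated vertices whose underlying undirected graph is isomorphic to that of $G$, where $r(D')$ is the number of edges of $G$ whose direction is reversed under an isomorphism from the underlying graph of $G$ to that of $D'$ (its parity is independent of the isomorphism because each component has an even number of edges). A weighted tournament on $n$ vertices is a function $A:[n]^2\to[0,1]$ with $A(x,y)+A(y,x)=1$ for all $x,y$ (so $A(x,x)=1/2$). For a digraph $D$, $t_D(A)=n^{-v(D)}\sum_{\phi:V(D)\to[n]}\prod_{(x,y)\in E(D)}A(\phi(x),\phi(y))$. Write $A=\frac12J+B$ with $J$ the all-ones matrix and $B$ skew-symmetric, and let $\lambda_{\max}(B)$ be the largest modulus of an eigenvalue of $B$. $D$ is LTS if there is $\varepsilon=\varepsilon(D)>0$ such that for every $n$ and every weighted tournament $A=\frac12J+B$ on $n$ vertices with $\lambda_{\max}(B)\le\varepsilon n$ one has $t_D(A)\ge2^{-e(D)}$; it is LTAS if there is such an $\varepsilon$ with $t_D(A)\le2^{-e(D)}$ for all such $A$. *)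

theory Defs
  imports
    Complex_Main
    "HOL-Library.FuncSet"
    "Graph_Theory.Digraph_Component"
    "Jordan_Normal_Form.Spectral_Radius"
begin

definition directed_path :: "nat \<Rightarrow> nat pair_pre_digraph" where
  "directed_path m = \<lparr> pverts = {..<m}, parcs = {(i, Suc i) | i. Suc i < m} \<rparr>"

definition two_P3 :: "nat pair_pre_digraph" where
  "two_P3 = \<lparr> pverts = {..<6}, parcs = {(0, 1), (1, 2), (3, 4), (4, 5)} \<rparr>"

definition directed_cycle :: "nat \<Rightarrow> nat pair_pre_digraph" where
  "directed_cycle l = \<lparr> pverts = {..<l}, parcs = {(i, Suc i mod l) | i. i < l} \<rparr>"

definition reverse_arcs :: "('a \<times> 'a) set \<Rightarrow> 'a pair_pre_digraph \<Rightarrow> 'a pair_pre_digraph" where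
  "reverse_arcs S D = \<lparr> pverts = pverts D, parcs = (parcs D - S) \<union> S\<inverse> \<rparr>"

definition underlying_iso ::
  "('a \<Rightarrow> 'b) \<Rightarrow> 'a pair_pre_digraph \<Rightarrow> 'b pair_pre_digraph \<Rightarrow> bool" where
  "underlying_iso f G H \<longleftrightarrow>
     bij_betw f (pverts G) (pverts H) \<and>
     (\<forall>u\<in>pverts G. \<forall>v\<in>pverts G.
        (u, v) \<in> parcs (mk_symmetric (with_proj G)) \<longleftrightarrow>
        (f u, f v) \<in> parcs (mk_symmetric (with_proj H)))"

text \<open>
  The subgraphs of \<open>D\<close>, without isolated vertices, whose underlying graph is isomorphic to that of
  \<open>G\<close>. A pair of antiparallel arcs yields a double edge in the underlying graph, while
  \<^const>\<open>mk_symmetric\<close> merges the two; as \<open>G\<close> is simple, such subgraphs are excluded by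
  antisymmetry.
\<close>
definition copies :: "'a pair_pre_digraph \<Rightarrow> 'b pair_pre_digraph \<Rightarrow> 'b pair_pre_digraph set" where
  "copies G D = {H. subgraph (with_proj H) (with_proj D) \<and> pverts H = Field (parcs H) \<and>
     antisym (parcs H) \<and> (\<exists>f. underlying_iso f G H)}"

text \<open>
  For \<open>G\<close> a directed path with an even number of arcs or \<open>two_P3\<close>, the parity of this number does
  not depend on the isomorphism chosen.
\<close>
definition num_reversed :: "'a pair_pre_digraph \<Rightarrow> 'b pair_pre_digraph \<Rightarrow> nat" where
  "num_reversed G H =
     (let f = (SOME f. underlying_iso f G H)
      in card {(u, v). (u, v) \<in> parcs G \<and> (f v, f u) \<in> parcs H})"

definition signed_count :: "'a pair_pre_digraph \<Rightarrow> 'b pair_pre_digraph \<Rightarrow> int" where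
  "signed_count G D = (\<Sum>H\<in>copies G D. (-1) ^ num_reversed G H)"

definition weighted_tournament :: "nat \<Rightarrow> real mat \<Rightarrow> bool" where
  "weighted_tournament n A \<longleftrightarrow> A \<in> carrier_mat n n \<and>
     (\<forall>x<n. \<forall>y<n. A $$ (x, y) \<in> {0..1} \<and> A $$ (x, y) + A $$ (y, x) = 1)"

definition hom_density :: "'a pair_pre_digraph \<Rightarrow> real mat \<Rightarrow> real" where
  "hom_density D A =
     (\<Sum>\<phi> \<in> pverts D \<rightarrow>\<^sub>E {..<dim_row A}. \<Prod>(x, y)\<in>parcs D. A $$ (\<phi> x, \<phi> y))
       / real (dim_row A) ^ card (pverts D)"

definition skew_part :: "nat \<Rightarrow> real mat \<Rightarrow> real mat" where
  "skew_part n A = A - (1/2) \<cdot>\<^sub>m mat n n (\<lambda>_. 1)"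

definition lambda_max :: "real mat \<Rightarrow> real" where
  "lambda_max B = spectral_radius (map_mat complex_of_real B)"

definition LTS :: "'a pair_pre_digraph \<Rightarrow> bool" where
  "LTS D \<longleftrightarrow> (\<exists>\<epsilon>>0. \<forall>n\<ge>1. \<forall>A. weighted_tournament n A \<and>
     lambda_max (skew_part n A) \<le> \<epsilon> * real n \<longrightarrow>
     hom_density D A \<ge> (1/2) ^ card (parcs D))"

definition LTAS :: "'a pair_pre_digraph \<Rightarrow> bool" where
  "LTAS D \<longleftrightarrow> (\<exists>\<epsilon>>0. \<forall>n\<ge>1. \<forall>A. weighted_tournament n A \<and>
     lambda_max (skew_part n A) \<le> \<epsilon> * real n \<longrightarrow>
     hom_density D A \<le> (1/2) ^ card (parcs D))"

end

theory Submission
  imports Defs "HOL-Analysis.Convex" "HOL-Number_Theory.Cong"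
begin

text \<open>
  Write \<open>A / n = U / 2 + M\<close> with \<open>U\<close> the matrix with all entries \<open>1 / n\<close>, a rank-one projection, and \<open>M\<close>
  skew-symmetric. Expanding the density of the cycle over the set \<open>F\<close> of edges that receive \<open>M\<close>
  gives a product over the runs of \<open>F\<close>, where a run of length \<open>j\<close> contributes \<open>\<langle>1, M\<^sup>j 1\<rangle>\<close>; this
  vanishes for odd \<open>j\<close> and is \<open>(-1)\<^sup>k P\<^sub>k\<close> with \<open>P\<^sub>k = \<bar>M\<^sup>k 1\<bar>\<^sup>2\<close> for \<open>j = 2 k\<close>. If the norm of \<open>M\<close> is at most
  \<open>\<epsilon>\<close>, then \<open>P\<^sub>j \<le> \<epsilon>\<^sup>2 P\<^sub>k\<close> for \<open>j > k\<close>, so up to an error \<open>O(\<epsilon>\<^sup>2 (P\<^sub>1\<^sup>2 + P\<^sub>k))\<close> only the terms for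
  \<open>P\<^sub>k\<close>, \<open>P\<^sub>1\<^sup>2\<close> (from \<open>2P\<^sub>3\<close>) and the trace of \<open>M\<^sup>l\<close> survive, and they decide the sign.
  The vanishing of the count of \<open>P\<^sub>3\<close> forces \<open>4\<close> to divide \<open>l\<close>, so that this trace is nonnegative.

  If the three signs do not agree, each can be realised on four vertices by a rank-two \<open>M\<close>. For
  \<open>P\<^sub>k\<close> to dominate the trace one needs \<open>4 k \<le> l\<close>: passing to complementary arcs of the cycle shows
  that the counts of \<open>P\<^bsub>2k+1\<^esub>\<close> and \<open>P\<^bsub>l-2k+1\<^esub>\<close> agree up to sign.
\<close>

section \<open>Closed walks of weighted kernels\<close>

text \<open>The hypothesis bounds a spectral radius, whereas every estimate needs a bound on the
  norm of \<open>M v\<close>. For skew-symmetric \<open>M\<close> these agree; the inequality needed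
  is derived from log-convexity of the norms of \<open>M\<^sup>j v\<close> and boundedness of
  rescaled matrix powers, without diagonalisation. Reversing an arc changes the sign of
  \<open>M\<close> on that edge, so a pattern \<open>F\<close> enters with the product of its signs.
  Grouping equal patterns produces the signed counts, and the full pattern gives the trace the sign
  \<open>(-1) ^ t\<close>. Both \<open>P k\<close> and \<open>(P 1)\<^sup>2\<close> must be kept
  because neither is bounded by a multiple of the other: they are of degree 2 and 4 in the all-ones
  vector, but of degree \<open>2 * k\<close> and 4 in \<open>M\<close>. The vanishing counts of the
  paths on 3 and 5 vertices give \<open>3 \<le> k\<close>, so for row sums of the order of a small
  \<open>\<delta>\<close> the square wins, while for much smaller row sums \<open>P k\<close> wins.
  The trace does not involve the all-ones vector and can survive alone. Both directions of
  inequality are treated at once by a factor \<open>z\<close> equal to 1 or -1 in front of the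
  deviation.\<close>

definition ip :: "nat \<Rightarrow> (nat \<Rightarrow> real) \<Rightarrow> (nat \<Rightarrow> real) \<Rightarrow> real" where
  "ip n v w = (\<Sum>x<n. v x * w x) / real n"

text \<open>Row vectors are multiplied from the left, so a walk is extended at its end. The division
  by \<open>n\<close> in \<open>ip\<close> makes the all-ones vector a unit vector.\<close>

definition act :: "nat \<Rightarrow> (nat \<Rightarrow> nat \<Rightarrow> real) \<Rightarrow> (nat \<Rightarrow> real) \<Rightarrow> nat \<Rightarrow> real" where
  "act n M v = (\<lambda>y. \<Sum>x<n. v x * M x y)"

abbreviation ones :: "nat \<Rightarrow> real" where "ones \<equiv> (\<lambda>_. 1)"

primrec trail :: "nat \<Rightarrow> (nat \<Rightarrow> nat \<Rightarrow> nat \<Rightarrow> real) \<Rightarrow> (nat \<Rightarrow> real) \<Rightarrow> nat \<Rightarrow> nat \<Rightarrow> real" where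
  "trail n Y h 0 = h"
| "trail n Y h (Suc i) = act n (Y i) (trail n Y h i)"

lemma sum_PiE_lessThan_Suc:
  fixes f :: "(nat \<Rightarrow> 'a) \<Rightarrow> 'b::comm_monoid_add"
  assumes "finite A"
  shows "(\<Sum>\<phi>\<in>{..<Suc m} \<rightarrow>\<^sub>E A. f \<phi>) = (\<Sum>\<phi>\<in>{..<m} \<rightarrow>\<^sub>E A. \<Sum>y\<in>A. f (\<phi>(m := y)))"
proof -
  have inj: "inj_on (\<lambda>(y, g). g(m := y)) (A \<times> ({..<m} \<rightarrow>\<^sub>E A))"
    by (rule inj_combinator) simp
  have "{..<Suc m} \<rightarrow>\<^sub>E A = (\<lambda>(y, g). g(m := y)) ` (A \<times> ({..<m} \<rightarrow>\<^sub>E A))"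
    by (simp add: lessThan_Suc PiE_insert_eq)
  then have "(\<Sum>\<phi>\<in>{..<Suc m} \<rightarrow>\<^sub>E A. f \<phi>) = (\<Sum>(y, g)\<in>A \<times> ({..<m} \<rightarrow>\<^sub>E A). f (g(m := y)))"
    by (simp only: sum.reindex[OF inj]) (simp add: case_prod_unfold)
  also have "\<dots> = (\<Sum>y\<in>A. \<Sum>g\<in>{..<m} \<rightarrow>\<^sub>E A. f (g(m := y)))"
    by (simp add: sum.cartesian_product)
  also have "\<dots> = (\<Sum>\<phi>\<in>{..<m} \<rightarrow>\<^sub>E A. \<Sum>y\<in>A. f (\<phi>(m := y)))"
    by (rule sum.swap)
  finally show ?thesis .
qed

text \<open>Transfer-matrix evaluation: summing out the last vertex turns its weight into a new end
  weight, which is why the induction leaves \<open>g\<close> arbitrary.\<close>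

lemma sum_paths_eq_trail:
  "(\<Sum>\<phi>\<in>{..<Suc m} \<rightarrow>\<^sub>E {..<n}. h (\<phi> 0) * (\<Prod>i<m. Y i (\<phi> i) (\<phi> (Suc i))) * g (\<phi> m))
     = (\<Sum>y<n. trail n Y h m y * g y)"
proof (induction m arbitrary: g)
  case 0
  show ?case
    by (subst sum_PiE_lessThan_Suc) simp_all
next
  case (Suc m)
  have "(\<Sum>\<phi>\<in>{..<Suc (Suc m)} \<rightarrow>\<^sub>E {..<n}.
          h (\<phi> 0) * (\<Prod>i<Suc m. Y i (\<phi> i) (\<phi> (Suc i))) * g (\<phi> (Suc m)))
      = (\<Sum>\<phi>\<in>{..<Suc m} \<rightarrow>\<^sub>E {..<n}. h (\<phi> 0) * (\<Prod>i<m. Y i (\<phi> i) (\<phi> (Suc i))) *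
          (\<Sum>y<n. Y m (\<phi> m) y * g y))"
    by (subst sum_PiE_lessThan_Suc) (simp_all add: sum_distrib_left mult.assoc)
  also have "\<dots> = (\<Sum>x<n. trail n Y h m x * (\<Sum>y<n. Y m x y * g y))"
    by (rule Suc.IH)
  also have "\<dots> = (\<Sum>x<n. \<Sum>y<n. trail n Y h m x * Y m x y * g y)"
    by (simp add: sum_distrib_left mult.assoc)
  also have "\<dots> = (\<Sum>y<n. \<Sum>x<n. trail n Y h m x * Y m x y * g y)"
    by (rule sum.swap)
  also have "\<dots> = (\<Sum>y<n. trail n Y h (Suc m) y * g y)"
    by (simp add: act_def sum_distrib_right)
  finally show ?case .
qed

definition cyc_sum :: "nat \<Rightarrow> nat \<Rightarrow> (nat \<Rightarrow> nat \<Rightarrow> nat \<Rightarrow> real) \<Rightarrow> real" where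
  "cyc_sum n l Y = (\<Sum>\<phi>\<in>{..<l} \<rightarrow>\<^sub>E {..<n}. \<Prod>i<l. Y i (\<phi> i) (\<phi> (Suc i mod l)))"

lemma cyc_sum_cong:
  assumes "\<And>i x y. i < l \<Longrightarrow> x < n \<Longrightarrow> y < n \<Longrightarrow> Y i x y = Y' i x y"
  shows "cyc_sum n l Y = cyc_sum n l Y'"
  unfolding cyc_sum_def
proof (intro sum.cong prod.cong refl)
  fix \<phi> i assume \<phi>: "\<phi> \<in> {..<l} \<rightarrow>\<^sub>E {..<n}" and i: "i \<in> {..<l}"
  then have "Suc i mod l \<in> {..<l}" by auto
  with \<phi> i show "Y i (\<phi> i) (\<phi> (Suc i mod l)) = Y' i (\<phi> i) (\<phi> (Suc i mod l))"
    using assms[of i "\<phi> i" "\<phi> (Suc i mod l)"] PiE_mem[OF \<phi>] by blast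
qed

lemma bij_betw_add_mod:
  assumes "0 < l"
  shows "bij_betw (\<lambda>i. (i + r) mod l) {..<l} {..<l::nat}"
proof -
  have "(\<lambda>i. (i + r) mod l) ` {..<l} \<subseteq> {..<l}"
    using assms by auto
  moreover have "inj_on (\<lambda>i. (i + r) mod l) {..<l}"
  proof (rule inj_onI)
    fix x y assume *: "x \<in> {..<l}" "y \<in> {..<l}" "(x + r) mod l = (y + r) mod l"
    from *(3) have "x mod l = y mod l"
      by (simp add: cong_add_rcancel_nat[unfolded unique_euclidean_semiring_class.cong_def])
    with * show "x = y" by simp
  qed
  ultimately show ?thesis
    by (simp add: bij_betw_def endo_inj_surj)
qed

text \<open>Relabelling the vertices by a rotation permutes the assignments. This allows the cycle
  to be cut at any chosen edge.\<close>

lemma cyc_sum_rotate: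
  assumes l: "0 < l"
  shows "cyc_sum n l (\<lambda>i. Y ((i + r) mod l)) = cyc_sum n l Y"
proof -
  define \<rho> where "\<rho> = (\<lambda>i. (i + r) mod l)"
  define \<rho>' where "\<rho>' = inv_into {..<l} \<rho>"
  have b: "bij_betw \<rho> {..<l} {..<l}"
    unfolding \<rho>_def using bij_betw_add_mod[OF l] .
  then have b': "bij_betw \<rho>' {..<l} {..<l}"
    unfolding \<rho>'_def by (rule bij_betw_inv_into)
  have inv: "\<rho>' (\<rho> i) = i" "\<rho> (\<rho>' i) = i" if "i < l" for i
    using b that by (auto simp: \<rho>'_def bij_betw_inv_into_left bij_betw_inv_into_right)
  have less: "\<rho> i < l" "\<rho>' i < l" if "i < l" for i
    using b b' that by (auto simp: bij_betw_def)
  have suc: "\<rho> (Suc i mod l) = Suc (\<rho> i) mod l" for i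
    by (simp add: \<rho>_def mod_simps)
  have "cyc_sum n l Y = (\<Sum>\<phi>\<in>{..<l} \<rightarrow>\<^sub>E {..<n}. \<Prod>i<l. Y (\<rho> i) (\<phi> (\<rho> i)) (\<phi> (Suc (\<rho> i) mod l)))"
    unfolding cyc_sum_def
    by (intro sum.cong refl prod.reindex_bij_betw[OF b, symmetric, where g = "\<lambda>i. Y i (\<phi> i) (\<phi> (Suc i mod l))" for \<phi>])
  also have "\<dots> = (\<Sum>\<phi>\<in>{..<l} \<rightarrow>\<^sub>E {..<n}. \<Prod>i<l. Y (\<rho> i) (\<phi> i) (\<phi> (Suc i mod l)))"
  proof (rule sum.reindex_bij_witness[where
        j = "\<lambda>\<phi>. restrict (\<lambda>i. \<phi> (\<rho> i)) {..<l}" and i = "\<lambda>\<phi>. restrict (\<lambda>i. \<phi> (\<rho>' i)) {..<l}"])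
    fix \<phi> assume \<phi>: "\<phi> \<in> {..<l} \<rightarrow>\<^sub>E {..<n}"
    then have ext: "\<phi> i = undefined" if "\<not> i < l" for i
      using that by (auto simp: PiE_def extensional_def)
    show "restrict (\<lambda>i. restrict (\<lambda>i. \<phi> (\<rho> i)) {..<l} (\<rho>' i)) {..<l} = \<phi>"
      "restrict (\<lambda>i. restrict (\<lambda>i. \<phi> (\<rho>' i)) {..<l} (\<rho> i)) {..<l} = \<phi>"
      by (auto simp: restrict_def less inv ext)
    show "restrict (\<lambda>i. \<phi> (\<rho> i)) {..<l} \<in> {..<l} \<rightarrow>\<^sub>E {..<n}"
      "restrict (\<lambda>i. \<phi> (\<rho>' i)) {..<l} \<in> {..<l} \<rightarrow>\<^sub>E {..<n}"
      using \<phi> less by (auto simp: PiE_def Pi_def)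
    have "restrict (\<lambda>i. \<phi> (\<rho> i)) {..<l} (Suc i mod l) = \<phi> (Suc (\<rho> i) mod l)" for i
      using l by (simp add: suc)
    then show "(\<Prod>i<l. Y (\<rho> i) (restrict (\<lambda>i. \<phi> (\<rho> i)) {..<l} i)
          (restrict (\<lambda>i. \<phi> (\<rho> i)) {..<l} (Suc i mod l)))
        = (\<Prod>i<l. Y (\<rho> i) (\<phi> (\<rho> i)) (\<phi> (Suc (\<rho> i) mod l)))"
      by (intro prod.cong) auto
  qed
  finally show ?thesis
    by (simp add: cyc_sum_def \<rho>_def)
qed

text \<open>The averaging kernel does not see its ends, so on the closing edge it opens the cycle
  into a path with both ends free.\<close>

lemma cyc_sum_const_last:
  assumes l: "0 < l" and Y: "\<And>x y. Y (l - 1) x y = 1 / real n"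
  shows "cyc_sum n l Y = ip n ones (trail n Y ones (l - 1))"
proof -
  obtain m where m: "l = Suc m"
    using l by (cases l) auto
  have "cyc_sum n l Y = (\<Sum>\<phi>\<in>{..<Suc m} \<rightarrow>\<^sub>E {..<n}.
      ones (\<phi> 0) * (\<Prod>i<m. Y i (\<phi> i) (\<phi> (Suc i))) * (\<lambda>_. 1 / real n) (\<phi> m))"
    unfolding cyc_sum_def using Y by (intro sum.cong) (simp_all add: m)
  also have "\<dots> = (\<Sum>y<n. trail n Y ones m y * (1 / real n))"
    by (rule sum_paths_eq_trail)
  finally show ?thesis
    by (simp add: ip_def m sum_divide_distrib)
qed

lemma trail_const: "trail n (\<lambda>_. M) h i = (act n M ^^ i) h"
  by (induction i) auto

definition unit_fun :: "nat \<Rightarrow> nat \<Rightarrow> real" where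
  "unit_fun x = (\<lambda>y. if y = x then 1 else 0)"

text \<open>This is the trace of the \<open>l\<close>-th power of \<open>M\<close>, read off from
  unit vectors; the factor \<open>real n\<close> undoes the normalisation of
  \<open>ip\<close>.\<close>

lemma cyc_sum_const:
  assumes l: "0 < l"
  shows "cyc_sum n l (\<lambda>_. M) = real n * (\<Sum>x<n. ip n (unit_fun x) ((act n M ^^ l) (unit_fun x)))"
proof -
  obtain m where m: "l = Suc m"
    using l by (cases l) auto
  have "cyc_sum n l (\<lambda>_. M) = (\<Sum>\<phi>\<in>{..<Suc m} \<rightarrow>\<^sub>E {..<n}. \<Sum>x<n.
      unit_fun x (\<phi> 0) * (\<Prod>i<m. M (\<phi> i) (\<phi> (Suc i))) * M (\<phi> m) x)"
    unfolding cyc_sum_def m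
  proof (rule sum.cong)
    fix \<phi> assume "\<phi> \<in> {..<Suc m} \<rightarrow>\<^sub>E {..<n}"
    then have \<phi>0: "\<phi> 0 < n" by auto
    have "(\<Prod>i<Suc m. M (\<phi> i) (\<phi> (Suc i mod Suc m))) = (\<Prod>i<m. M (\<phi> i) (\<phi> (Suc i))) * M (\<phi> m) (\<phi> 0)"
      by simp
    also have "\<dots> = (\<Sum>x<n. if x = \<phi> 0 then (\<Prod>i<m. M (\<phi> i) (\<phi> (Suc i))) * M (\<phi> m) x else 0)"
      using \<phi>0 by simp
    also have "\<dots> = (\<Sum>x<n. unit_fun x (\<phi> 0) * (\<Prod>i<m. M (\<phi> i) (\<phi> (Suc i))) * M (\<phi> m) x)"
      by (intro sum.cong) (auto simp: unit_fun_def)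
    finally show "(\<Prod>i<Suc m. M (\<phi> i) (\<phi> (Suc i mod Suc m))) = \<dots>" .
  qed simp
  also have "\<dots> = (\<Sum>x<n. \<Sum>y<n. trail n (\<lambda>_. M) (unit_fun x) m y * M y x)"
    by (subst sum.swap, intro sum.cong refl, rule sum_paths_eq_trail)
  also have "\<dots> = (\<Sum>x<n. (act n M ^^ l) (unit_fun x) x)"
    by (simp add: trail_const m act_def)
  also have "\<dots> = (\<Sum>x<n. \<Sum>y<n. unit_fun x y * (act n M ^^ l) (unit_fun x) y)"
    by (intro sum.cong refl) (simp add: unit_fun_def if_distrib[where f = "\<lambda>a. a * _"] cong: if_cong)
  finally show ?thesis
    by (cases "n = 0") (simp_all add: ip_def flip: sum_divide_distrib)
qed

lemma ip_commute: "ip n v w = ip n w v"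
  by (simp add: ip_def mult.commute)

lemma ip_scale [simp]: "ip n (\<lambda>y. c * v y) w = c * ip n v w" "ip n v (\<lambda>y. c * w y) = c * ip n v w"
  by (simp_all add: ip_def sum_distrib_left mult_ac)

lemma ip_self_nonneg [simp]: "0 \<le> ip n v v"
  by (simp add: ip_def sum_nonneg)

lemma ip_one_const: "0 < n \<Longrightarrow> ip n ones (\<lambda>_. c) = c"
  by (simp add: ip_def)

lemma ip_one_one: "0 < n \<Longrightarrow> ip n ones ones = 1"
  by (simp add: ip_def)

lemma ip_Cauchy_Schwarz: "(ip n v w)\<^sup>2 \<le> ip n v v * ip n w w"
  using Cauchy_Schwarz_ineq_sum[of v w "{..<n}"]
  by (simp add: ip_def power_divide power2_eq_square divide_right_mono)

lemma act_scale: "act n M (\<lambda>y. c * v y) = (\<lambda>y. c * act n M v y)"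
  by (simp add: act_def sum_distrib_left mult_ac)

lemma act_average: "act n (\<lambda>_ _. 1 / real n) v = (\<lambda>y. ip n ones v)"
  by (simp add: act_def ip_def sum_divide_distrib)

section \<open>Skew-symmetric kernels and the norms of their iterates\<close>

locale skew_kernel =
  fixes n :: nat and M :: "nat \<Rightarrow> nat \<Rightarrow> real"
  assumes n_pos: "0 < n" and skew: "\<And>x y. x < n \<Longrightarrow> y < n \<Longrightarrow> M x y = - M y x"
begin

abbreviation iter :: "nat \<Rightarrow> (nat \<Rightarrow> real) \<Rightarrow> nat \<Rightarrow> real" where
  "iter j v \<equiv> (act n M ^^ j) v"

definition nrm :: "nat \<Rightarrow> (nat \<Rightarrow> real) \<Rightarrow> real" where
  "nrm j v = ip n (iter j v) (iter j v)"

definition P :: "nat \<Rightarrow> real" where "P j = nrm j ones"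

lemma ip_act: "ip n (act n M v) w = - ip n v (act n M w)"
proof -
  have "(\<Sum>y<n. (\<Sum>x<n. v x * M x y) * w y) = (\<Sum>y<n. \<Sum>x<n. v x * M x y * w y)"
    by (simp add: sum_distrib_right)
  also have "\<dots> = (\<Sum>x<n. \<Sum>y<n. v x * M x y * w y)"
    by (rule sum.swap)
  also have "\<dots> = (\<Sum>x<n. \<Sum>y<n. - (v x * (w y * M y x)))"
  proof (intro sum.cong refl)
    fix x y assume "x \<in> {..<n}" "y \<in> {..<n}"
    then have "M x y = - M y x" using skew by blast
    then show "v x * M x y * w y = - (v x * (w y * M y x))" by (simp add: mult_ac)
  qed
  also have "\<dots> = - (\<Sum>x<n. v x * (\<Sum>y<n. w y * M y x))"
    by (simp add: sum_negf sum_distrib_left)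
  finally show ?thesis
    by (simp add: ip_def act_def)
qed

lemma ip_iter: "ip n (iter j v) w = (-1) ^ j * ip n v (iter j w)"
proof (induction j arbitrary: w)
  case (Suc j)
  have "ip n (iter (Suc j) v) w = - ((-1) ^ j * ip n v (iter j (act n M w)))"
    by (simp add: ip_act Suc)
  then show ?case
    by (simp add: funpow_swap1)
qed simp

lemma iter_scale: "iter m (\<lambda>y. c * v y) = (\<lambda>y. c * iter m v y)"
  by (induction m) (simp_all add: act_scale)

lemma ip_iter_even: "ip n v (iter (2 * j) v) = (-1) ^ j * nrm j v"
proof -
  have "nrm j v = (-1) ^ j * ip n v (iter (2 * j) v)"
    by (simp add: nrm_def ip_iter mult_2 funpow_add)
  then show ?thesis
    by (simp add: power_mult_distrib flip: mult.assoc)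
qed

text \<open>Moving an odd number of factors \<open>M\<close> to the other side changes the sign, so
  the number equals its own negative.\<close>

lemma ip_iter_odd:
  assumes "odd j" shows "ip n v (iter j v) = 0"
  using ip_iter[of j v v] assms by (simp add: ip_commute[of n v])

lemma nrm_nonneg [simp]: "0 \<le> nrm j v"
  by (simp add: nrm_def)

text \<open>Move one factor \<open>M\<close> from one side of \<open>nrm (Suc j) v\<close> to the
  other and apply Cauchy-Schwarz.\<close>

lemma nrm_log_convex: "(nrm (Suc j) v)\<^sup>2 \<le> nrm j v * nrm (Suc (Suc j)) v"
proof -
  have "nrm (Suc j) v = - ip n (iter j v) (iter (Suc (Suc j)) v)"
    by (simp add: nrm_def ip_act)
  then show ?thesis
    using ip_Cauchy_Schwarz[of n "iter j v" "iter (Suc (Suc j)) v"] by (simp add: nrm_def)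
qed

text \<open>By log-convexity the ratios of consecutive norms never decrease, so a lower bound for
  the first ratio persists.\<close>

lemma nrm_ratio:
  assumes "0 < nrm 0 v" and q: "q * nrm 0 v \<le> nrm 1 v" "0 < q"
  shows "0 < nrm j v \<and> q * nrm j v \<le> nrm (Suc j) v"
proof (induction j)
  case 0
  show ?case using assms by simp
next
  case (Suc j)
  then have pos: "0 < nrm (Suc j) v"
    using q(2) by (smt (verit) mult_pos_pos)
  have "nrm j v * (q * nrm (Suc j) v) \<le> nrm (Suc j) v * nrm (Suc j) v"
    using Suc pos by (simp add: mult_ac mult_left_mono)
  also have "\<dots> \<le> nrm j v * nrm (Suc (Suc j)) v"
    using nrm_log_convex[of j v] by (simp add: power2_eq_square)
  finally show ?case
    using Suc pos by simp
qed

lemma nrm_ge_geometric: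
  assumes "0 < nrm 0 v" and q: "q * nrm 0 v \<le> nrm 1 v" "0 < q"
  shows "q ^ j * nrm 0 v \<le> nrm j v"
proof (induction j)
  case (Suc j)
  have "q ^ Suc j * nrm 0 v \<le> q * nrm j v"
    using Suc q(2) by simp
  also have "\<dots> \<le> nrm (Suc j) v"
    using nrm_ratio[OF assms] by simp
  finally show ?case .
qed simp

lemma P_0 [simp]: "P 0 = 1"
  using n_pos by (simp add: P_def nrm_def ip_one_one)

lemma P_nonneg [simp]: "0 \<le> P j"
  by (simp add: P_def)

end

section \<open>Patterns on the cycle\<close>

definition arc :: "nat \<Rightarrow> nat \<Rightarrow> nat \<Rightarrow> nat set" where
  "arc l i m = (\<lambda>j. (i + j) mod l) ` {..<m}"

text \<open>The number \<open>i\<close> stands for the edge between \<open>i\<close> and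
  \<open>Suc i mod l\<close>. The condition \<open>2 * k < l\<close> excludes the full cycle, so for
  positive \<open>k\<close> these are the edge sets of paths with \<open>2 * k\<close>
  edges.\<close>

definition single_arcs :: "nat \<Rightarrow> nat \<Rightarrow> nat set set" where
  "single_arcs l k = {F. \<exists>i<l. 2 * k < l \<and> F = arc l i (2 * k)}"

text \<open>\<open>arc l i 3\<close> is the vertex set of the path with edges
  \<open>arc l i 2\<close>, so the disjointness is that of the vertices of two copies of the path on
  three vertices.\<close>

definition double_arcs :: "nat \<Rightarrow> nat set set" where
  "double_arcs l = {F. \<exists>i<l. \<exists>j<l. arc l i 3 \<inter> arc l j 3 = {} \<and> F = arc l i 2 \<union> arc l j 2}"

abbreviation rot :: "nat \<Rightarrow> nat \<Rightarrow> nat \<Rightarrow> nat" where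
  "rot l r \<equiv> (\<lambda>i. (i + r) mod l)"

lemma inj_on_rot: "0 < l \<Longrightarrow> inj_on (rot l r) {..<l}"
  using bij_betw_add_mod[of l r] by (simp add: bij_betw_def)

lemma card_arc: "0 < l \<Longrightarrow> m \<le> l \<Longrightarrow> card (arc l i m) = m"
  unfolding arc_def using inj_on_rot[of l i]
  by (subst card_image) (auto simp: add.commute[of i] intro: inj_on_subset)

lemma rot_interval: "rot l r ` {a..<a + m} = arc l ((a + r) mod l) m"
proof -
  have "{a..<a + m} = (+) a ` {..<m}"
    by (simp add: lessThan_atLeast0 add.commute)
  then show ?thesis
    by (simp add: arc_def image_image mod_simps add_ac)
qed

lemma arc_2: "arc l i 2 = {i mod l, Suc i mod l}"
  by (auto simp: arc_def lessThan_Suc numeral_2_eq_2)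

lemma arc_3: "arc l i 3 = {i mod l, Suc i mod l, Suc (Suc i) mod l}"
  by (auto simp: arc_def lessThan_Suc numeral_3_eq_3)

lemma rot_pair: "rot l r ` {a, Suc a} = arc l ((a + r) mod l) 2"
  by (auto simp: arc_2 mod_simps)

lemma single_arcs_card: "F \<in> single_arcs l k \<Longrightarrow> card F = 2 * k"
  by (auto simp: single_arcs_def card_arc)

text \<open>Rotating the first path to the start leaves only the offset \<open>b\<close> of the
  second. The bounds on \<open>b\<close> say that edge 2 and the closing edge \<open>l - 1\<close>
  are missed, which later separates the two runs and opens the cycle.\<close>

lemma double_arcs_normal:
  assumes "F \<in> double_arcs l"
  obtains r b where "3 \<le> b" "b + 2 < l" "F = rot l r ` {0, 1, b, Suc b}"
proof -
  obtain i j where ij: "i < l" "j < l" "arc l i 3 \<inter> arc l j 3 = {}" "F = arc l i 2 \<union> arc l j 2"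
    using assms by (auto simp: double_arcs_def)
  define b where "b = (j + l - i) mod l"
  have "(b + i) mod l = (j + l - i + i) mod l"
    unfolding b_def by (simp only: mod_add_left_eq)
  then have b: "b < l" "(b + i) mod l = j"
    using ij by (auto simp: b_def)
  have disj: "x \<notin> arc l j 3" if "x \<in> arc l i 3" for x
    using that ij(3) by auto
  have "3 \<le> b"
  proof (rule ccontr)
    assume "\<not> 3 \<le> b"
    then have "j \<in> arc l i 3"
      unfolding arc_def using b by (auto simp: add.commute intro!: image_eqI[of _ _ b])
    then show False using disj ij by (auto simp: arc_3)
  qed
  moreover have "b + 2 < l"
  proof (rule ccontr)
    assume "\<not> b + 2 < l"
    then consider "l = b + 1" | "l = b + 2" using b by linarith
    then have "i \<in> arc l j 3"
    proof cases
      case 1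
      have "(j + 1) mod l = (b + i + 1) mod l"
        unfolding b(2)[symmetric] by (simp only: mod_add_left_eq)
      also have "b + i + 1 = i + l" using 1 by simp
      finally have "(j + 1) mod l = i" using ij by simp
      then show ?thesis by (simp add: arc_3)
    next
      case 2
      have "(j + 2) mod l = (b + i + 2) mod l"
        unfolding b(2)[symmetric] by (simp only: mod_add_left_eq)
      also have "b + i + 2 = i + l" using 2 by simp
      finally have "(j + 2) mod l = i" using ij by simp
      then show ?thesis by (simp add: arc_3)
    qed
    then show False using disj ij by (auto simp: arc_3)
  qed
  moreover have "F = rot l i ` {0, 1, b, Suc b}"
    using b ij rot_pair[where l = l and r = i and a = 0] rot_pair[where l = l and r = i and a = b]
    by (auto simp: arc_2)
  ultimately show ?thesis by (rule that)
qed

lemma double_arcs_card: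
  assumes "F \<in> double_arcs l" shows "card F = 4 \<and> 4 < l"
proof -
  obtain r b where b: "3 \<le> b" "b + 2 < l" "F = rot l r ` {0, 1, b, Suc b}"
    using assms by (rule double_arcs_normal)
  have "inj_on (rot l r) {0, 1, b, Suc b}"
    by (rule inj_on_subset[OF inj_on_rot]) (use b in auto)
  then have "card F = card {0, 1, b, Suc b}"
    unfolding b(3) by (rule card_image)
  then show ?thesis using b by simp
qed

lemma Suc_mod_inj:
  assumes "x < l" "y < l" "Suc x mod l = Suc y mod l" shows "x = (y::nat)"
  by (rule inj_onD[OF inj_on_rot[of l 1]]) (use assms in simp_all)

text \<open>An arc has a single end, whereas a member of \<open>double_arcs l\<close> has two.\<close>
lemma single_double_disjoint: "F \<in> single_arcs l k \<Longrightarrow> F \<notin> double_arcs l"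
proof
  assume F: "F \<in> single_arcs l k" "F \<in> double_arcs l"
  obtain i where i: "i < l" "2 * k < l" "F = arc l i (2 * k)"
    using F(1) by (auto simp: single_arcs_def)
  have ends: "x = (i + 2 * k - 1) mod l" if x: "x \<in> F" "Suc x mod l \<notin> F" for x
  proof -
    obtain j where j: "j < 2 * k" "x = (i + j) mod l"
      using x(1) i by (auto simp: arc_def)
    have "\<not> Suc j < 2 * k"
    proof (rule notI)
      assume "Suc j < 2 * k"
      then have "Suc x mod l \<in> F"
        unfolding i(3) arc_def j(2) by (intro image_eqI[of _ _ "Suc j"]) (auto simp: mod_simps)
      with x show False by simp
    qed
    then have "j = 2 * k - 1" using j by linarith
    then show ?thesis using j by simp
  qed
  obtain a b where ab: "a < l" "b < l" "arc l a 3 \<inter> arc l b 3 = {}" "F = arc l a 2 \<union> arc l b 2"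
    using F(2) by (auto simp: double_arcs_def)
  have neq: "Suc x mod l \<noteq> x" if "x < l" for x
    using double_arcs_card[OF F(2)] that by (cases "Suc x = l") auto
  have end2: "Suc x mod l \<in> F" "Suc (Suc x) mod l \<notin> F"
    if xy: "F = arc l x 2 \<union> arc l y 2" "arc l x 3 \<inter> arc l y 3 = {}" "x < l" "y < l" for x y
  proof -
    have "4 < l" using double_arcs_card[OF F(2)] by simp
    then have 1: "Suc (Suc x) mod l \<noteq> Suc x mod l" "Suc (Suc x) mod l \<noteq> x mod l"
      using neq[of "Suc x mod l"] xy(3) by (auto simp: mod_Suc split: if_splits)
    have 2: "Suc (Suc x) mod l \<notin> arc l y 3"
      using xy(2) arc_3[of l x] by blast
    show "Suc x mod l \<in> F" unfolding xy(1) arc_2 by simp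
    show "Suc (Suc x) mod l \<notin> F"
      using 1 2 unfolding xy(1) arc_2 arc_3 by simp
  qed
  have "Suc a mod l = (i + 2 * k - 1) mod l" "Suc b mod l = (i + 2 * k - 1) mod l"
    using end2[OF ab(4,3,1,2)] end2[of b a] ab ends[of "Suc a mod l"] ends[of "Suc b mod l"]
    by (simp_all add: mod_simps Int_commute Un_commute)
  then have "Suc a mod l = Suc b mod l" by simp
  then have "a = b" using Suc_mod_inj ab(1,2) by blast
  then show False using ab(3) by (auto simp: arc_3)
qed

section \<open>Kernels of small norm and the contribution of an edge pattern\<close>

locale contracting_kernel = skew_kernel +
  fixes e :: real
  assumes e: "0 \<le> e" "e \<le> 1"
    and contracting: "\<And>v. ip n (act n M v) (act n M v) \<le> e\<^sup>2 * ip n v v"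
begin

lemma e2: "0 \<le> e\<^sup>2" "e\<^sup>2 \<le> 1"
  using e by (auto simp: power_le_one)

lemma nrm_Suc_le: "nrm (Suc j) v \<le> e\<^sup>2 * nrm j v"
  using contracting by (simp add: nrm_def)

lemma nrm_antimono: "i \<le> j \<Longrightarrow> nrm j v \<le> nrm i v"
proof (induction rule: dec_induct)
  case (step j)
  have "e\<^sup>2 * nrm j v \<le> 1 * nrm j v"
    by (intro mult_right_mono e2) simp
  then show ?case using step nrm_Suc_le[of j v] by linarith
qed simp

lemma nrm_le_strict: assumes "i < j" shows "nrm j v \<le> e\<^sup>2 * nrm i v"
  using nrm_antimono[of "Suc i" j v] nrm_Suc_le[of i v] assms by simp

lemma P_le_one: "P k \<le> 1"
  using nrm_antimono[of 0 k ones] P_0 by (simp add: P_def)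

lemma P_le_e2: "1 \<le> k \<Longrightarrow> P k \<le> e\<^sup>2"
  using nrm_le_strict[of 0 k ones] P_0 by (simp add: P_def)

lemma P_le_P1: "1 \<le> k \<Longrightarrow> P k \<le> P 1"
  using nrm_antimono[of 1 k ones] by (simp add: P_def)

lemma P_le_e2_P1: "2 \<le> k \<Longrightarrow> P k \<le> e\<^sup>2 * P 1"
  using nrm_le_strict[of 1 k ones] by (simp add: P_def)

text \<open>Unless both runs are as short as possible, one of the indices is at least 2 and gains a
  factor \<open>e\<^sup>2\<close>.\<close>

lemma P_product_small:
  assumes "1 \<le> k" "1 \<le> m" "\<not> (k = 1 \<and> m = 1)"
  shows "P k * P m \<le> e\<^sup>2 * (P 1)\<^sup>2"
proof -
  consider "2 \<le> k" | "2 \<le> m" using assms by linarith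
  then show ?thesis
  proof cases
    case 1
    have "P k * P m \<le> (e\<^sup>2 * P 1) * P 1"
      by (intro mult_mono P_le_e2_P1 P_le_P1) (use 1 assms in auto)
    then show ?thesis by (simp add: power2_eq_square mult_ac)
  next
    case 2
    have "P k * P m \<le> P 1 * (e\<^sup>2 * P 1)"
      by (intro mult_mono P_le_e2_P1 P_le_P1) (use 2 assms in auto)
    then show ?thesis by (simp add: power2_eq_square mult_ac)
  qed
qed

definition run_value :: "nat \<Rightarrow> real" where "run_value j = ip n ones (iter j ones)"

lemma run_value_0 [simp]: "run_value 0 = 1"
  using n_pos by (simp add: run_value_def ip_one_one)

lemma run_value_odd: "odd j \<Longrightarrow> run_value j = 0"
  by (simp add: run_value_def ip_iter_odd)

lemma run_value_even: "run_value (2 * k) = (-1) ^ k * P k"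
  by (simp add: run_value_def ip_iter_even P_def)

lemma run_value_abs_le_one: "\<bar>run_value j\<bar> \<le> 1"
  using P_le_one by (cases "even j") (auto simp: run_value_odd run_value_even abs_mult elim!: evenE)

lemma run_value_abs_le_e2: "1 \<le> j \<Longrightarrow> \<bar>run_value j\<bar> \<le> e\<^sup>2"
  using P_le_e2 e2 by (cases "even j") (auto simp: run_value_odd run_value_even abs_mult elim!: evenE)

definition mixed :: "nat set \<Rightarrow> nat \<Rightarrow> nat \<Rightarrow> nat \<Rightarrow> real" where
  "mixed F i = (if i \<in> F then M else (\<lambda>_ _. 1 / real n))"

lemma mixed_in: "i \<in> F \<Longrightarrow> mixed F i = M"
  and mixed_notin: "i \<notin> F \<Longrightarrow> mixed F i = (\<lambda>_ _. 1 / real n)"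
  by (simp_all add: mixed_def)

text \<open>The term of the expanded product that belongs to \<open>F\<close>, stripped of its signs
  and of the factors 1/2.\<close>

definition tau :: "nat \<Rightarrow> nat set \<Rightarrow> real" where
  "tau l F = cyc_sum n l (mixed F)"

text \<open>The possible shapes of the part of \<open>F\<close> below \<open>i\<close>, when its last \<open>j\<close> elements form an unfinished
  run and \<open>c\<close> is the product of the contributions of the finished ones.\<close>
definition shape :: "nat set \<Rightarrow> nat \<Rightarrow> real \<Rightarrow> nat \<Rightarrow> bool" where
  "shape F i c j \<longleftrightarrow> j \<le> i \<and>
     (F \<inter> {..<i} = {i - j..<i} \<and> c = 1 \<or>
      (\<exists>a k. 1 \<le> k \<and> a + 2 * k < i - j \<and> F \<inter> {..<i} = {a..<a + 2 * k} \<union> {i - j..<i} \<and>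
         c = (-1) ^ k * P k) \<or>
      (\<exists>a b. a + 2 < b \<and> b + 2 < i - j \<and> F \<inter> {..<i} = {a, Suc a, b, Suc b} \<union> {i - j..<i} \<and>
         c = (P 1)\<^sup>2) \<or>
      \<bar>c\<bar> \<le> e\<^sup>2 * (P 1)\<^sup>2)"

lemma shape_cases:
  assumes "shape F i c j"
  obtains (none) "F \<inter> {..<i} = {i - j..<i}" "c = 1"
    | (single) a k where "1 \<le> k" "a + 2 * k < i - j" "F \<inter> {..<i} = {a..<a + 2 * k} \<union> {i - j..<i}"
        "c = (-1) ^ k * P k"
    | (double) a b where "a + 2 < b" "b + 2 < i - j" "F \<inter> {..<i} = {a, Suc a, b, Suc b} \<union> {i - j..<i}"
        "c = (P 1)\<^sup>2"
    | (small) "\<bar>c\<bar> \<le> e\<^sup>2 * (P 1)\<^sup>2"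
  using assms unfolding shape_def by blast

lemma shape_none: "j \<le> i \<Longrightarrow> F \<inter> {..<i} = {i - j..<i} \<Longrightarrow> shape F i 1 j"
  by (simp add: shape_def)

lemma shape_single:
  "j \<le> i \<Longrightarrow> 1 \<le> k \<Longrightarrow> a + 2 * k < i - j \<Longrightarrow> F \<inter> {..<i} = {a..<a + 2 * k} \<union> {i - j..<i} \<Longrightarrow>
     shape F i ((-1) ^ k * P k) j"
  unfolding shape_def by blast

lemma shape_double:
  "j \<le> i \<Longrightarrow> a + 2 < b \<Longrightarrow> b + 2 < i - j \<Longrightarrow> F \<inter> {..<i} = {a, Suc a, b, Suc b} \<union> {i - j..<i} \<Longrightarrow>
     shape F i ((P 1)\<^sup>2) j"
  unfolding shape_def by blast

lemma shape_small: "j \<le> i \<Longrightarrow> \<bar>c\<bar> \<le> e\<^sup>2 * (P 1)\<^sup>2 \<Longrightarrow> shape F i c j"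
  by (simp add: shape_def)

text \<open>An edge of \<open>F\<close> only lengthens the unfinished run: \<open>i\<close> and
  \<open>j\<close> grow together, so the start \<open>i - j\<close> and the finished part stay
  put.\<close>

lemma shape_in:
  assumes "shape F i c j" "i \<in> F" shows "shape F (Suc i) c (Suc j)"
proof -
  have ji: "j \<le> i" using assms(1) by (simp add: shape_def)
  have F: "F \<inter> {..<Suc i} = insert i (F \<inter> {..<i})" "{Suc i - Suc j..<Suc i} = insert i {i - j..<i}"
    using assms(2) ji by (auto simp: less_Suc_eq)
  from assms(1) show ?thesis
  proof (cases rule: shape_cases)
    case none
    then show ?thesis using shape_none[of "Suc j" "Suc i" F] F ji by simp
  next
    case (single a k)
    have "F \<inter> {..<Suc i} = {a..<a + 2 * k} \<union> {Suc i - Suc j..<Suc i}"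
      unfolding F single(3) by blast
    with single ji show ?thesis using shape_single[of "Suc j" "Suc i" k a F] by simp
  next
    case (double a b)
    have "F \<inter> {..<Suc i} = {a, Suc a, b, Suc b} \<union> {Suc i - Suc j..<Suc i}"
      unfolding F double(3) by blast
    with double ji show ?thesis using shape_double[of "Suc j" "Suc i" a b F] by simp
  next
    case small
    then show ?thesis using shape_small ji by simp
  qed
qed

text \<open>An edge outside \<open>F\<close> finishes the current run. An odd run kills the product;
  a first run of length \<open>2 * m\<close> gives a single pattern; two runs of length 2 give a
  double pattern; any other new run makes the product small, and small products remain
  small.\<close>

lemma shape_notin:
  assumes sh: "shape F i c j" and "i \<notin> F" shows "shape F (Suc i) (c * run_value j) 0"
proof -
  have ji: "j \<le> i" using sh by (simp add: shape_def)
  have F: "F \<inter> {..<Suc i} = F \<inter> {..<i}"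
    using assms(2) by (auto simp: less_Suc_eq)
  consider (0) "j = 0" | (odd) "odd j" | (even) m where "1 \<le> m" "j = 2 * m"
    by (cases "j = 0"; cases "even j") (auto elim!: evenE)
  then show ?thesis
  proof cases
    case 0
    from sh show ?thesis
    proof (cases rule: shape_cases)
      case none
      then show ?thesis using shape_none[of 0 "Suc i" F] 0 F by simp
    next
      case (single a k)
      then show ?thesis using shape_single[of 0 "Suc i" k a F] 0 F by simp
    next
      case (double a b)
      then show ?thesis using shape_double[of 0 "Suc i" a b F] 0 F by simp
    next
      case small
      then show ?thesis using 0 by (simp add: shape_small)
    qed
  next
    case odd
    then show ?thesis by (simp add: run_value_odd shape_small e2)
  next
    case even
    from sh show ?thesis
    proof (cases rule: shape_cases)
      case none
      have "F \<inter> {..<Suc i} = {i - j..<i - j + 2 * m} \<union> {Suc i - 0..<Suc i}"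
        using none even ji by (simp add: F)
      then show ?thesis
        using shape_single[of 0 "Suc i" m "i - j" F] none even ji by (simp add: run_value_even)
    next
      case (single a k)
      show ?thesis
      proof (cases "k = 1 \<and> m = 1")
        case True
        have "{i - j..<i} = {i - j, Suc (i - j)}" "{a..<a + 2 * k} = {a, Suc a}"
          using True even ji by auto
        then have "F \<inter> {..<Suc i} = {a, Suc a, i - j, Suc (i - j)} \<union> {Suc i - 0..<Suc i}"
          unfolding F single(3) by auto
        moreover have "c * run_value j = (P 1)\<^sup>2"
          using single True even run_value_even[of 1] by (simp add: power2_eq_square)
        ultimately show ?thesis
          using shape_double[of 0 "Suc i" a "i - j" F] single True even ji by simp
      next
        case False
        then have "\<bar>c * run_value j\<bar> \<le> e\<^sup>2 * (P 1)\<^sup>2"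
          using P_product_small[of k m] single even by (simp add: run_value_even abs_mult)
        then show ?thesis by (simp add: shape_small)
      qed
    next
      case double
      have "\<bar>c * run_value j\<bar> \<le> (P 1)\<^sup>2 * e\<^sup>2"
        unfolding abs_mult double(4) by (intro mult_mono run_value_abs_le_e2) (use even in auto)
      then show ?thesis by (simp add: shape_small mult.commute)
    next
      case small
      have "\<bar>c * run_value j\<bar> \<le> (e\<^sup>2 * (P 1)\<^sup>2) * 1"
        unfolding abs_mult using small e2 by (intro mult_mono run_value_abs_le_one) auto
      then show ?thesis by (simp add: shape_small)
    qed
  qed
qed

text \<open>Each averaging edge resets the vector to a constant, so at any time it is a multiple of
  \<open>M\<^sup>j 1\<close>, where \<open>j\<close> is the length of the current run.\<close>

lemma trail_shape: "\<exists>c j. trail n (mixed F) ones i = (\<lambda>y. c * iter j ones y) \<and> shape F i c j"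
proof (induction i)
  case 0
  have "shape F 0 1 0" by (simp add: shape_def)
  then show ?case by (intro exI[of _ 1] exI[of _ 0]) simp
next
  case (Suc i)
  then obtain c j where cj: "trail n (mixed F) ones i = (\<lambda>y. c * iter j ones y)" "shape F i c j"
    by blast
  show ?case
  proof (cases "i \<in> F")
    case True
    then show ?thesis
      using cj shape_in[OF cj(2) True]
      by (intro exI[of _ c] exI[of _ "Suc j"]) (simp add: mixed_in True act_scale)
  next
    case False
    then show ?thesis
      using cj shape_notin[OF cj(2) False]
      by (intro exI[of _ "c * run_value j"] exI[of _ 0]) (simp add: mixed_notin False act_average run_value_def)
  qed
qed

lemma tau_shape:
  assumes "0 < l" "l - 1 \<notin> F" shows "shape F l (tau l F) 0"
proof -
  obtain c j where cj: "trail n (mixed F) ones (l - 1) = (\<lambda>y. c * iter j ones y)" "shape F (l - 1) c j"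
    using trail_shape by blast
  have "tau l F = c * run_value j"
    unfolding tau_def using assms cj by (subst cyc_sum_const_last) (auto simp: mixed_notin run_value_def)
  then show ?thesis
    using shape_notin[OF cj(2) assms(2)] assms(1) by simp
qed

section \<open>Normalising a pattern by rotation\<close>

lemma tau_rot:
  assumes l: "0 < l" and G: "G \<subseteq> {..<l}"
  shows "tau l (rot l r ` G) = tau l G"
proof -
  have "mixed (rot l r ` G) ((i + r) mod l) = mixed G i" if "i < l" for i
  proof -
    have "(i + r) mod l \<in> rot l r ` G \<longleftrightarrow> i \<in> G"
      using inj_on_image_mem_iff[OF inj_on_rot[OF l, where r = r], of i G] that G by auto
    then show ?thesis by (simp add: mixed_def)
  qed
  then have "tau l G = cyc_sum n l (\<lambda>i. mixed (rot l r ` G) ((i + r) mod l))"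
    unfolding tau_def cyc_sum_def by simp
  then show ?thesis
    by (simp add: cyc_sum_rotate[OF l] tau_def)
qed

lemma obtain_rot:
  assumes F: "F \<subseteq> {..<l}" "r < l" "r \<notin> F"
  obtains G q where "G \<subseteq> {..<l}" "l - 1 \<notin> G" "F = rot l q ` G"
proof
  \<comment> \<open>Shifting by \<open>Suc r\<close> carries \<open>l - 1\<close> to the missed edge
    \<open>r\<close>, so the closing edge becomes a missed one.\<close>
  define G where "G = {i. i < l \<and> rot l (Suc r) i \<in> F}"
  show "G \<subseteq> {..<l}" by (auto simp: G_def)
  show "l - 1 \<notin> G" using F by (simp add: G_def)
  have full: "rot l (Suc r) ` {..<l} = {..<l}"
    using bij_betw_add_mod[of l "Suc r"] F by (simp add: bij_betw_def)
  show "F = rot l (Suc r) ` G"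
  proof (intro Set.set_eqI iffI)
    fix x assume x: "x \<in> F"
    then have "x \<in> rot l (Suc r) ` {..<l}"
      unfolding full using F(1) by blast
    then obtain i where i: "i < l" "x = rot l (Suc r) i" by (rule imageE) simp
    with x have "i \<in> G" by (simp add: G_def)
    with i show "x \<in> rot l (Suc r) ` G" by blast
  qed (auto simp: G_def)
qed

text \<open>A proper subset misses an edge. With that edge rotated to the end, the scan by
  \<open>trail_shape\<close> covers the whole pattern and ends with no unfinished run, so the four
  shapes become the four alternatives.\<close>

lemma tau_classification:
  assumes F: "F \<subset> {..<l}"
  shows "F = {} \<or> (\<exists>k\<ge>1. F \<in> single_arcs l k) \<or> F \<in> double_arcs l \<or> \<bar>tau l F\<bar> \<le> e\<^sup>2 * (P 1)\<^sup>2"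
proof -
  obtain r where r: "r < l" "r \<notin> F" using psubset_imp_ex_mem[OF F] by blast
  then have l: "0 < l" by simp
  obtain G q where G: "G \<subseteq> {..<l}" "l - 1 \<notin> G" "F = rot l q ` G"
    using F r by (metis obtain_rot psubset_imp_subset)
  have tau: "tau l F = tau l G" unfolding G(3) using tau_rot l G by simp
  have "G \<inter> {..<l} = G" using G by auto
  then consider (A) "G = {}"
    | (B) a k where "1 \<le> k" "a + 2 * k < l" "G = {a..<a + 2 * k}"
    | (C) a b where "a + 2 < b" "b + 2 < l" "G = {a, Suc a, b, Suc b}"
    | (D) "\<bar>tau l F\<bar> \<le> e\<^sup>2 * (P 1)\<^sup>2"
    using tau_shape[OF l G(2)] unfolding shape_def tau by auto
  then show ?thesis
  proof cases
    case B
    then have "F \<in> single_arcs l k"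
      unfolding single_arcs_def G(3) B(3) rot_interval
      by (intro CollectI exI[of _ "(a + q) mod l"] conjI refl) (use B l in auto)
    with B show ?thesis by auto
  next
    case C
    have "arc l ((a + q) mod l) 3 \<inter> arc l ((b + q) mod l) 3 = {}"
    proof -
      have "rot l q ` {a..<a + 3} \<inter> rot l q ` {b..<b + 3} = rot l q ` ({a..<a + 3} \<inter> {b..<b + 3})"
        by (rule inj_on_image_Int[OF inj_on_rot[OF l], symmetric]) (use C in auto)
      also have "{a..<a + 3} \<inter> {b..<b + 3} = {}" using C(1) by auto
      finally show ?thesis by (simp only: rot_interval image_empty)
    qed
    moreover have "F = arc l ((a + q) mod l) 2 \<union> arc l ((b + q) mod l) 2"
      unfolding G(3) C(3) rot_pair[symmetric] by auto
    ultimately have "F \<in> double_arcs l"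
      unfolding double_arcs_def
      by (intro CollectI exI[of _ "(a + q) mod l"] exI[of _ "(b + q) mod l"] conjI) (use l in auto)
    then show ?thesis by simp
  qed (use G in auto)
qed

section \<open>Exact values of the surviving patterns\<close>

lemma trail_run:
  assumes "\<And>j. j < m \<Longrightarrow> i + j \<in> F"
  shows "trail n (mixed F) ones (i + m) = iter m (trail n (mixed F) ones i)"
  using assms by (induction m) (simp_all add: mixed_in)

text \<open>The first averaging edge replaces the vector by its mean; the further ones fix
  constants.\<close>

lemma trail_gap:
  assumes "trail n (mixed F) ones i = (\<lambda>y. c * iter j ones y)" "i < i'"
    and gap: "\<And>x. i \<le> x \<Longrightarrow> x < i' \<Longrightarrow> x \<notin> F"
  shows "trail n (mixed F) ones i' = (\<lambda>_. c * run_value j)"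
proof -
  have "trail n (mixed F) ones (Suc i + m) = (\<lambda>_. c * run_value j)" if "i + m < i'" for m
    using that
  proof (induction m)
    case 0
    then show ?case
      using assms(1) gap[of i] by (simp add: mixed_notin act_average run_value_def)
  next
    case (Suc m)
    then have "Suc i + m \<notin> F" using gap by simp
    then show ?case using Suc n_pos by (simp add: mixed_notin act_average ip_one_const)
  qed
  from this[of "i' - Suc i"] assms(2) show ?thesis by simp
qed

lemma tau_eq_trail:
  assumes "0 < l" "l - 1 \<notin> F" shows "trail n (mixed F) ones l = (\<lambda>_. tau l F)"
proof -
  obtain m where m: "l = Suc m" using assms by (cases l) auto
  have "tau l F = ip n ones (trail n (mixed F) ones (l - 1))"
    unfolding tau_def using assms by (subst cyc_sum_const_last) (auto simp: mixed_notin)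
  then show ?thesis
    using assms by (simp add: m mixed_notin act_average)
qed

lemma tau_empty: "0 < l \<Longrightarrow> tau l {} = 1"
  using trail_gap[of "{}" 0 1 0 l] tau_eq_trail[of l "{}"] by (simp add: fun_eq_iff)

lemma tau_single:
  assumes "F \<in> single_arcs l k" shows "tau l F = (-1) ^ k * P k"
proof -
  obtain i where i: "i < l" "2 * k < l" "F = arc l i (2 * k)"
    using assms by (auto simp: single_arcs_def)
  define G where "G = {0..<0 + 2 * k}"
  have F: "F = rot l i ` G"
    unfolding G_def rot_interval using i by simp
  have "tau l F = tau l G"
    unfolding F by (rule tau_rot) (use i in \<open>auto simp: G_def\<close>)
  have "trail n (mixed G) ones (0 + 2 * k) = iter (2 * k) (trail n (mixed G) ones 0)"
    by (rule trail_run) (auto simp: G_def)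
  then have "trail n (mixed G) ones (2 * k) = (\<lambda>y. 1 * iter (2 * k) ones y)"
    by (simp only: add_0 trail.simps mult_1)
  then have "trail n (mixed G) ones l = (\<lambda>_. 1 * run_value (2 * k))"
    by (rule trail_gap) (use i in \<open>auto simp: G_def\<close>)
  moreover have "trail n (mixed G) ones l = (\<lambda>_. tau l G)"
    by (rule tau_eq_trail) (use i in \<open>auto simp: G_def\<close>)
  ultimately have "tau l G = 1 * run_value (2 * k)"
    by (simp only: fun_eq_iff)
  with \<open>tau l F = tau l G\<close> show ?thesis by (simp add: run_value_even)
qed

lemma tau_double:
  assumes "F \<in> double_arcs l" shows "tau l F = (P 1)\<^sup>2"
proof -
  obtain r b where b: "3 \<le> b" "b + 2 < l" "F = rot l r ` {0, 1, b, Suc b}"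
    using assms by (rule double_arcs_normal)
  define G where "G = {0, 1, b, Suc b}"
  have "tau l F = tau l G"
    unfolding b(3) G_def by (rule tau_rot) (use b in auto)
  have "trail n (mixed G) ones (0 + 2) = iter 2 (trail n (mixed G) ones 0)"
    by (rule trail_run) (auto simp: G_def)
  then have "trail n (mixed G) ones 2 = (\<lambda>y. 1 * iter 2 ones y)"
    by (simp only: add_0 trail.simps mult_1)
  then have 1: "trail n (mixed G) ones b = (\<lambda>_. 1 * run_value 2)"
    by (rule trail_gap) (use b in \<open>auto simp: G_def\<close>)
  have "trail n (mixed G) ones (b + 2) = iter 2 (trail n (mixed G) ones b)"
    by (rule trail_run) (auto simp: G_def less_2_cases_iff)
  also have "\<dots> = (\<lambda>y. run_value 2 * iter 2 ones y)"
    unfolding 1 using iter_scale[of 2 "run_value 2" ones] by (simp only: mult_1 mult_1_right)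
  finally have "trail n (mixed G) ones l = (\<lambda>_. run_value 2 * run_value 2)"
    by (rule trail_gap) (use b in \<open>auto simp: G_def\<close>)
  moreover have "trail n (mixed G) ones l = (\<lambda>_. tau l G)"
    by (rule tau_eq_trail) (use b in \<open>auto simp: G_def\<close>)
  ultimately have "tau l G = run_value 2 * run_value 2"
    by (simp only: fun_eq_iff)
  with \<open>tau l F = tau l G\<close> show ?thesis
    using run_value_even[of 1] by (simp add: power2_eq_square)
qed

end

section \<open>Expansion of the cyclic sum\<close>

definition single_sum :: "nat \<Rightarrow> (nat \<Rightarrow> real) \<Rightarrow> nat \<Rightarrow> real" where
  "single_sum l s k = (\<Sum>F\<in>single_arcs l k. \<Prod>i\<in>F. s i)"

definition double_sum :: "nat \<Rightarrow> (nat \<Rightarrow> real) \<Rightarrow> real" where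
  "double_sum l s = (\<Sum>F\<in>double_arcs l. \<Prod>i\<in>F. s i)"

lemma single_arcs_subset_Pow: "single_arcs l k \<subseteq> Pow {..<l}"
  by (auto simp: single_arcs_def arc_def)

lemma double_arcs_subset_Pow: "double_arcs l \<subseteq> Pow {..<l}"
  by (auto simp: double_arcs_def arc_def)

context contracting_kernel
begin

lemma cyc_sum_expand:
  "cyc_sum n l (\<lambda>i x y. 1 / (2 * real n) + s i * M x y)
     = (\<Sum>F\<in>Pow {..<l}. (1 / 2) ^ (l - card F) * (\<Prod>i\<in>F. s i) * tau l F)"
proof -
  have "cyc_sum n l (\<lambda>i x y. 1 / (2 * real n) + s i * M x y)
      = (\<Sum>\<phi>\<in>{..<l} \<rightarrow>\<^sub>E {..<n}. \<Sum>F\<in>Pow {..<l}. (1 / 2) ^ (l - card F) * (\<Prod>i\<in>F. s i) *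
           (\<Prod>i<l. mixed F i (\<phi> i) (\<phi> (Suc i mod l))))"
    unfolding cyc_sum_def
  proof (rule sum.cong[OF refl])
    fix \<phi> :: "nat \<Rightarrow> nat"
    let ?m = "\<lambda>i. M (\<phi> i) (\<phi> (Suc i mod l))"
    have "(\<Prod>i<l. 1 / (2 * real n) + s i * ?m i) = (\<Prod>i<l. s i * ?m i + (1 / 2) * (1 / real n))"
      by (simp add: add.commute)
    also have "\<dots> = (\<Sum>F\<in>Pow {..<l}. (\<Prod>i\<in>F. s i * ?m i) * (\<Prod>i\<in>{..<l} - F. (1 / 2) * (1 / real n)))"
      by (rule prod_add) simp
    also have "\<dots> = (\<Sum>F\<in>Pow {..<l}. (1 / 2) ^ (l - card F) * (\<Prod>i\<in>F. s i) *
           (\<Prod>i<l. mixed F i (\<phi> i) (\<phi> (Suc i mod l))))"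
    proof (rule sum.cong[OF refl])
      fix F assume "F \<in> Pow {..<l}"
      then have F: "F \<subseteq> {..<l}" "finite F" by (auto intro: finite_subset)
      have "(\<Prod>i<l. mixed F i (\<phi> i) (\<phi> (Suc i mod l)))
          = (\<Prod>i\<in>{..<l} - F. mixed F i (\<phi> i) (\<phi> (Suc i mod l))) *
            (\<Prod>i\<in>F. mixed F i (\<phi> i) (\<phi> (Suc i mod l)))"
        by (rule prod.subset_diff) (use F in auto)
      also have "(\<Prod>i\<in>{..<l} - F. mixed F i (\<phi> i) (\<phi> (Suc i mod l))) = (1 / real n) ^ (l - card F)"
        using F by (simp add: mixed_notin card_Diff_subset)
      also have "(\<Prod>i\<in>F. mixed F i (\<phi> i) (\<phi> (Suc i mod l))) = (\<Prod>i\<in>F. ?m i)"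
        by (simp add: mixed_in)
      finally show "(\<Prod>i\<in>F. s i * ?m i) * (\<Prod>i\<in>{..<l} - F. (1 / 2) * (1 / real n))
          = (1 / 2) ^ (l - card F) * (\<Prod>i\<in>F. s i) * (\<Prod>i<l. mixed F i (\<phi> i) (\<phi> (Suc i mod l)))"
        using F by (simp add: prod.distrib card_Diff_subset power_mult_distrib power_divide)
    qed
    finally show "(\<Prod>i<l. 1 / (2 * real n) + s i * ?m i) = \<dots>" .
  qed
  also have "\<dots> = (\<Sum>F\<in>Pow {..<l}. (1 / 2) ^ (l - card F) * (\<Prod>i\<in>F. s i) * tau l F)"
    by (subst sum.swap) (simp add: tau_def cyc_sum_def sum_distrib_left)
  finally show ?thesis .
qed

text \<open>Every part is an indicator of a family of sets, even of the singleton families, so that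
  \<open>sum_Pow_indicator\<close> evaluates all of them in the same way.\<close>

definition approx :: "nat \<Rightarrow> nat set \<Rightarrow> real" where
  "approx l F = (if F \<in> {{}} then 1 else 0) + (if F \<in> {{..<l}} then tau l {..<l} else 0) +
     (\<Sum>k=1..<l. if F \<in> single_arcs l k then (-1) ^ k * P k else 0) +
     (if F \<in> double_arcs l then (P 1)\<^sup>2 else 0)"

text \<open>For positive \<open>k\<close> no two of the indicators overlap: cardinalities separate
  all the families except a single from a double pattern, and \<open>single_double_disjoint\<close>
  separates those.\<close>

lemma approx_eq:
  assumes l: "0 < l"
  shows "approx l {} = 1" and "approx l {..<l} = tau l {..<l}"
    and "1 \<le> k \<Longrightarrow> F \<in> single_arcs l k \<Longrightarrow> approx l F = (-1) ^ k * P k"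
    and "F \<in> double_arcs l \<Longrightarrow> approx l F = (P 1)\<^sup>2"
    and "F \<noteq> {} \<Longrightarrow> F \<noteq> {..<l} \<Longrightarrow> (\<And>k. 1 \<le> k \<Longrightarrow> F \<notin> single_arcs l k) \<Longrightarrow> F \<notin> double_arcs l \<Longrightarrow>
       approx l F = 0"
proof -
  have single: "F \<noteq> {} \<and> F \<noteq> {..<l} \<and> F \<notin> double_arcs l \<and> k < l" if "F \<in> single_arcs l k" "1 \<le> k" for F k
  proof -
    have "2 * k < l" using that(1) unfolding single_arcs_def by blast
    then show ?thesis
      using single_arcs_card[OF that(1)] single_double_disjoint[OF that(1)] that(2) by auto
  qed
  have double: "F \<noteq> {} \<and> F \<noteq> {..<l}" if "F \<in> double_arcs l" for F
    using double_arcs_card[OF that] by auto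
  have no_single: "(\<Sum>k=1..<l. if F \<in> single_arcs l k then (-1) ^ k * P k else 0) = 0"
    if "\<And>k. 1 \<le> k \<Longrightarrow> F \<notin> single_arcs l k" for F
    using that by (intro sum.neutral) auto
  have ns: "(\<Sum>k=1..<l. if {} \<in> single_arcs l k then (-1) ^ k * P k else 0) = 0"
    "(\<Sum>k=1..<l. if {..<l} \<in> single_arcs l k then (-1) ^ k * P k else 0) = 0"
    by (rule no_single; use single in blast)+
  show "approx l {} = 1"
    using l ns double[of "{}"] unfolding approx_def by auto
  show "approx l {..<l} = tau l {..<l}"
    using l ns double[of "{..<l}"] unfolding approx_def by auto
  show "approx l F = (P 1)\<^sup>2" if F: "F \<in> double_arcs l"
  proof -
    have "(\<Sum>k=1..<l. if F \<in> single_arcs l k then (-1) ^ k * P k else 0) = 0"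
      by (rule no_single) (use single F in blast)
    then show ?thesis using double[OF F] F by (simp add: approx_def)
  qed
  show "approx l F = (-1) ^ k * P k" if F: "1 \<le> k" "F \<in> single_arcs l k"
  proof -
    have "F \<in> single_arcs l m \<longleftrightarrow> m = k" for m
      using single_arcs_card[of F l m] single_arcs_card[OF F(2)] F(2) by auto
    then have "(\<Sum>m=1..<l. if F \<in> single_arcs l m then (-1) ^ m * P m else 0) = (-1) ^ k * P k"
      using single[OF F(2,1)] F(1) by simp
    then show ?thesis using single[OF F(2,1)] by (simp add: approx_def)
  qed
  show "approx l F = 0" if "F \<noteq> {}" "F \<noteq> {..<l}" "\<And>k. 1 \<le> k \<Longrightarrow> F \<notin> single_arcs l k" "F \<notin> double_arcs l"
    using no_single[OF that(3)] that by (simp add: approx_def)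
qed

lemma tau_approx:
  assumes l: "0 < l" and F: "F \<subseteq> {..<l}"
  shows "\<bar>tau l F - approx l F\<bar> \<le> e\<^sup>2 * (P 1)\<^sup>2"
proof -
  have nonneg: "0 \<le> e\<^sup>2 * (P 1)\<^sup>2" by simp
  consider "F = {}" | "F = {..<l}" | k where "1 \<le> k" "F \<in> single_arcs l k" | "F \<in> double_arcs l"
    | "F \<noteq> {}" "F \<noteq> {..<l}" "\<And>k. 1 \<le> k \<Longrightarrow> F \<notin> single_arcs l k" "F \<notin> double_arcs l"
    by blast
  then show ?thesis
  proof cases
    case 5
    then have "\<bar>tau l F\<bar> \<le> e\<^sup>2 * (P 1)\<^sup>2"
      using tau_classification[of F l] F by blast
    then show ?thesis using approx_eq(5)[OF l] 5 by simp
  qed (use approx_eq[OF l] tau_empty[OF l] tau_single tau_double nonneg in simp_all)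
qed

lemma sum_Pow_indicator:
  fixes w :: "nat set \<Rightarrow> real"
  assumes "\<F> \<subseteq> Pow {..<l}"
  shows "(\<Sum>F\<in>Pow {..<l}. w F * (if F \<in> \<F> then v else 0)) = (\<Sum>F\<in>\<F>. w F) * v"
proof -
  have "(\<Sum>F\<in>Pow {..<l}. w F * (if F \<in> \<F> then v else 0)) = (\<Sum>F\<in>Pow {..<l}. if F \<in> \<F> then w F * v else 0)"
    by (rule sum.cong) auto
  also have "\<dots> = (\<Sum>F\<in>Pow {..<l} \<inter> \<F>. w F * v)"
    by (rule sum.inter_restrict[symmetric]) simp
  also have "Pow {..<l} \<inter> \<F> = \<F>" using assms by auto
  finally show ?thesis by (simp add: sum_distrib_right)
qed

text \<open>There are \<open>2 ^ l\<close> patterns of weight at most 1, and for each of them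
  \<open>tau\<close> differs from \<open>approx\<close> by at most
  \<open>e\<^sup>2 * (P 1)\<^sup>2\<close>.\<close>

lemma cyc_sum_approx:
  assumes l: "0 < l" and s: "\<And>i. \<bar>s i\<bar> = 1"
  shows "\<bar>cyc_sum n l (\<lambda>i x y. 1 / (2 * real n) + s i * M x y) - (1 / 2) ^ l
      - (\<Prod>i<l. s i) * tau l {..<l}
      - (\<Sum>k=1..<l. (1 / 2) ^ (l - 2 * k) * single_sum l s k * ((-1) ^ k * P k))
      - (1 / 2) ^ (l - 4) * double_sum l s * (P 1)\<^sup>2\<bar> \<le> 2 ^ l * (e\<^sup>2 * (P 1)\<^sup>2)"
proof -
  define w where "w F = (1 / 2) ^ (l - card F) * (\<Prod>i\<in>F. s i)" for F
  have w: "\<bar>w F\<bar> \<le> 1" for F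
    using s by (simp add: w_def abs_mult abs_prod power_abs power_le_one)
  have "(\<Sum>F\<in>Pow {..<l}. w F * approx l F)
      = (\<Sum>F\<in>Pow {..<l}. w F * (if F \<in> {{}} then 1 else 0)) +
        (\<Sum>F\<in>Pow {..<l}. w F * (if F \<in> {{..<l}} then tau l {..<l} else 0)) +
        (\<Sum>F\<in>Pow {..<l}. \<Sum>k=1..<l. w F * (if F \<in> single_arcs l k then (-1) ^ k * P k else 0)) +
        (\<Sum>F\<in>Pow {..<l}. w F * (if F \<in> double_arcs l then (P 1)\<^sup>2 else 0))"
    unfolding approx_def by (simp only: distrib_left sum.distrib sum_distrib_left)
  also have "(\<Sum>F\<in>Pow {..<l}. w F * (if F \<in> {{}} then 1 else 0)) = (1 / 2) ^ l"
    by (subst sum_Pow_indicator) (auto simp: w_def)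
  also have "(\<Sum>F\<in>Pow {..<l}. w F * (if F \<in> {{..<l}} then tau l {..<l} else 0)) = (\<Prod>i<l. s i) * tau l {..<l}"
    by (subst sum_Pow_indicator) (auto simp: w_def)
  also have "(\<Sum>F\<in>Pow {..<l}. \<Sum>k=1..<l. w F * (if F \<in> single_arcs l k then (-1) ^ k * P k else 0))
      = (\<Sum>k=1..<l. \<Sum>F\<in>Pow {..<l}. w F * (if F \<in> single_arcs l k then (-1) ^ k * P k else 0))"
    by (rule sum.swap)
  also have "\<dots> = (\<Sum>k=1..<l. (1 / 2) ^ (l - 2 * k) * single_sum l s k * ((-1) ^ k * P k))"
  proof (rule sum.cong[OF refl])
    fix k
    have "(\<Sum>F\<in>single_arcs l k. w F) = (1 / 2) ^ (l - 2 * k) * single_sum l s k"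
      unfolding single_sum_def sum_distrib_left w_def
      by (rule sum.cong) (auto dest: single_arcs_card)
    then show "(\<Sum>F\<in>Pow {..<l}. w F * (if F \<in> single_arcs l k then (-1) ^ k * P k else 0))
        = (1 / 2) ^ (l - 2 * k) * single_sum l s k * ((-1) ^ k * P k)"
      by (subst sum_Pow_indicator[OF single_arcs_subset_Pow]) simp
  qed
  also have "(\<Sum>F\<in>Pow {..<l}. w F * (if F \<in> double_arcs l then (P 1)\<^sup>2 else 0))
      = (1 / 2) ^ (l - 4) * double_sum l s * (P 1)\<^sup>2"
  proof -
    have "(\<Sum>F\<in>double_arcs l. w F) = (1 / 2) ^ (l - 4) * double_sum l s"
      unfolding double_sum_def sum_distrib_left w_def
      by (rule sum.cong) (auto dest: double_arcs_card)
    then show ?thesis by (subst sum_Pow_indicator[OF double_arcs_subset_Pow]) simp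
  qed
  finally have main: "(\<Sum>F\<in>Pow {..<l}. w F * approx l F)
      = (1 / 2) ^ l + (\<Prod>i<l. s i) * tau l {..<l}
        + (\<Sum>k=1..<l. (1 / 2) ^ (l - 2 * k) * single_sum l s k * ((-1) ^ k * P k))
        + (1 / 2) ^ (l - 4) * double_sum l s * (P 1)\<^sup>2" .
  have "\<bar>(\<Sum>F\<in>Pow {..<l}. w F * tau l F) - (\<Sum>F\<in>Pow {..<l}. w F * approx l F)\<bar>
      = \<bar>\<Sum>F\<in>Pow {..<l}. w F * (tau l F - approx l F)\<bar>"
    by (simp add: sum_subtractf right_diff_distrib)
  also have "\<dots> \<le> (\<Sum>F\<in>Pow {..<l}. 1 * (e\<^sup>2 * (P 1)\<^sup>2))"
    by (rule order_trans[OF sum_abs], rule sum_mono, unfold abs_mult, rule mult_mono)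
      (use w tau_approx[OF l] in auto)
  also have "\<dots> = 2 ^ l * (e\<^sup>2 * (P 1)\<^sup>2)"
    by (simp add: card_Pow)
  finally have "\<bar>(\<Sum>F\<in>Pow {..<l}. w F * tau l F) - (\<Sum>F\<in>Pow {..<l}. w F * approx l F)\<bar>
      \<le> 2 ^ l * (e\<^sup>2 * (P 1)\<^sup>2)" .
  moreover have "cyc_sum n l (\<lambda>i x y. 1 / (2 * real n) + s i * M x y) = (\<Sum>F\<in>Pow {..<l}. w F * tau l F)"
    unfolding w_def by (rule cyc_sum_expand)
  ultimately show ?thesis
    unfolding main by (simp only: diff_diff_eq add.assoc)
qed

lemma tau_full:
  assumes "0 < l"
  shows "tau l {..<l} = real n * (\<Sum>x<n. ip n (unit_fun x) (iter l (unit_fun x)))"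
proof -
  have "tau l {..<l} = cyc_sum n l (\<lambda>_. M)"
    unfolding tau_def cyc_sum_def by (intro sum.cong prod.cong) (auto simp: mixed_def)
  then show ?thesis using cyc_sum_const[OF assms] by simp
qed

text \<open>Here divisibility by 4 yields the sign: half of the \<open>4 * q\<close> factors are
  moved across the inner product, and their number \<open>2 * q\<close> is even.\<close>

lemma tau_full_four:
  assumes "0 < q"
  shows "tau (4 * q) {..<4 * q} = real n * (\<Sum>x<n. nrm (2 * q) (unit_fun x))"
  using tau_full[of "4 * q"] assms ip_iter_even[of _ "2 * q"] by simp

end

section \<open>Subgraphs of an oriented cycle\<close>

locale oriented_cycle =
  fixes l :: nat and S :: "(nat \<times> nat) set"
  assumes l: "3 \<le> l" and S: "S \<subseteq> parcs (directed_cycle l)"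
begin

abbreviation step :: "nat \<Rightarrow> nat" where "step x \<equiv> Suc x mod l"

definition C :: "nat pair_pre_digraph" where "C = reverse_arcs S (directed_cycle l)"

definition sg :: "nat \<Rightarrow> int" where "sg i = (if (i, step i) \<in> S then -1 else 1)"

definition oarc :: "nat \<Rightarrow> nat \<times> nat" where
  "oarc i = (if (i, step i) \<in> S then (step i, i) else (i, step i))"

definition sub :: "nat set \<Rightarrow> nat pair_pre_digraph" where
  "sub F = \<lparr> pverts = Field (oarc ` F), parcs = oarc ` F \<rparr>"

definition adj :: "nat set \<Rightarrow> nat \<Rightarrow> nat \<Rightarrow> bool" where
  "adj F u v \<longleftrightarrow> u \<in> F \<and> v = step u \<or> v \<in> F \<and> u = step v"

lemma step_less: "step x < l"
  using l by simp

lemma step_neq: "x < l \<Longrightarrow> step x \<noteq> x"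
  using l by (cases "Suc x = l") auto

text \<open>This rests on \<open>3 \<le> l\<close>: two different edges never join the same two
  vertices, so every edge has a well-defined clockwise direction.\<close>

lemma step_step_neq: "x < l \<Longrightarrow> step (step x) \<noteq> x"
  using l by (cases "Suc x = l"; cases "Suc (Suc x) = l") auto

lemma step_inj: "x < l \<Longrightarrow> y < l \<Longrightarrow> step x = step y \<longleftrightarrow> x = y"
  using Suc_mod_inj by blast

lemma arc_in_S:
  assumes "(u, v) \<in> S" shows "u < l \<and> v = step u"
  using assms S by (auto simp: directed_cycle_def)

lemma parcs_C: "parcs C = oarc ` {..<l}"
proof (intro Set.set_eqI iffI)
  fix a assume "a \<in> parcs C"
  then consider "a \<in> parcs (directed_cycle l)" "a \<notin> S" | u v where "a = (v, u)" "(u, v) \<in> S"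
    by (auto simp: C_def reverse_arcs_def)
  then show "a \<in> oarc ` {..<l}"
  proof cases
    case 1
    then obtain i where "i < l" "a = (i, step i)" by (auto simp: directed_cycle_def)
    with 1 have "a = oarc i" by (simp add: oarc_def)
    with \<open>i < l\<close> show ?thesis by blast
  next
    case 2
    then have "a = oarc u" "u < l" using arc_in_S by (auto simp: oarc_def)
    then show ?thesis by blast
  qed
next
  fix a assume "a \<in> oarc ` {..<l}"
  then obtain i where "i < l" "a = oarc i" by blast
  then show "a \<in> parcs C"
    by (auto simp: oarc_def C_def reverse_arcs_def directed_cycle_def)
qed

lemma pverts_C: "pverts C = {..<l}"
  by (simp add: C_def reverse_arcs_def directed_cycle_def)

lemma oarc_eq_iff:
  assumes "i < l" "j < l" shows "oarc i = oarc j \<longleftrightarrow> i = j"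
  using step_step_neq[OF assms(1)] step_step_neq[OF assms(2)] by (auto simp: oarc_def split: if_splits)

lemma inj_oarc: "inj_on oarc {..<l}"
  using oarc_eq_iff by (auto simp: inj_on_def)

lemma adj_iff: "(u, v) \<in> oarc ` F \<or> (v, u) \<in> oarc ` F \<longleftrightarrow> adj F u v"
proof
  assume "(u, v) \<in> oarc ` F \<or> (v, u) \<in> oarc ` F"
  then show "adj F u v" by (auto simp: adj_def oarc_def split: if_splits)
next
  have *: "oarc x \<in> {(x, step x), (step x, x)}" for x by (simp add: oarc_def)
  assume "adj F u v"
  then show "(u, v) \<in> oarc ` F \<or> (v, u) \<in> oarc ` F"
    using *[of u] *[of v] unfolding adj_def by (auto intro: rev_image_eqI)
qed

lemma forward_arc_iff:
  assumes "F \<subseteq> {..<l}" "u \<in> F"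
  shows "(u, step u) \<in> oarc ` F \<longleftrightarrow> sg u = 1" "(step u, u) \<in> oarc ` F \<longleftrightarrow> sg u = -1"
proof -
  have u: "u < l" using assms by auto
  have "(u, step u) = oarc x \<longleftrightarrow> x = u \<and> sg u = 1" "(step u, u) = oarc x \<longleftrightarrow> x = u \<and> sg u = -1" for x
    using step_step_neq[OF u] by (auto simp: oarc_def sg_def split: if_splits)
  then show "(u, step u) \<in> oarc ` F \<longleftrightarrow> sg u = 1" "(step u, u) \<in> oarc ` F \<longleftrightarrow> sg u = -1"
    using assms(2) unfolding image_iff by blast+
qed

lemma sg_cases: "sg i = 1 \<or> sg i = -1"
  by (simp add: sg_def)

lemma Field_sub: "Field (oarc ` F) = F \<union> step ` F"
proof -
  have "x \<in> Field (oarc ` F) \<longleftrightarrow> (\<exists>y. adj F x y)" for x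
    unfolding adj_iff[symmetric] Field_def by blast
  then show ?thesis by (auto simp: adj_def)
qed

lemma antisym_sub:
  assumes "F \<subseteq> {..<l}" shows "antisym (oarc ` F)"
proof (rule antisymI)
  fix a b assume "(a, b) \<in> oarc ` F" "(b, a) \<in> oarc ` F"
  then obtain i j where ij: "(a, b) = oarc i" "(b, a) = oarc j" "i \<in> F" "j \<in> F" by blast
  then have "i < l" "j < l" using assms by auto
  then show "a = b"
    using ij step_step_neq[of i] step_step_neq[of j] by (auto simp: oarc_def split: if_splits)
qed

lemma sub_inj: "F \<subseteq> {..<l} \<Longrightarrow> F' \<subseteq> {..<l} \<Longrightarrow> sub F = sub F' \<Longrightarrow> F = F'"
  using inj_on_image_eq_iff[OF inj_oarc] by (simp add: sub_def)

lemma wf_sub: "wf_digraph (with_proj (sub F))"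
proof unfold_locales
  fix a assume "a \<in> arcs (with_proj (sub F))"
  then have "(fst a, snd a) \<in> oarc ` F" by (simp add: sub_def)
  from FieldI1[OF this] FieldI2[OF this]
  show "tail (with_proj (sub F)) a \<in> verts (with_proj (sub F))"
    "head (with_proj (sub F)) a \<in> verts (with_proj (sub F))"
    by (simp_all add: sub_def)
qed

lemma wf_C: "wf_digraph (with_proj C)"
  by unfold_locales (auto simp: parcs_C pverts_C oarc_def)

text \<open>A copy has no isolated vertices and is therefore determined by its edge set.
  Antisymmetry is automatic, as the cycle has no antiparallel arcs.\<close>

lemma copies_C: "copies G C = sub ` {F. F \<subseteq> {..<l} \<and> (\<exists>f. underlying_iso f G (sub F))}"
proof (intro Set.set_eqI iffI)
  fix H assume H: "H \<in> copies G C"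
  then have "parcs H \<subseteq> oarc ` {..<l}"
    by (auto simp: copies_def subgraph_def parcs_C)
  then obtain F where F: "F \<subseteq> {..<l}" "parcs H = oarc ` F" by (auto simp: subset_image_iff)
  then have "H = sub F" using H by (simp add: copies_def sub_def)
  with H F show "H \<in> sub ` {F. F \<subseteq> {..<l} \<and> (\<exists>f. underlying_iso f G (sub F))}"
    by (auto simp: copies_def)
next
  fix H assume "H \<in> sub ` {F. F \<subseteq> {..<l} \<and> (\<exists>f. underlying_iso f G (sub F))}"
  then obtain F f where F: "F \<subseteq> {..<l}" "H = sub F" "underlying_iso f G (sub F)" by blast
  have "Field (oarc ` F) \<subseteq> {..<l}"
    using F(1) step_less by (auto simp: Field_sub)
  then have "subgraph (with_proj (sub F)) (with_proj C)"
    unfolding subgraph_def using F(1)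
    by (intro conjI wf_sub wf_C compatibleI_with_proj) (auto simp: sub_def parcs_C pverts_C)
  moreover have "pverts (sub F) = Field (parcs (sub F))" "antisym (parcs (sub F))"
    using antisym_sub[OF F(1)] by (simp_all add: sub_def)
  ultimately show "H \<in> copies G C"
    using F unfolding copies_def by blast
qed

lemma underlying_iso_sub:
  "underlying_iso f G (sub F) \<longleftrightarrow> bij_betw f (pverts G) (F \<union> step ` F) \<and>
     (\<forall>u\<in>pverts G. \<forall>v\<in>pverts G. (u, v) \<in> parcs G \<or> (v, u) \<in> parcs G \<longleftrightarrow> adj F (f u) (f v))"
proof -
  have sym: "(u, v) \<in> parcs (mk_symmetric (with_proj H)) \<longleftrightarrow> (u, v) \<in> parcs H \<or> (v, u) \<in> parcs H"
    for H :: "'x pair_pre_digraph" and u v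
    by (simp add: parcs_mk_symmetric) (metis fst_conv snd_conv prod.collapse)
  show ?thesis
    unfolding underlying_iso_def sym by (simp add: sub_def Field_sub adj_iff)
qed

text \<open>For neighbours \<open>x\<close> and \<open>y\<close> this is the index of the edge
  joining them, namely the end from which the clockwise step starts.\<close>

definition idx :: "nat \<Rightarrow> nat \<Rightarrow> nat" where
  "idx x y = (if y = step x then x else y)"

text \<open>Each arc of \<open>G\<close> contributes the sign of its image edge, times \<open>-1\<close> if the isomorphism runs
  against the direction of the cycle.\<close>
lemma sign_iso:
  assumes iso: "underlying_iso f G (sub F)" and F: "F \<subseteq> {..<l}"
    and Field: "Field (parcs G) = pverts G" and fin: "finite (parcs G)"
    and asym: "\<And>u v. (u, v) \<in> parcs G \<Longrightarrow> (v, u) \<notin> parcs G"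
  shows "(\<lambda>(u, v). idx (f u) (f v)) ` parcs G = F"
    and "(-1) ^ card {(u, v). (u, v) \<in> parcs G \<and> (f v, f u) \<in> parcs (sub F)} =
       (\<Prod>(u, v)\<in>parcs G. if f v = step (f u) then 1 else -1) * (\<Prod>i\<in>F. sg i)"
proof -
  have V: "u \<in> pverts G" "v \<in> pverts G" if "(u, v) \<in> parcs G" for u v
    using that Field by (auto simp: Field_def)
  have bij: "bij_betw f (pverts G) (F \<union> step ` F)"
    and adj: "\<And>u v. u \<in> pverts G \<Longrightarrow> v \<in> pverts G \<Longrightarrow>
       (u, v) \<in> parcs G \<or> (v, u) \<in> parcs G \<longleftrightarrow> adj F (f u) (f v)"
    using iso by (auto simp: underlying_iso_sub)
  have inj: "f u = f v \<longleftrightarrow> u = v" if "u \<in> pverts G" "v \<in> pverts G" for u v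
    using bij that by (auto simp: bij_betw_def inj_on_def)
  have dir: "f u \<in> F \<and> f v = step (f u) \<and> idx (f u) (f v) = f u \<or>
      f v \<in> F \<and> f u = step (f v) \<and> f v \<noteq> step (f u) \<and> idx (f u) (f v) = f v" if "(u, v) \<in> parcs G" for u v
  proof -
    have "adj F (f u) (f v)" using adj[OF V[OF that]] that by blast
    then consider "f u \<in> F" "f v = step (f u)" | "f v \<in> F" "f u = step (f v)"
      unfolding adj_def by blast
    then show ?thesis
    proof cases
      case 1
      then show ?thesis by (simp add: idx_def)
    next
      case 2
      then have "f v \<noteq> step (f u)"
        using F step_step_neq[of "f v"] by auto
      with 2 show ?thesis by (simp add: idx_def)
    qed
  qed
  have injI: "inj_on (\<lambda>(u, v). idx (f u) (f v)) (parcs G)"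
  proof (rule inj_onI, clarify)
    fix u v u' v' assume a: "(u, v) \<in> parcs G" "(u', v') \<in> parcs G"
      and eq: "idx (f u) (f v) = idx (f u') (f v')"
    note W = V[OF a(1)] V[OF a(2)]
    have "(f u = f u' \<and> f v = f v') \<or> (f u = f v' \<and> f v = f u')"
      using dir[OF a(1)] dir[OF a(2)] eq by auto
    then have "(u = u' \<and> v = v') \<or> (u = v' \<and> v = u')"
      using W by (simp add: inj)
    then show "u = u' \<and> v = v'" using asym a by blast
  qed
  show image: "(\<lambda>(u, v). idx (f u) (f v)) ` parcs G = F"
  proof (intro Set.set_eqI iffI)
    fix x assume "x \<in> (\<lambda>(u, v). idx (f u) (f v)) ` parcs G"
    then obtain u v where "(u, v) \<in> parcs G" "x = idx (f u) (f v)" by auto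
    with dir[OF this(1)] show "x \<in> F" by auto
  next
    fix x assume x: "x \<in> F"
    then have img: "x \<in> f ` pverts G" "step x \<in> f ` pverts G"
      using bij by (auto simp: bij_betw_def)
    obtain u where u: "u \<in> pverts G" "x = f u" using img(1) by (rule imageE) simp
    obtain v where v: "v \<in> pverts G" "step x = f v" using img(2) by (rule imageE) simp
    note uv = u(1) v(1) u(2)[symmetric] v(2)[symmetric]
    have xl: "x < l" using x F by auto
    have "adj F (f u) (f v)" unfolding adj_def uv(3,4) using x by simp
    then consider "(u, v) \<in> parcs G" | "(v, u) \<in> parcs G" using adj uv(1,2) by blast
    then show "x \<in> (\<lambda>(u, v). idx (f u) (f v)) ` parcs G"
    proof cases
      case 1
      then show ?thesis
        by (rule rev_image_eqI) (simp add: idx_def uv)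
    next
      case 2
      then show ?thesis
        by (rule rev_image_eqI) (use step_step_neq[OF xl] in \<open>auto simp: idx_def uv\<close>)
    qed
  qed
  let ?R = "{(u, v). (u, v) \<in> parcs G \<and> (f v, f u) \<in> parcs (sub F)}"
  have "(-1) ^ card ?R = (\<Prod>a\<in>?R. - 1 :: int)" by simp
  also have "\<dots> = (\<Prod>a\<in>parcs G. if a \<in> ?R then - 1 else 1)"
    using prod.inter_restrict[OF fin, of "\<lambda>_. -1 :: int" ?R] by (simp add: Int_absorb1 subset_iff)
  also have "\<dots> = (\<Prod>(u, v)\<in>parcs G. (if f v = step (f u) then 1 else -1) * sg (idx (f u) (f v)))"
  proof (rule prod.cong[OF refl], clarify)
    fix u v assume a: "(u, v) \<in> parcs G"
    show "(if (u, v) \<in> ?R then - 1 else 1) = (if f v = step (f u) then 1 else -1) * sg (idx (f u) (f v))"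
      using dir[OF a]
    proof (elim disjE conjE)
      assume h: "f u \<in> F" "f v = step (f u)" "idx (f u) (f v) = f u"
      have "(u, v) \<in> ?R \<longleftrightarrow> sg (f u) = -1"
        using forward_arc_iff(2)[OF F h(1)] a by (simp add: sub_def h(2))
      then show ?thesis using h sg_cases[of "f u"] by auto
    next
      assume h: "f v \<in> F" "f u = step (f v)" "f v \<noteq> step (f u)" "idx (f u) (f v) = f v"
      have "(u, v) \<in> ?R \<longleftrightarrow> sg (f v) = 1"
        using forward_arc_iff(1)[OF F h(1)] a by (simp add: sub_def h(2))
      then show ?thesis using h sg_cases[of "f v"] by auto
    qed
  qed
  also have "\<dots> = (\<Prod>(u, v)\<in>parcs G. if f v = step (f u) then 1 else -1) *
      (\<Prod>(u, v)\<in>parcs G. sg (idx (f u) (f v)))"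
    by (simp add: prod.distrib case_prod_unfold)
  also have "(\<Prod>(u, v)\<in>parcs G. sg (idx (f u) (f v))) = (\<Prod>i\<in>F. sg i)"
    unfolding image[symmetric] prod.reindex[OF injI] by (simp add: case_prod_unfold)
  finally show "(-1) ^ card ?R = (\<Prod>(u, v)\<in>parcs G. if f v = step (f u) then 1 else -1) * (\<Prod>i\<in>F. sg i)" .
qed

text \<open>An injective map that sends every arc to a clockwise step cannot create an extra
  adjacency, because \<open>sub F\<close> has only the edges in \<open>F\<close>.\<close>

lemma iso_forward:
  assumes inj: "inj_on f (pverts G)" and Field: "Field (parcs G) = pverts G"
    and step: "\<And>u v. (u, v) \<in> parcs G \<Longrightarrow> f v = step (f u)"
    and F: "F = (\<lambda>(u, v). f u) ` parcs G"
  shows "underlying_iso f G (sub F)"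
  unfolding underlying_iso_sub
proof (intro conjI ballI)
  have V: "u \<in> pverts G" "v \<in> pverts G" if "(u, v) \<in> parcs G" for u v
    using that Field by (auto simp: Field_def)
  have "step ` F = (\<lambda>(u, v). f v) ` parcs G"
    unfolding F image_image using step by (intro image_cong) auto
  then have "F \<union> step ` F = f ` Field (parcs G)"
    unfolding F by (force simp: Field_def image_iff Domain_iff Range_iff)
  then show "bij_betw f (pverts G) (F \<union> step ` F)"
    using inj by (simp add: bij_betw_def Field)
  fix u v assume uv: "u \<in> pverts G" "v \<in> pverts G"
  have *: "(u, v) \<in> parcs G \<longleftrightarrow> f u \<in> F \<and> f v = step (f u)" if "u \<in> pverts G" "v \<in> pverts G" for u v
  proof
    assume "f u \<in> F \<and> f v = step (f u)"
    then obtain u' v' where a: "(u', v') \<in> parcs G" "f u = f u'" "f v = f v'"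
      unfolding F using step by fastforce
    then have "u = u'" "v = v'" using inj that V[OF a(1)] by (auto simp: inj_on_def)
    with a show "(u, v) \<in> parcs G" by simp
  qed (use step in \<open>auto simp: F\<close>)
  show "(u, v) \<in> parcs G \<or> (v, u) \<in> parcs G \<longleftrightarrow> adj F (f u) (f v)"
    unfolding adj_def using *[OF uv] *[OF uv(2,1)] by blast
qed

section \<open>Injective walks on the cycle\<close>

lemma walk_forward:
  assumes g: "\<And>j. j < m \<Longrightarrow> g (Suc j) = step (g j)" and "g 0 < l" "j \<le> m"
  shows "g j = (g 0 + j) mod l"
  using assms(3)
proof (induction j)
  case (Suc j)
  then have "g (Suc j) = step (g j)" using g by simp
  also have "\<dots> = (g 0 + Suc j) mod l" using Suc by (simp add: mod_simps)
  finally show ?case .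
qed (use assms in simp)

text \<open>A walk that turns back revisits the vertex of two steps before, which injectivity
  forbids; hence the direction of the first step is kept.\<close>

lemma walk_cases:
  assumes less: "\<And>j. j \<le> m \<Longrightarrow> g j < l"
    and adj: "\<And>j. j < m \<Longrightarrow> g (Suc j) = step (g j) \<or> g j = step (g (Suc j))"
    and inj: "inj_on g {..m}"
  shows "(\<forall>j<m. g (Suc j) = step (g j)) \<or> (\<forall>j<m. g j = step (g (Suc j)))"
proof -
  have neq: "g j \<noteq> g (Suc (Suc j))" if "Suc j < m" for j
    using inj_onD[OF inj, of j "Suc (Suc j)"] that by auto
  have f: "g (Suc (Suc j)) = step (g (Suc j))" if "Suc j < m" "g (Suc j) = step (g j)" for j
    using adj[of "Suc j"] neq[of j] that less[of j] less[of "Suc (Suc j)"]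
      step_inj[of "g j" "g (Suc (Suc j))"] by auto
  have b: "g (Suc j) = step (g (Suc (Suc j)))" if "Suc j < m" "g j = step (g (Suc j))" for j
    using adj[of "Suc j"] neq[of j] that by auto
  show ?thesis
  proof (cases "m = 0 \<or> g (Suc 0) = step (g 0)")
    case True
    have "g (Suc j) = step (g j)" if "j < m" for j
      using that by (induction j) (use True f in auto)
    then show ?thesis by blast
  next
    case False
    then have *: "g 0 = step (g (Suc 0))" using adj[of 0] by auto
    have "g j = step (g (Suc j))" if "j < m" for j
      using that by (induction j) (use * b in auto)
    then show ?thesis by blast
  qed
qed

lemma walk_arcs:
  assumes less: "\<And>j. j \<le> m \<Longrightarrow> g j < l"
    and adj: "\<And>j. j < m \<Longrightarrow> g (Suc j) = step (g j) \<or> g j = step (g (Suc j))"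
    and inj: "inj_on g {..m}"
  obtains i where "i < l" "g ` {..m} = arc l i (Suc m)" "(\<lambda>j. idx (g j) (g (Suc j))) ` {..<m} = arc l i m"
proof -
  from walk_cases[OF assms] show ?thesis
  proof
    assume fwd: "\<forall>j<m. g (Suc j) = step (g j)"
    have gj: "g j = (g 0 + j) mod l" if "j \<le> m" for j
      by (rule walk_forward[of m]) (use fwd less that in auto)
    show ?thesis
    proof (rule that[of "g 0"])
      show "g 0 < l" using less by simp
      show "g ` {..m} = arc l (g 0) (Suc m)"
        unfolding arc_def by (intro image_cong gj) (simp_all add: lessThan_Suc_atMost)
      show "(\<lambda>j. idx (g j) (g (Suc j))) ` {..<m} = arc l (g 0) m"
        unfolding arc_def
      proof (rule image_cong[OF refl])
        fix j assume "j \<in> {..<m}"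
        then have "idx (g j) (g (Suc j)) = g j" "j \<le> m" using fwd by (auto simp: idx_def)
        then show "idx (g j) (g (Suc j)) = (g 0 + j) mod l" using gj[of j] by (simp only:)
      qed
    qed
  next
    assume bwd: "\<forall>j<m. g j = step (g (Suc j))"
    \<comment> \<open>Read in reverse, an anticlockwise walk is a clockwise one with the same
      vertices and edges, and it starts at the last vertex of \<open>g\<close>.\<close>
    define h where "h j = g (m - j)" for j
    have hstep: "h (Suc j) = step (h j)" if "j < m" for j
      using bwd[rule_format, of "m - Suc j"] that by (simp add: h_def Suc_diff_Suc)
    have hj: "h j = (h 0 + j) mod l" if "j \<le> m" for j
      by (rule walk_forward[of m]) (use hstep less that in \<open>auto simp: h_def\<close>)
    have "x \<in> (\<lambda>j. m - j) ` {..m}" if "x \<le> m" for x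
      using that by (intro image_eqI[of _ _ "m - x"]) auto
    moreover have "x \<in> (\<lambda>j. m - Suc j) ` {..<m}" if "x < m" for x
      using that by (intro image_eqI[of _ _ "m - Suc x"]) auto
    ultimately have rev: "(\<lambda>j. m - j) ` {..m} = {..m}" "(\<lambda>j. m - Suc j) ` {..<m} = {..<m}"
      by auto
    show ?thesis
    proof (rule that[of "h 0"])
      show "h 0 < l" using less by (simp add: h_def)
      have "g ` {..m} = h ` {..m}"
        unfolding h_def image_image[symmetric, of g "\<lambda>j. m - j"] rev ..
      also have "\<dots> = arc l (h 0) (Suc m)"
        unfolding arc_def by (intro image_cong hj) (simp_all add: lessThan_Suc_atMost)
      finally show "g ` {..m} = arc l (h 0) (Suc m)" .
      have "(\<lambda>j. idx (g j) (g (Suc j))) ` {..<m} = (\<lambda>j. g (Suc j)) ` {..<m}"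
      proof (rule image_cong[OF refl])
        fix j assume "j \<in> {..<m}"
        then have "g j = step (g (Suc j))" "g (Suc j) < l" using bwd less by auto
        then show "idx (g j) (g (Suc j)) = g (Suc j)"
          using step_step_neq[of "g (Suc j)"] by (auto simp: idx_def)
      qed
      also have "\<dots> = (\<lambda>j. g (Suc j)) ` (\<lambda>j. m - Suc j) ` {..<m}"
        unfolding rev ..
      also have "\<dots> = h ` {..<m}"
        unfolding image_image h_def by (intro image_cong refl) (simp add: Suc_diff_Suc)
      also have "\<dots> = arc l (h 0) m"
        unfolding arc_def by (intro image_cong hj) (simp_all add: lessThan_Suc_atMost)
      finally show "(\<lambda>j. idx (g j) (g (Suc j))) ` {..<m} = arc l (h 0) m" .
    qed
  qed
qed

end

section \<open>Signed counts as sums over patterns\<close>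

lemma directed_path_arcs: "parcs (directed_path (Suc m)) = (\<lambda>j. (j, Suc j)) ` {..<m}"
  by (auto simp: directed_path_def)

lemma directed_path_verts: "pverts (directed_path (Suc m)) = {..m}"
  by (auto simp: directed_path_def)

lemma directed_path_Field: "0 < m \<Longrightarrow> Field (parcs (directed_path (Suc m))) = {..m}"
proof -
  assume m: "0 < m"
  have "j \<in> Field (parcs (directed_path (Suc m)))" if "j \<le> m" for j
  proof (cases "j < m")
    case True
    then have "(j, Suc j) \<in> parcs (directed_path (Suc m))" by (auto simp: directed_path_arcs)
    then show ?thesis by (rule FieldI1)
  next
    case False
    then have "(m - 1, j) \<in> parcs (directed_path (Suc m))"
      using m that by (auto simp: directed_path_arcs)
    then show ?thesis by (rule FieldI2)
  qed
  moreover have "Field (parcs (directed_path (Suc m))) \<subseteq> {..m}"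
    by (auto simp: Field_def directed_path_arcs)
  ultimately show ?thesis by auto
qed

lemma two_P3_arcs: "parcs two_P3 = {(0, 1), (1, 2), (3, 4), (4, 5)}"
  and two_P3_verts: "pverts two_P3 = {..<6}"
  by (simp_all add: two_P3_def)

lemma two_P3_asym: "(u, v) \<in> parcs two_P3 \<Longrightarrow> (v, u) \<notin> parcs two_P3"
  unfolding two_P3_arcs by (elim insertE) simp_all

lemma two_P3_Field: "Field (parcs two_P3) = pverts two_P3"
proof -
  have "{..<6::nat} = {0, 1, 2, 3, 4, 5}" by auto
  then show ?thesis by (auto simp: two_P3_arcs two_P3_verts Field_def)
qed

context oriented_cycle
begin

text \<open>The assumption \<open>sign\<close> covers every isomorphism, so the arbitrary choice
  made in \<open>num_reversed\<close> does no harm.\<close>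

lemma signed_count_eq:
  assumes family: "\<And>F. F \<subseteq> {..<l} \<Longrightarrow> (\<exists>f. underlying_iso f G (sub F)) \<longleftrightarrow> F \<in> \<F>"
    and sub: "\<F> \<subseteq> Pow {..<l}"
    and sign: "\<And>F f. F \<in> \<F> \<Longrightarrow> underlying_iso f G (sub F) \<Longrightarrow>
      (-1) ^ card {(u, v). (u, v) \<in> parcs G \<and> (f v, f u) \<in> parcs (sub F)} = (\<Prod>i\<in>F. sg i)"
  shows "signed_count G C = (\<Sum>F\<in>\<F>. \<Prod>i\<in>F. sg i)"
proof -
  have "{F. F \<subseteq> {..<l} \<and> (\<exists>f. underlying_iso f G (sub F))} = \<F>"
    using family sub by blast
  then have "copies G C = sub ` \<F>" by (simp add: copies_C)
  moreover have "inj_on sub \<F>"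
    using sub_inj sub unfolding inj_on_def by blast
  ultimately have "signed_count G C = (\<Sum>F\<in>\<F>. (-1) ^ num_reversed G (sub F))"
    by (simp add: signed_count_def sum.reindex)
  also have "\<dots> = (\<Sum>F\<in>\<F>. \<Prod>i\<in>F. sg i)"
  proof (rule sum.cong[OF refl])
    fix F assume F: "F \<in> \<F>"
    then have "\<exists>f. underlying_iso f G (sub F)" using family sub by blast
    then have "underlying_iso (SOME f. underlying_iso f G (sub F)) G (sub F)" by (rule someI_ex)
    from sign[OF F this] show "(-1) ^ num_reversed G (sub F) = (\<Prod>i\<in>F. sg i)"
      by (simp add: num_reversed_def Let_def)
  qed
  finally show ?thesis .
qed

lemma iso_adj:
  assumes "underlying_iso f G (sub F)" "F \<subseteq> {..<l}" "Field (parcs G) = pverts G"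
  shows "inj_on f (pverts G)" "v \<in> pverts G \<Longrightarrow> f v < l"
    and "(u, v) \<in> parcs G \<Longrightarrow> f v = step (f u) \<or> f u = step (f v)"
proof -
  have bij: "bij_betw f (pverts G) (F \<union> step ` F)"
    using assms(1) by (simp add: underlying_iso_sub)
  then show "inj_on f (pverts G)" by (simp add: bij_betw_def)
  have "F \<union> step ` F \<subseteq> {..<l}" using assms(2) step_less by auto
  then show "v \<in> pverts G \<Longrightarrow> f v < l"
    using bij_betwE[OF bij] by blast
  assume a: "(u, v) \<in> parcs G"
  then have "u \<in> pverts G" "v \<in> pverts G" using assms(3) by (auto simp: Field_def)
  then have "adj F (f u) (f v)" using assms(1) a by (auto simp: underlying_iso_sub)
  then show "f v = step (f u) \<or> f u = step (f v)" by (auto simp: adj_def)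
qed

text \<open>A path embeds as an injective walk, hence as an arc. Running it anticlockwise flips all
  \<open>m\<close> comparisons with the cycle, so the sign is unaffected when \<open>m\<close> is
  even.\<close>

lemma path_iso_arc:
  assumes iso: "underlying_iso f (directed_path (Suc m)) (sub F)" and F: "F \<subseteq> {..<l}" and m: "0 < m"
  shows "\<exists>i<l. m < l \<and> F = arc l i m"
    and "(-1) ^ card {(u, v). (u, v) \<in> parcs (directed_path (Suc m)) \<and> (f v, f u) \<in> parcs (sub F)}
      = (if f 1 = step (f 0) then 1 else (-1) ^ m) * (\<Prod>i\<in>F. sg i)"
proof -
  let ?G = "directed_path (Suc m)"
  have Field: "Field (parcs ?G) = pverts ?G"
    using m by (simp add: directed_path_Field directed_path_verts)
  note adj = iso_adj[OF iso F Field, unfolded directed_path_verts]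
  have walk: "f (Suc j) = step (f j) \<or> f j = step (f (Suc j))" if "j < m" for j
    using adj(3)[of j "Suc j"] that by (auto simp: directed_path_arcs)
  have asym: "(v, u) \<notin> parcs ?G" if "(u, v) \<in> parcs ?G" for u v
    using that by (auto simp: directed_path_arcs)
  note sign = sign_iso[OF iso F Field _ asym]
  have fin: "finite (parcs ?G)" by (simp add: directed_path_arcs)
  obtain i where i: "i < l" "f ` {..m} = arc l i (Suc m)" "(\<lambda>j. idx (f j) (f (Suc j))) ` {..<m} = arc l i m"
    by (rule walk_arcs[of m f]) (use adj walk in auto)
  have "F = arc l i m"
    using sign(1)[OF fin] i(3) by (simp add: directed_path_arcs image_image)
  moreover have "m < l"
  proof -
    have "Suc m = card (f ` {..m})" using card_image[OF adj(1)] by simp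
    also have "\<dots> \<le> card {..<l}" by (rule card_mono) (use adj(2) in auto)
    finally show ?thesis by simp
  qed
  ultimately show "\<exists>i<l. m < l \<and> F = arc l i m" using i(1) by blast
  have "(\<Prod>(u, v)\<in>parcs ?G. if f v = step (f u) then 1 else -1 :: int)
      = (\<Prod>j<m. if f (Suc j) = step (f j) then 1 else -1)"
    unfolding directed_path_arcs by (subst prod.reindex) (auto simp: inj_on_def)
  also have "\<dots> = (if f 1 = step (f 0) then 1 else (-1) ^ m)"
  proof -
    have less: "f j < l" if "j \<le> m" for j using adj(2) that by simp
    from walk_cases[of m f] less walk adj(1)
    consider "\<forall>j<m. f (Suc j) = step (f j)" | "\<forall>j<m. f j = step (f (Suc j))" by blast
    then show ?thesis
    proof cases
      case 1
      then show ?thesis using m by simp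
    next
      case 2
      then have "f (Suc j) \<noteq> step (f j)" if "j < m" for j
        using step_step_neq[of "f (Suc j)"] less[of "Suc j"] that by auto
      then show ?thesis using m by simp
    qed
  qed
  finally show "(-1) ^ card {(u, v). (u, v) \<in> parcs ?G \<and> (f v, f u) \<in> parcs (sub F)}
      = (if f 1 = step (f 0) then 1 else (-1) ^ m) * (\<Prod>i\<in>F. sg i)"
    using sign(2)[OF fin] by simp
qed

lemma arc_iso_path:
  assumes "i < l" "m < l" "0 < m"
  shows "\<exists>f. underlying_iso f (directed_path (Suc m)) (sub (arc l i m))"
proof -
  let ?f = "\<lambda>j. (j + i) mod l"
  have "underlying_iso ?f (directed_path (Suc m)) (sub (arc l i m))"
  proof (rule iso_forward)
    show "inj_on ?f (pverts (directed_path (Suc m)))"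
      by (rule inj_on_subset[OF inj_on_rot[where l = l]]) (use assms in \<open>auto simp: directed_path_verts\<close>)
    show "Field (parcs (directed_path (Suc m))) = pverts (directed_path (Suc m))"
      using assms by (simp add: directed_path_Field directed_path_verts)
    show "?f v = step (?f u)" if "(u, v) \<in> parcs (directed_path (Suc m))" for u v
      using that by (auto simp: directed_path_arcs mod_simps)
    show "arc l i m = (\<lambda>(u, v). ?f u) ` parcs (directed_path (Suc m))"
      by (simp add: directed_path_arcs image_image arc_def add.commute)
  qed
  then show ?thesis by blast
qed

lemma signed_count_path:
  assumes "0 < k"
  shows "signed_count (directed_path (2 * k + 1)) C = (\<Sum>F\<in>single_arcs l k. \<Prod>i\<in>F. sg i)"
proof (rule signed_count_eq)
  have G: "directed_path (2 * k + 1) = directed_path (Suc (2 * k))" by simp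
  fix F assume F: "F \<subseteq> {..<l}"
  show "(\<exists>f. underlying_iso f (directed_path (2 * k + 1)) (sub F)) \<longleftrightarrow> F \<in> single_arcs l k"
  proof
    assume "\<exists>f. underlying_iso f (directed_path (2 * k + 1)) (sub F)"
    then show "F \<in> single_arcs l k"
      unfolding G using path_iso_arc(1)[OF _ F] assms by (auto simp: single_arcs_def)
  next
    assume "F \<in> single_arcs l k"
    then obtain i where "i < l" "2 * k < l" "F = arc l i (2 * k)" by (auto simp: single_arcs_def)
    then show "\<exists>f. underlying_iso f (directed_path (2 * k + 1)) (sub F)"
      unfolding G using arc_iso_path assms by simp
  qed
next
  fix F f assume "F \<in> single_arcs l k" and iso: "underlying_iso f (directed_path (2 * k + 1)) (sub F)"
  then have F: "F \<subseteq> {..<l}" using single_arcs_subset_Pow by blast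
  show "(-1) ^ card {(u, v). (u, v) \<in> parcs (directed_path (2 * k + 1)) \<and> (f v, f u) \<in> parcs (sub F)}
      = (\<Prod>i\<in>F. sg i)"
    using path_iso_arc(2)[of f "2 * k" F] iso F assms by simp
qed (rule single_arcs_subset_Pow)

text \<open>The components start at the vertices 0 and 3 and are treated as two separate walks. Each
  keeps its direction over its two edges, though the two directions may differ from one
  another.\<close>

lemma two_P3_walks:
  assumes iso: "underlying_iso f two_P3 (sub F)" and F: "F \<subseteq> {..<l}"
  shows "F \<in> double_arcs l"
    and "a = 0 \<or> a = 3 \<Longrightarrow> (f (Suc (Suc a)) = step (f (Suc a))) = (f (Suc a) = step (f a))"
proof -
  note adj = iso_adj[OF iso F two_P3_Field, unfolded two_P3_verts]
  have walk: "f (Suc (a + j)) = step (f (a + j)) \<or> f (a + j) = step (f (Suc (a + j)))"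
    if "j < 2" "a = 0 \<or> a = 3" for a j
    using adj(3)[of "a + j" "Suc (a + j)"] that by (auto simp: two_P3_arcs less_2_cases_iff)
  have inj: "inj_on (\<lambda>j. f (a + j)) {..2}" if "a = 0 \<or> a = 3" for a
  proof (rule inj_onI)
    fix x y assume "x \<in> {..2::nat}" "y \<in> {..2}" "f (a + x) = f (a + y)"
    then show "x = y" using inj_onD[OF adj(1), of "a + x" "a + y"] that by auto
  qed
  have less: "f (a + j) < l" if "j \<le> 2" "a = 0 \<or> a = 3" for a j
    using adj(2) that by auto
  have arcs: "\<exists>i<l. (\<lambda>j. f (a + j)) ` {..2} = arc l i 3 \<and>
      {idx (f a) (f (Suc a)), idx (f (Suc a)) (f (Suc (Suc a)))} = arc l i 2" if a: "a = 0 \<or> a = 3" for a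
  proof -
    obtain i where "i < l" "(\<lambda>j. f (a + j)) ` {..2} = arc l i (Suc 2)"
      "(\<lambda>j. idx (f (a + j)) (f (a + Suc j))) ` {..<2} = arc l i 2"
      by (rule walk_arcs[of 2 "\<lambda>j. f (a + j)"]) (use less[OF _ a] walk[OF _ a] inj[OF a] in auto)
    moreover have "{..<2::nat} = {0, 1}" by auto
    ultimately show ?thesis by (auto simp: numeral_3_eq_3 numeral_2_eq_2)
  qed
  obtain i where i: "i < l" "(\<lambda>j. f (0 + j)) ` {..2} = arc l i 3" "{idx (f 0) (f 1), idx (f 1) (f 2)} = arc l i 2"
    using arcs[of 0] by (auto simp: numeral_2_eq_2)
  obtain j where j: "j < l" "(\<lambda>j. f (3 + j)) ` {..2} = arc l j 3" "{idx (f 3) (f 4), idx (f 4) (f 5)} = arc l j 2"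
    using arcs[of 3] by (auto simp: eval_nat_numeral)
  have "f (0 + x) \<noteq> f (3 + y)" if "x \<le> 2" "y \<le> 2" for x y
    using inj_onD[OF adj(1), of x "3 + y"] that by auto
  then have disj: "arc l i 3 \<inter> arc l j 3 = {}"
    unfolding i(2)[symmetric] j(2)[symmetric] by blast
  have "F = (\<lambda>(u, v). idx (f u) (f v)) ` parcs two_P3"
    using sign_iso(1)[OF iso F two_P3_Field _ two_P3_asym] by (simp add: two_P3_arcs)
  also have "\<dots> = {idx (f 0) (f 1), idx (f 1) (f 2)} \<union> {idx (f 3) (f 4), idx (f 4) (f 5)}"
    by (auto simp: two_P3_arcs)
  finally show "F \<in> double_arcs l"
    unfolding double_arcs_def using i j disj by blast
  show "(f (Suc (Suc a)) = step (f (Suc a))) = (f (Suc a) = step (f a))" if a: "a = 0 \<or> a = 3" for a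
  proof -
    have "(\<forall>j<2. f (a + Suc j) = step (f (a + j))) \<or> (\<forall>j<2. f (a + j) = step (f (a + Suc j)))"
      by (rule walk_cases) (use less[OF _ a] walk[OF _ a] inj[OF a] in auto)
    then show ?thesis
    proof
      assume *: "\<forall>j<2. f (a + Suc j) = step (f (a + j))"
      show ?thesis using *[rule_format, of 0] *[rule_format, of 1] by simp
    next
      assume *: "\<forall>j<2. f (a + j) = step (f (a + Suc j))"
      have "f a = step (f (Suc a))" "f (Suc a) = step (f (Suc (Suc a)))"
        using *[rule_format, of 0] *[rule_format, of 1] by simp_all
      then show ?thesis
        using step_step_neq[of "f (Suc a)"] step_step_neq[of "f (Suc (Suc a))"]
          less[OF _ a, of 1] less[OF _ a, of 2] by simp
    qed
  qed
qed

lemma double_arcs_iso: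
  assumes "F \<in> double_arcs l"
  shows "\<exists>f. underlying_iso f two_P3 (sub F)"
proof -
  obtain r b where b: "3 \<le> b" "b + 2 < l" "F = rot l r ` {0, 1, b, Suc b}"
    using assms by (rule double_arcs_normal)
  \<comment> \<open>The first component goes to 0, 1, 2 and the second to \<open>b\<close>,
    \<open>b + 1\<close>, \<open>b + 2\<close>, before the rotation.\<close>
  define g where "g j = (if j < 3 then j else b + (j - 3))" for j
  define f where "f j = rot l r (g j)" for j
  have "underlying_iso f two_P3 (sub F)"
  proof (rule iso_forward)
    show "inj_on f (pverts two_P3)"
    proof (rule inj_onI)
      fix x y assume xy: "x \<in> pverts two_P3" "y \<in> pverts two_P3" "f x = f y"
      then have "g x < l" "g y < l" using b by (auto simp: two_P3_verts g_def)
      then have "g x = g y"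
        using inj_onD[OF inj_on_rot[of l r], of "g x" "g y"] xy(3) by (simp add: f_def)
      then show "x = y" using b by (auto simp: g_def split: if_splits)
    qed
    show "Field (parcs two_P3) = pverts two_P3" by (rule two_P3_Field)
    show "f v = step (f u)" if "(u, v) \<in> parcs two_P3" for u v
      using that by (auto simp: two_P3_arcs f_def g_def mod_simps)
    show "F = (\<lambda>(u, v). f u) ` parcs two_P3"
      by (auto simp: two_P3_arcs f_def g_def b(3))
  qed
  then show ?thesis by blast
qed

lemma signed_count_two_P3:
  "signed_count two_P3 C = (\<Sum>F\<in>double_arcs l. \<Prod>i\<in>F. sg i)"
proof (rule signed_count_eq)
  fix F assume F: "F \<subseteq> {..<l}"
  then show "(\<exists>f. underlying_iso f two_P3 (sub F)) \<longleftrightarrow> F \<in> double_arcs l"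
    using two_P3_walks(1) double_arcs_iso by blast
next
  fix F f assume "F \<in> double_arcs l" and iso: "underlying_iso f two_P3 (sub F)"
  then have F: "F \<subseteq> {..<l}" using double_arcs_subset_Pow by blast
  have eq: "(f 2 = step (f 1)) = (f 1 = step (f 0))" "(f 5 = step (f 4)) = (f 4 = step (f 3))"
    using two_P3_walks(2)[OF iso F, of 0] two_P3_walks(2)[OF iso F, of 3]
    by (simp_all add: eval_nat_numeral)
  define d where "d u v = (if f v = step (f u) then 1 else - 1 :: int)" for u v
  have sq: "d u v * d u v = 1" for u v by (simp add: d_def)
  have "d 1 2 = d 0 1" "d 4 5 = d 3 4" by (simp_all only: d_def eq)
  \<comment> \<open>Grouped by component, the direction signs form two squares, so only the signs of
    the edges remain.\<close>
  moreover have "(\<Prod>(u, v)\<in>parcs two_P3. d u v) = (d 0 1 * d 1 2) * (d 3 4 * d 4 5)"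
    by (simp add: two_P3_arcs)
  ultimately have "(\<Prod>(u, v)\<in>parcs two_P3. d u v) = 1" by (simp add: sq)
  moreover have "finite (parcs two_P3)" by (simp add: two_P3_arcs)
  ultimately show "(-1) ^ card {(u, v). (u, v) \<in> parcs two_P3 \<and> (f v, f u) \<in> parcs (sub F)} = (\<Prod>i\<in>F. sg i)"
    using sign_iso(2)[OF iso F two_P3_Field _ two_P3_asym] by (simp only: d_def mult_1)
qed (rule double_arcs_subset_Pow)

end

section \<open>Divisibility and complementary arcs\<close>

lemma sum_prod_signs:
  fixes u :: "'a \<Rightarrow> int"
  assumes A: "finite A" and u: "\<And>i. i \<in> A \<Longrightarrow> u i = 1 \<or> u i = -1"
  shows "(\<Sum>i\<in>A. u i) = int (card A) - 2 * int (card {i \<in> A. u i = -1})"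
    and "(\<Prod>i\<in>A. u i) = (-1) ^ card {i \<in> A. u i = -1}"
proof -
  have "(\<Sum>i\<in>A. u i) = (\<Sum>i\<in>A. 1 - 2 * (if u i = -1 then 1 else 0))"
    using u by (intro sum.cong) auto
  also have "\<dots> = int (card A) - 2 * (\<Sum>i\<in>A. if u i = -1 then 1 else 0)"
    by (simp add: sum_subtractf sum_distrib_left)
  also have "(\<Sum>i\<in>A. if u i = -1 then 1 else 0) = int (card {i \<in> A. u i = -1})"
    using A by (simp flip: sum.inter_filter)
  finally show "(\<Sum>i\<in>A. u i) = int (card A) - 2 * int (card {i \<in> A. u i = -1})" .
  have "(\<Prod>i\<in>A. u i) = (\<Prod>i\<in>A. if u i = -1 then -1 else 1)"
    using u by (intro prod.cong) auto
  also have "\<dots> = (\<Prod>i\<in>{i \<in> A. u i = -1}. -1)"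
    using A by (rule prod.inter_filter[symmetric])
  finally show "(\<Prod>i\<in>A. u i) = (-1) ^ card {i \<in> A. u i = -1}" by simp
qed

lemma arc_complement:
  assumes "i < l" "m \<le> l"
  shows "{..<l} - arc l i m = arc l ((i + m) mod l) (l - m)"
proof -
  have l: "0 < l" using assms by simp
  have "arc l i m = rot l i ` {0..<0 + m}"
    unfolding rot_interval using assms by simp
  moreover have "{..<l} = rot l i ` {..<l}"
    using bij_betw_add_mod[OF l, of i] by (simp add: bij_betw_def)
  ultimately have "{..<l} - arc l i m = rot l i ` {..<l} - rot l i ` {0..<0 + m}"
    by simp
  also have "\<dots> = rot l i ` ({..<l} - {0..<0 + m})"
    by (rule inj_on_image_set_diff[OF inj_on_rot[OF l], symmetric]) (use assms in auto)
  also have "{..<l} - {0..<0 + m} = {m..<m + (l - m)}"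
    using assms by auto
  finally show ?thesis
    unfolding rot_interval by (simp add: add.commute)
qed

context oriented_cycle
begin

lemma step_bij: "bij_betw step {..<l} {..<l}"
  using bij_betw_add_mod[of l 1] l by simp

lemma prod_sg_squared: "(\<Prod>i\<in>F. sg i) * (\<Prod>i\<in>F. sg i) = 1"
  unfolding prod.distrib[symmetric] by (rule prod.neutral) (simp add: sg_def)

lemma single_arcs_complement:
  assumes "F \<in> single_arcs l k" "0 < k" "even l"
  shows "{..<l} - F \<in> single_arcs l (l div 2 - k)"
proof -
  obtain i where i: "i < l" "2 * k < l" "F = arc l i (2 * k)"
    using assms(1) by (auto simp: single_arcs_def)
  have "l - 2 * k = 2 * (l div 2 - k)" using assms(3) by (auto elim: evenE)
  then have "{..<l} - F = arc l ((i + 2 * k) mod l) (2 * (l div 2 - k))"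
    unfolding i(3) using arc_complement[of i l "2 * k"] i by simp
  moreover have "(i + 2 * k) mod l < l" "2 * (l div 2 - k) < l" using i assms(2) by auto
  ultimately show ?thesis unfolding single_arcs_def by blast
qed

text \<open>The complement of an arc of even length in an even cycle is again an arc of even length.
  Signs being their own inverses, its product is the total product times that of the arc.\<close>

lemma single_sum_complement:
  assumes "0 < k" "2 * k < l" "even l"
  shows "(\<Sum>F\<in>single_arcs l (l div 2 - k). \<Prod>i\<in>F. sg i) = (\<Prod>i<l. sg i) * (\<Sum>F\<in>single_arcs l k. \<Prod>i\<in>F. sg i)"
proof -
  have k': "0 < l div 2 - k" "l div 2 - (l div 2 - k) = k" using assms by auto
  have dbl: "{..<l} - ({..<l} - F) = F" if "F \<in> single_arcs l j" for F j
    using single_arcs_subset_Pow that by blast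
  have "(\<Prod>i\<in>{..<l} - F. sg i) = (\<Prod>i<l. sg i) * (\<Prod>i\<in>F. sg i)" if "F \<in> single_arcs l k" for F
  proof -
    have "F \<subseteq> {..<l}" using single_arcs_subset_Pow that by blast
    then have "(\<Prod>i<l. sg i) = (\<Prod>i\<in>{..<l} - F. sg i) * (\<Prod>i\<in>F. sg i)"
      by (rule prod.subset_diff) simp
    then show ?thesis using prod_sg_squared[of F] by (simp add: mult.assoc)
  qed
  then have "(\<Prod>i<l. sg i) * (\<Sum>F\<in>single_arcs l k. \<Prod>i\<in>F. sg i)
      = (\<Sum>F\<in>single_arcs l k. \<Prod>i\<in>{..<l} - F. sg i)"
    by (simp add: sum_distrib_left)
  also have "\<dots> = (\<Sum>F\<in>single_arcs l (l div 2 - k). \<Prod>i\<in>F. sg i)"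
    by (rule sum.reindex_bij_witness[where i = "\<lambda>F. {..<l} - F" and j = "\<lambda>F. {..<l} - F"])
      (use dbl single_arcs_complement[of _ "l div 2 - k"] single_arcs_complement[of _ k] assms k' in auto)
  finally show ?thesis by simp
qed

text \<open>By complementation the count at \<open>l div 2 - k\<close> is nonzero as well, so
  minimality of \<open>k\<close> forces \<open>k \<le> l div 2 - k\<close>.\<close>

lemma least_single_le:
  assumes "0 < k" "(\<Sum>F\<in>single_arcs l k. \<Prod>i\<in>F. sg i) \<noteq> 0" "even l"
    and least: "\<And>j. 0 < j \<Longrightarrow> j < k \<Longrightarrow> (\<Sum>F\<in>single_arcs l j. \<Prod>i\<in>F. sg i) = 0"
  shows "4 * k \<le> l"
proof -
  have k: "2 * k < l"
    using assms(2) by (rule contrapos_np) (simp add: single_arcs_def)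
  have "(\<Prod>i<l. sg i) \<noteq> 0" by (metis mult_zero_left prod_sg_squared zero_neq_one)
  then have "(\<Sum>F\<in>single_arcs l (l div 2 - k). \<Prod>i\<in>F. sg i) \<noteq> 0"
    using single_sum_complement[OF assms(1) k assms(3)] assms(2) by simp
  then have "\<not> l div 2 - k < k" using least[of "l div 2 - k"] k assms(3) by (auto elim!: evenE)
  then show ?thesis using k assms(3) by auto
qed

text \<open>With \<open>u i\<close> the product of two consecutive signs, the vanishing sum says
  that exactly half of the \<open>u i\<close> are -1. In the product of all \<open>u i\<close> every
  sign occurs twice, so the number of these -1 is even.\<close>

lemma four_dvd:
  assumes "(\<Sum>F\<in>single_arcs l 1. \<Prod>i\<in>F. sg i) = 0"
  shows "4 dvd l"
proof -
  define u where "u i = sg i * sg (step i)" for i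
  have u: "u i = 1 \<or> u i = -1" for i by (simp add: u_def sg_def)
  have eq: "single_arcs l 1 = (\<lambda>i. {i, step i}) ` {..<l}"
    using l by (auto simp: single_arcs_def arc_2)
  have inj: "inj_on (\<lambda>i. {i, step i}) {..<l}"
  proof (rule inj_onI)
    fix i j assume ij: "i \<in> {..<l}" "j \<in> {..<l}" "{i, step i} = {j, step j}"
    show "i = j"
    proof (rule ccontr)
      assume "i \<noteq> j"
      then have "i = step j" "j = step i" using ij(3) by (auto simp: doubleton_eq_iff)
      then show False using step_step_neq[of i] ij(1) by auto
    qed
  qed
  have "0 = (\<Sum>i<l. \<Prod>x\<in>{i, step i}. sg x)"
    using assms unfolding eq sum.reindex[OF inj] by simp
  also have "\<dots> = (\<Sum>i<l. u i)"
    by (rule sum.cong) (auto simp: u_def dest: step_neq)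
  finally have sum: "int l = 2 * int (card {i \<in> {..<l}. u i = -1})"
    using sum_prod_signs(1)[of "{..<l}" u] u by simp
  have "(\<Prod>i<l. u i) = (\<Prod>i<l. sg i) * (\<Prod>i<l. sg (step i))"
    by (simp add: u_def prod.distrib)
  also have "(\<Prod>i<l. sg (step i)) = (\<Prod>i<l. sg i)"
    by (rule prod.reindex_bij_betw[OF step_bij])
  finally have "(-1 :: int) ^ card {i \<in> {..<l}. u i = -1} = 1"
    using sum_prod_signs(2)[of "{..<l}" u] u prod_sg_squared by simp
  then have "even (card {i \<in> {..<l}. u i = -1})"
    by (cases "even (card {i \<in> {..<l}. u i = -1})") simp_all
  then show ?thesis using sum by presburger
qed

lemma prod_sg: "(\<Prod>i<l. sg i) = (-1) ^ card S"
proof -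
  have eq: "S = (\<lambda>i. (i, step i)) ` {i \<in> {..<l}. sg i = -1}"
  proof (intro Set.set_eqI iffI)
    fix a assume a: "a \<in> S"
    obtain u v where uv: "a = (u, v)" by (cases a)
    with a arc_in_S[of u v] have "u < l" "v = step u" "sg u = -1" by (auto simp: sg_def)
    with uv show "a \<in> (\<lambda>i. (i, step i)) ` {i \<in> {..<l}. sg i = -1}" by blast
  next
    fix a assume "a \<in> (\<lambda>i. (i, step i)) ` {i \<in> {..<l}. sg i = -1}"
    then obtain i where "a = (i, step i)" "sg i = -1" by blast
    then show "a \<in> S" by (simp add: sg_def split: if_splits)
  qed
  have inj: "inj_on (\<lambda>i. (i, step i)) {i \<in> {..<l}. sg i = -1}"
    by (auto simp: inj_on_def)
  have "card S = card ((\<lambda>i. (i, step i)) ` {i \<in> {..<l}. sg i = -1})"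
    using eq by (rule arg_cong)
  also have "\<dots> = card {i \<in> {..<l}. sg i = -1}"
    by (rule card_image[OF inj])
  finally have "card S = card {i \<in> {..<l}. sg i = -1}" .
  then show ?thesis
    using sum_prod_signs(2)[of "{..<l}" sg] sg_cases by simp
qed

lemma card_parcs_C: "card (parcs C) = l"
  by (simp add: parcs_C card_image inj_oarc)

lemma hom_density_C:
  assumes A: "weighted_tournament n A"
  shows "hom_density C A = cyc_sum n l (\<lambda>i x y. 1 / (2 * real n) +
    real_of_int (sg i) * ((A $$ (x, y) - 1 / 2) / real n))"
proof -
  have dim: "dim_row A = n" and sum1: "\<And>x y. x < n \<Longrightarrow> y < n \<Longrightarrow> A $$ (x, y) + A $$ (y, x) = 1"
    using A by (auto simp: weighted_tournament_def)
  have "(\<Prod>(x, y)\<in>parcs C. A $$ (\<phi> x, \<phi> y)) / real n ^ l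
      = (\<Prod>i<l. 1 / (2 * real n) + real_of_int (sg i) * ((A $$ (\<phi> i, \<phi> (step i)) - 1 / 2) / real n))"
    if \<phi>: "\<phi> \<in> {..<l} \<rightarrow>\<^sub>E {..<n}" for \<phi>
  proof -
    have "(\<Prod>(x, y)\<in>parcs C. A $$ (\<phi> x, \<phi> y)) / real n ^ l
        = (\<Prod>i<l. (case oarc i of (x, y) \<Rightarrow> A $$ (\<phi> x, \<phi> y)) / real n)"
      unfolding parcs_C prod.reindex[OF inj_oarc] by (simp add: prod_dividef)
    also have "\<dots> = (\<Prod>i<l. 1 / (2 * real n) + real_of_int (sg i) * ((A $$ (\<phi> i, \<phi> (step i)) - 1 / 2) / real n))"
    proof (rule prod.cong[OF refl])
      fix i assume "i \<in> {..<l}"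
      then have less: "\<phi> i < n" "\<phi> (step i) < n"
        using PiE_mem[OF \<phi>, of i] PiE_mem[OF \<phi>, of "step i"] step_less[of i] by simp_all
      \<comment> \<open>Reading a reversed arc along the clockwise direction negates the deviation
        from 1/2, which is the sign \<open>sg i\<close>.\<close>
      then have "A $$ (\<phi> (step i), \<phi> i) = 1 - A $$ (\<phi> i, \<phi> (step i))"
        using sum1[OF less] by linarith
      moreover have "0 < real n" using less by simp
      ultimately show "(case oarc i of (x, y) \<Rightarrow> A $$ (\<phi> x, \<phi> y)) / real n
          = 1 / (2 * real n) + real_of_int (sg i) * ((A $$ (\<phi> i, \<phi> (step i)) - 1 / 2) / real n)"
        by (simp add: oarc_def sg_def field_simps)
    qed
    finally show ?thesis .
  qed
  then show ?thesis
    unfolding hom_density_def cyc_sum_def dim pverts_C by (simp add: sum_divide_distrib)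
qed

end

section \<open>The spectral radius of a skew-symmetric matrix\<close>

text \<open>Evaluate the eigenvalue equation at a coordinate where the eigenvector has its largest
  modulus.\<close>

lemma lambda_max_le:
  assumes B: "B \<in> carrier_mat n n" and n: "0 < n"
    and entry: "\<And>x y. x < n \<Longrightarrow> y < n \<Longrightarrow> \<bar>B $$ (x, y)\<bar> \<le> d"
  shows "lambda_max B \<le> d * real n"
proof -
  define Z where "Z = map_mat complex_of_real B"
  have Z: "Z \<in> carrier_mat n n" using B by (simp add: Z_def)
  obtain a where a: "eigenvalue Z a" "lambda_max B = norm a"
    using spectral_radius_mem_max(1)[OF Z n] unfolding lambda_max_def Z_def[symmetric] spectrum_def by auto
  then obtain v where v: "v \<in> carrier_vec n" "v \<noteq> 0\<^sub>v n" "Z *\<^sub>v v = a \<cdot>\<^sub>v v"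
    using Z by (auto simp: eigenvalue_def eigenvector_def)
  obtain x where x: "x < n" "\<And>y. y < n \<Longrightarrow> norm (v $ y) \<le> norm (v $ x)"
  proof -
    let ?N = "(\<lambda>y. norm (v $ y)) ` {..<n}"
    have "Max ?N \<in> ?N" using n by (intro Max_in) auto
    then obtain x where "x < n" "Max ?N = norm (v $ x)" by auto
    moreover have "norm (v $ y) \<le> Max ?N" if "y < n" for y using that by (intro Max_ge) auto
    ultimately show ?thesis by (intro that[of x]) auto
  qed
  have pos: "0 < norm (v $ x)"
  proof (rule ccontr)
    assume "\<not> 0 < norm (v $ x)"
    then have "norm (v $ x) = 0" by simp
    then have "v $ y = 0" if "y < n" for y using x(2)[OF that] by simp
    then have "v = 0\<^sub>v n" using v(1) by (intro eq_vecI) auto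
    with v(2) show False by simp
  qed
  have "a * v $ x = (Z *\<^sub>v v) $ x" unfolding v(3) using v(1) x(1) by simp
  also have "\<dots> = (\<Sum>y<n. Z $$ (x, y) * v $ y)"
    using Z v(1) x(1) by (simp add: scalar_prod_def lessThan_atLeast0)
  finally have "norm a * norm (v $ x) = norm (\<Sum>y<n. Z $$ (x, y) * v $ y)"
    by (simp flip: norm_mult)
  also have "\<dots> \<le> (\<Sum>y<n. d * norm (v $ x))"
  proof (rule order_trans[OF norm_sum], rule sum_mono)
    fix y assume "y \<in> {..<n}"
    then have y: "y < n" by simp
    have Zd: "norm (Z $$ (x, y)) \<le> d" using entry[of x y] x(1) y B by (simp add: Z_def)
    have "0 \<le> norm (Z $$ (x, y))" by simp
    with Zd have "0 \<le> d" by linarith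
    show "norm (Z $$ (x, y) * v $ y) \<le> d * norm (v $ x)"
      unfolding norm_mult by (rule mult_mono[OF Zd x(2)[OF y] \<open>0 \<le> d\<close> norm_ge_zero])
  qed
  finally have "norm a * norm (v $ x) \<le> (d * real n) * norm (v $ x)"
    by (simp add: mult_ac)
  then show ?thesis using pos a(2) by simp
qed

context skew_kernel
begin

text \<open>Dividing by \<open>r * real n\<close> brings the spectral radius below 1, so by the
  Jordan normal form the powers have uniformly bounded entries. The bound \<open>K\<close> may
  depend on \<open>v\<close> and \<open>n\<close>, since only the growth rate in \<open>j\<close> is
  used.\<close>

lemma iter_bound:
  assumes B: "B \<in> carrier_mat n n" and BM: "\<And>x y. x < n \<Longrightarrow> y < n \<Longrightarrow> B $$ (x, y) = real n * M x y"
    and lam: "lambda_max B \<le> e * real n" and r: "e < r" "0 < r"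
  shows "\<exists>K. \<forall>j. nrm j v \<le> K * (r\<^sup>2) ^ j"
proof -
  define Z where "Z = map_mat complex_of_real B"
  define Y where "Y = mat n n (\<lambda>(x, y). complex_of_real (M x y / r))"
  define W where "W v = vec n (\<lambda>x. complex_of_real (v x))" for v :: "nat \<Rightarrow> real"
  have Z: "Z \<in> carrier_mat n n" using B by (simp add: Z_def)
  have Y: "Y \<in> carrier_mat n n" by (simp add: Y_def)
  have rn: "complex_of_real (r * real n) \<noteq> 0" using r n_pos by simp
  have ZY: "Z = complex_of_real (r * real n) \<cdot>\<^sub>m Y"
    using Z B BM r by (intro eq_matI) (auto simp: Z_def Y_def)
  have "spectral_radius Y < 1"
  proof -
    obtain a where a: "eigenvalue Y a" "spectral_radius Y = norm a"
      using spectral_radius_mem_max(1)[OF Y n_pos] unfolding spectrum_def by auto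
    then obtain w where w: "w \<in> carrier_vec n" "w \<noteq> 0\<^sub>v n" "Y *\<^sub>v w = a \<cdot>\<^sub>v w"
      using Y by (auto simp: eigenvalue_def eigenvector_def)
    have "Z *\<^sub>v w = (complex_of_real (r * real n) * a) \<cdot>\<^sub>v w"
    proof -
      have "Z *\<^sub>v w = complex_of_real (r * real n) \<cdot>\<^sub>v (Y *\<^sub>v w)"
        unfolding ZY using Y w(1) by (intro eq_vecI) auto
      then show ?thesis by (simp add: w(3) smult_smult_assoc)
    qed
    then have "eigenvalue Z (complex_of_real (r * real n) * a)"
      using w Z unfolding eigenvalue_def eigenvector_def by auto
    then have "norm (complex_of_real (r * real n) * a) \<le> lambda_max B"
      unfolding lambda_max_def Z_def[symmetric]
      by (intro spectral_radius_mem_max(2)[OF Z n_pos]) (auto simp: spectrum_def)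
    then have "r * real n * norm a \<le> lambda_max B"
      using r n_pos by (simp add: norm_mult abs_mult)
    then have "(r * norm a) * real n \<le> e * real n"
      using lam by (simp add: mult_ac)
    then have "r * norm a \<le> e" using n_pos by simp
    then have "r * norm a < r * 1" using r by linarith
    then show ?thesis using r a(2) by simp
  qed
  then obtain c where c: "\<And>k. norm_bound (Y ^\<^sub>m k) c"
    using spectral_radius_jnf_norm_bound_less_1_upper_triangular[OF Y] by blast
  \<comment> \<open>Matrices act on columns and \<open>act\<close> on rows; skew-symmetry turns one
    into the negative of the other.\<close>
  have YW: "Y *\<^sub>v W v = W (\<lambda>x. (- 1 / r) * act n M v x)" for v
  proof (rule eq_vecI)
    fix x assume "x < dim_vec (W (\<lambda>x. (- 1 / r) * act n M v x))"
    then have x: "x < n" by (simp add: W_def)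
    have "(Y *\<^sub>v W v) $ x = (\<Sum>y<n. complex_of_real (M x y / r * v y))"
      using x by (simp add: Y_def W_def scalar_prod_def lessThan_atLeast0)
    also have "\<dots> = (\<Sum>y<n. complex_of_real (- 1 / r * (v y * M y x)))"
    proof (rule sum.cong[OF refl])
      fix y assume "y \<in> {..<n}"
      then have "M x y = - M y x" using skew x by blast
      then show "complex_of_real (M x y / r * v y) = complex_of_real (- 1 / r * (v y * M y x))"
        by simp
    qed
    also have "\<dots> = complex_of_real (- 1 / r * act n M v x)"
      by (simp only: act_def sum_distrib_left of_real_sum)
    finally show "(Y *\<^sub>v W v) $ x = W (\<lambda>x. (- 1 / r) * act n M v x) $ x"
      using x by (simp add: W_def)
  qed (simp add: W_def Y_def)
  have power: "(Y ^\<^sub>m k) *\<^sub>v W v = W (\<lambda>x. (- 1 / r) ^ k * iter k v x)" for k v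
  proof (induction k arbitrary: v)
    case 0
    have "1\<^sub>m n *\<^sub>v W v = W v" by (rule one_mult_mat_vec) (simp add: W_def)
    then show ?case using Y by simp
  next
    case (Suc k)
    have "(Y ^\<^sub>m Suc k) *\<^sub>v W v = (Y ^\<^sub>m k) *\<^sub>v (Y *\<^sub>v W v)"
      using Y by (simp add: assoc_mult_mat_vec[of _ n n _ n] pow_carrier_mat[OF Y] W_def)
    also have "\<dots> = W (\<lambda>x. (- 1 / r) ^ k * iter k (\<lambda>x. (- 1 / r) * act n M v x) x)"
      unfolding YW by (rule Suc)
    also have "\<dots> = W (\<lambda>x. (- 1 / r) ^ Suc k * iter (Suc k) v x)"
      unfolding iter_scale by (simp add: funpow_swap1 mult_ac)
    finally show ?case .
  qed
  have mat_vec: "(X *\<^sub>v W v) $ x = (\<Sum>y<n. X $$ (x, y) * complex_of_real (v y))"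
    if "X \<in> carrier_mat n n" "x < n" for X x
    using that by (simp add: W_def scalar_prod_def lessThan_atLeast0)
  define s where "s = (\<Sum>y<n. \<bar>v y\<bar>)"
  have entry: "\<bar>iter k v x\<bar> \<le> r ^ k * (\<bar>c\<bar> * s)" if x: "x < n" for k x
  proof -
    have "\<bar>(- 1 / r) ^ k * iter k v x\<bar> = norm (((Y ^\<^sub>m k) *\<^sub>v W v) $ x)"
      unfolding power using x by (simp add: W_def norm_mult norm_power norm_divide abs_mult power_abs)
    also have "((Y ^\<^sub>m k) *\<^sub>v W v) $ x = (\<Sum>y<n. (Y ^\<^sub>m k) $$ (x, y) * complex_of_real (v y))"
      by (rule mat_vec[OF pow_carrier_mat[OF Y] x])
    also have "norm \<dots> \<le> (\<Sum>y<n. \<bar>c\<bar> * \<bar>v y\<bar>)"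
    proof (rule order_trans[OF norm_sum], rule sum_mono)
      fix y assume "y \<in> {..<n}"
      then have "norm ((Y ^\<^sub>m k) $$ (x, y)) \<le> c"
        using c[of k] x unfolding norm_bound_def carrier_matD[OF pow_carrier_mat[OF Y]] by blast
      then have "norm ((Y ^\<^sub>m k) $$ (x, y)) \<le> \<bar>c\<bar>" by linarith
      then show "norm ((Y ^\<^sub>m k) $$ (x, y) * complex_of_real (v y)) \<le> \<bar>c\<bar> * \<bar>v y\<bar>"
        by (simp add: norm_mult mult_right_mono)
    qed
    also have "\<dots> = \<bar>c\<bar> * s" by (simp add: s_def sum_distrib_left)
    finally have "r ^ k * \<bar>(- 1 / r) ^ k * iter k v x\<bar> \<le> r ^ k * (\<bar>c\<bar> * s)"
      using r by (intro mult_left_mono) auto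
    also have "r ^ k * \<bar>(- 1 / r) ^ k * iter k v x\<bar> = \<bar>iter k v x\<bar>"
      using r by (simp add: abs_mult power_abs power_divide)
    finally show ?thesis .
  qed
  have "nrm k v \<le> (\<bar>c\<bar> * s)\<^sup>2 * (r\<^sup>2) ^ k" for k
  proof -
    have "(\<Sum>x<n. iter k v x * iter k v x) \<le> (\<Sum>x<n. (r ^ k * (\<bar>c\<bar> * s))\<^sup>2)"
    proof (rule sum_mono)
      fix x assume "x \<in> {..<n}"
      then have "\<bar>iter k v x\<bar>\<^sup>2 \<le> (r ^ k * (\<bar>c\<bar> * s))\<^sup>2"
        using entry by (intro power_mono) auto
      then show "iter k v x * iter k v x \<le> (r ^ k * (\<bar>c\<bar> * s))\<^sup>2"
        by (simp add: power2_eq_square)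
    qed
    then have "nrm k v \<le> (r ^ k * (\<bar>c\<bar> * s))\<^sup>2"
      using n_pos by (simp add: nrm_def ip_def divide_le_eq mult.commute)
    then show ?thesis by (simp add: power_mult_distrib power_mult[symmetric] mult_ac)
  qed
  then show ?thesis by blast
qed

text \<open>Since \<open>\<lambda>j. nrm j v\<close> is log-convex, a first ratio above \<open>e\<^sup>2\<close> would
  force growth faster than the spectral radius permits.\<close>
lemma contracting_of_lambda_max:
  assumes B: "B \<in> carrier_mat n n" and BM: "\<And>x y. x < n \<Longrightarrow> y < n \<Longrightarrow> B $$ (x, y) = real n * M x y"
    and lam: "lambda_max B \<le> e * real n" and e: "0 \<le> e"
  shows "ip n (act n M v) (act n M v) \<le> e\<^sup>2 * ip n v v"
proof (rule ccontr)
  assume "\<not> ?thesis"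
  then have gt: "e\<^sup>2 * nrm 0 v < nrm 1 v" by (simp add: nrm_def)
  have n1: "0 < nrm 1 v"
    using gt by (rule le_less_trans[rotated]) simp
  have n0: "0 < nrm 0 v"
  proof (rule ccontr)
    assume "\<not> 0 < nrm 0 v"
    then have "nrm 0 v = 0" using nrm_nonneg[of 0 v] by linarith
    then have "(nrm 1 v)\<^sup>2 \<le> 0" using nrm_log_convex[of 0 v] by simp
    with n1 show False by simp
  qed
  define q where "q = nrm 1 v / nrm 0 v"
  have q: "e\<^sup>2 < q" using gt n0 by (simp add: q_def less_divide_eq)
  \<comment> \<open>The square of \<open>r\<close> is the midpoint of \<open>e\<^sup>2\<close> and
    \<open>q\<close>: above \<open>e\<^sup>2\<close> so that \<open>iter_bound\<close> applies, and
    below \<open>q\<close> so that growth by factors \<open>q\<close> contradicts it.\<close>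
  define r where "r = sqrt ((e\<^sup>2 + q) / 2)"
  have e2: "0 \<le> e\<^sup>2" by simp
  have q_pos: "0 < q" by (rule le_less_trans[OF e2 q])
  then have avg: "0 < (e\<^sup>2 + q) / 2" using e2 by (simp add: add_nonneg_pos)
  then have r2: "r\<^sup>2 = (e\<^sup>2 + q) / 2" "0 < r" by (simp_all only: r_def real_sqrt_pow2 less_imp_le real_sqrt_gt_zero)
  have "e < r" unfolding r_def by (rule real_less_rsqrt) (use q in simp)
  obtain K where K: "\<And>j. nrm j v \<le> K * (r\<^sup>2) ^ j"
    using iter_bound[OF B BM lam \<open>e < r\<close> r2(2)] by blast
  have "1 < q / r\<^sup>2" unfolding r2(1) using avg q by (simp add: less_divide_eq)
  then obtain j where j: "K / nrm 0 v < (q / r\<^sup>2) ^ j" using real_arch_pow by blast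
  have "q ^ j * nrm 0 v \<le> nrm j v"
    by (rule nrm_ge_geometric) (use n0 q_pos in \<open>simp_all add: q_def\<close>)
  also have "\<dots> \<le> K * (r\<^sup>2) ^ j" by (rule K)
  also have "\<dots> < (q / r\<^sup>2) ^ j * nrm 0 v * (r\<^sup>2) ^ j"
    using j n0 r2(2) by (intro mult_strict_right_mono) (simp_all add: divide_less_eq)
  also have "\<dots> = q ^ j * nrm 0 v"
    using r2(2) by (simp add: power_divide)
  finally show False by simp
qed

end

lemma skew_part_carrier: "skew_part n A \<in> carrier_mat n n"
  unfolding skew_part_def by (rule minus_carrier_mat) simp

lemma tournament_kernel:
  assumes A: "weighted_tournament n A" and n: "1 \<le> n"
    and lam: "lambda_max (skew_part n A) \<le> e * real n" and e: "0 \<le> e" "e \<le> 1"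
  shows "contracting_kernel n (\<lambda>x y. (A $$ (x, y) - 1 / 2) / real n) e"
proof -
  let ?M = "\<lambda>x y. (A $$ (x, y) - 1 / 2) / real n"
  have carrier: "A \<in> carrier_mat n n" and sum1: "\<And>x y. x < n \<Longrightarrow> y < n \<Longrightarrow> A $$ (x, y) + A $$ (y, x) = 1"
    using A by (auto simp: weighted_tournament_def)
  interpret skew_kernel n ?M
  proof
    show "0 < n" using n by simp
    fix x y assume "x < n" "y < n"
    then have "A $$ (x, y) - 1 / 2 = - (A $$ (y, x) - 1 / 2)" using sum1[of x y] by linarith
    then show "?M x y = - ?M y x" by (simp only: minus_divide_left)
  qed
  have BM: "skew_part n A $$ (x, y) = real n * ?M x y" if "x < n" "y < n" for x y
    using that carrier n by (simp add: skew_part_def)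
  show ?thesis
    using e contracting_of_lambda_max[OF skew_part_carrier BM lam] by unfold_locales auto
qed

section \<open>Local behaviour of the density\<close>

context oriented_cycle
begin

definition path_count :: "nat \<Rightarrow> int" where
  "path_count k = (\<Sum>F\<in>single_arcs l k. \<Prod>i\<in>F. sg i)"

definition pair_count :: int where
  "pair_count = (\<Sum>F\<in>double_arcs l. \<Prod>i\<in>F. sg i)"

lemma abs_prod_sg: "\<bar>\<Prod>i\<in>F. sg i\<bar> = 1"
  by (simp add: abs_prod sg_def)

lemma abs_family_sum_le:
  assumes "\<F> \<subseteq> Pow {..<l}" shows "\<bar>\<Sum>F\<in>\<F>. \<Prod>i\<in>F. sg i\<bar> \<le> 2 ^ l"
proof -
  have "\<bar>\<Sum>F\<in>\<F>. \<Prod>i\<in>F. sg i\<bar> \<le> (\<Sum>F\<in>\<F>. \<bar>\<Prod>i\<in>F. sg i\<bar>)"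
    by (rule sum_abs)
  also have "\<dots> = int (card \<F>)"
    by (simp add: abs_prod_sg)
  also have "card \<F> \<le> card (Pow {..<l})"
    using assms by (intro card_mono) auto
  finally show ?thesis by (simp add: card_Pow)
qed

lemma path_count_le: "\<bar>real_of_int (path_count k)\<bar> \<le> 2 ^ l"
  using abs_family_sum_le[OF single_arcs_subset_Pow, of k] unfolding path_count_def
  by (metis of_int_abs of_int_le_iff of_int_numeral of_int_power)

lemma pair_count_le: "\<bar>real_of_int pair_count\<bar> \<le> 2 ^ l"
  using abs_family_sum_le[OF double_arcs_subset_Pow] unfolding pair_count_def
  by (metis of_int_abs of_int_le_iff of_int_numeral of_int_power)

lemma path_count_less: "path_count k \<noteq> 0 \<Longrightarrow> 2 * k < l"
  unfolding path_count_def by (rule ccontr) (simp add: single_arcs_def)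

lemma pair_count_less: "pair_count \<noteq> 0 \<Longrightarrow> 4 < l"
proof -
  assume "pair_count \<noteq> 0"
  then have "double_arcs l \<noteq> {}" by (auto simp: pair_count_def)
  then show "4 < l" using double_arcs_card by blast
qed

end

text \<open>The last two assumptions allow either the least index of a nonzero path count or, if all
  path counts vanish, an arbitrary positive \<open>k\<close>; both situations are then treated
  together.\<close>

locale cycle_tournament = oriented_cycle l S + contracting_kernel n M e
  for l S n M e +
  fixes A :: "real mat" and k :: nat
  assumes A: "weighted_tournament n A"
    and M: "\<And>x y. x < n \<Longrightarrow> y < n \<Longrightarrow> M x y = (A $$ (x, y) - 1 / 2) / real n"
    and four_l: "4 dvd l"
    and k: "1 \<le> k"
    and below_k: "\<And>j. 1 \<le> j \<Longrightarrow> j < k \<Longrightarrow> path_count j = 0"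
    and none: "path_count k = 0 \<Longrightarrow> 1 \<le> j \<Longrightarrow> path_count j = 0"
begin

definition excess :: real where "excess = hom_density C A - (1 / 2) ^ l"

definition trace_term :: real where "trace_term = tau l {..<l}"

text \<open>The factor \<open>path_count k\<close> removes \<open>P k\<close> from the error when
  the main part has no path term to absorb it.\<close>

definition err :: real where
  "err = real l * 2 ^ l * (e\<^sup>2 * (\<bar>real_of_int (path_count k)\<bar> * P k + (P 1)\<^sup>2))"

text \<open>Path counts below \<open>k\<close> vanish, and each \<open>P j\<close> with
  \<open>j > k\<close> is at most \<open>e\<^sup>2 * P k\<close>. When \<open>path_count k\<close>
  is nonzero, it is an integer of modulus at least 1, so the factor may be inserted on the
  right.\<close>

lemma path_terms:
  "\<bar>(\<Sum>j=1..<l. (1 / 2) ^ (l - 2 * j) * real_of_int (path_count j) * ((-1) ^ j * P j))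
     - (1 / 2) ^ (l - 2 * k) * real_of_int (path_count k) * ((-1) ^ k * P k)\<bar>
   \<le> real (l - 1) * 2 ^ l * (e\<^sup>2 * (\<bar>real_of_int (path_count k)\<bar> * P k))"
proof (cases "path_count k = 0")
  case True
  then show ?thesis using none by simp
next
  case False
  define g where "g j = (1 / 2) ^ (l - 2 * j) * real_of_int (path_count j) * ((-1) ^ j * P j)" for j
  have "k \<in> {1..<l}" using k path_count_less[OF False] by auto
  then have "(\<Sum>j=1..<l. g j) - g k = (\<Sum>j\<in>{1..<l} - {k}. g j)"
    by (simp add: sum_diff1)
  also have "\<bar>\<dots>\<bar> \<le> (\<Sum>j\<in>{1..<l} - {k}. 2 ^ l * (e\<^sup>2 * P k))"
  proof (rule order_trans[OF sum_abs], rule sum_mono)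
    fix j assume j: "j \<in> {1..<l} - {k}"
    show "\<bar>g j\<bar> \<le> 2 ^ l * (e\<^sup>2 * P k)"
    proof (cases "j < k")
      case True
      then show ?thesis using below_k j e2 by (simp add: g_def)
    next
      case False
      then have "P j \<le> e\<^sup>2 * P k" using j unfolding P_def by (intro nrm_le_strict) auto
      moreover have "\<bar>g j\<bar> = (1 / 2) ^ (l - 2 * j) * \<bar>real_of_int (path_count j)\<bar> * P j"
        by (simp add: g_def abs_mult power_abs)
      moreover have "(1 / 2 :: real) ^ (l - 2 * j) * \<bar>real_of_int (path_count j)\<bar> \<le> 1 * 2 ^ l"
        by (intro mult_mono path_count_le) (auto simp: power_le_one)
      ultimately show ?thesis by (simp only:) (intro mult_mono; simp)
    qed
  qed
  also have "\<dots> = real (l - 1) * 2 ^ l * (e\<^sup>2 * P k) - 2 ^ l * (e\<^sup>2 * P k)"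
    using \<open>k \<in> {1..<l}\<close> by (simp add: card_Diff_singleton algebra_simps)
  also have "\<dots> \<le> real (l - 1) * 2 ^ l * (e\<^sup>2 * P k)"
    using e2 by simp
  also have "\<dots> \<le> real (l - 1) * 2 ^ l * (e\<^sup>2 * (\<bar>real_of_int (path_count k)\<bar> * P k))"
  proof -
    have "1 \<le> \<bar>real_of_int (path_count k)\<bar>" using False by linarith
    then have "1 * P k \<le> \<bar>real_of_int (path_count k)\<bar> * P k" by (rule mult_right_mono) simp
    then show ?thesis by (intro mult_left_mono) (use e2 in auto)
  qed
  finally show ?thesis by (simp add: g_def)
qed

lemma excess_approx:
  "\<bar>excess - real_of_int (\<Prod>i<l. sg i) * trace_term
     - (1 / 2) ^ (l - 2 * k) * real_of_int (path_count k) * ((-1) ^ k * P k)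
     - (1 / 2) ^ (l - 4) * real_of_int pair_count * (P 1)\<^sup>2\<bar> \<le> err"
proof -
  let ?s = "\<lambda>i. real_of_int (sg i)"
  have single: "single_sum l ?s j = real_of_int (path_count j)" for j
    by (simp add: single_sum_def path_count_def)
  have double: "double_sum l ?s = real_of_int pair_count"
    by (simp add: double_sum_def pair_count_def)
  have hom: "hom_density C A = cyc_sum n l (\<lambda>i x y. 1 / (2 * real n) + ?s i * M x y)"
    unfolding hom_density_C[OF A] by (rule cyc_sum_cong) (simp add: M)
  have l0: "0 < l" using l by simp
  have "\<bar>?s i\<bar> = 1" for i by (simp add: sg_def)
  note main = cyc_sum_approx[OF l0, of ?s, OF this, folded hom, unfolded single double]
  have prod: "(\<Prod>i<l. ?s i) = real_of_int (\<Prod>i<l. sg i)" by simp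
  have "err = real (l - 1) * 2 ^ l * (e\<^sup>2 * (\<bar>real_of_int (path_count k)\<bar> * P k))
      + 2 ^ l * (e\<^sup>2 * (P 1)\<^sup>2) + 2 ^ l * (e\<^sup>2 * (\<bar>real_of_int (path_count k)\<bar> * P k))
      + real (l - 1) * 2 ^ l * (e\<^sup>2 * (P 1)\<^sup>2)"
    using l0 by (simp add: err_def algebra_simps)
  moreover have "0 \<le> 2 ^ l * (e\<^sup>2 * (\<bar>real_of_int (path_count k)\<bar> * P k))"
    "0 \<le> real (l - 1) * 2 ^ l * (e\<^sup>2 * (P 1)\<^sup>2)"
    using e2 by simp_all
  ultimately show ?thesis
    using main path_terms unfolding excess_def trace_term_def prod by linarith
qed

lemma excess_lower:
  assumes "\<bar>z\<bar> = 1"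
  shows "z * real_of_int (\<Prod>i<l. sg i) * trace_term
      + (1 / 2) ^ (l - 2 * k) * (z * (-1) ^ k * real_of_int (path_count k)) * P k
      + (1 / 2) ^ (l - 4) * (z * real_of_int pair_count) * (P 1)\<^sup>2 - err \<le> z * excess"
proof -
  consider "z = 1" | "z = -1" using assms by linarith
  then show ?thesis
    by cases (use excess_approx in \<open>simp_all add: mult_ac abs_le_iff\<close>)
qed

lemma trace_term_eq: "trace_term = real n * (\<Sum>x<n. nrm (l div 2) (unit_fun x))"
proof -
  have "4 * (l div 4) = l" "2 * (l div 4) = l div 2" using four_l by presburger+
  then show ?thesis using tau_full_four[of "l div 4"] l by (simp add: trace_term_def)
qed

lemma trace_term_nonneg: "0 \<le> trace_term"
  unfolding trace_term_eq by (intro mult_nonneg_nonneg sum_nonneg) auto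

text \<open>Each unit vector has squared norm \<open>1 / real n\<close> and loses a factor
  \<open>e\<^sup>2\<close> in each of \<open>l div 2\<close> steps.\<close>

lemma trace_term_le: "trace_term \<le> real n * e ^ l"
proof -
  have power: "nrm j v \<le> (e\<^sup>2) ^ j * nrm 0 v" for j v
  proof (induction j)
    case (Suc j)
    have "nrm (Suc j) v \<le> e\<^sup>2 * nrm j v" by (rule nrm_Suc_le)
    also have "\<dots> \<le> e\<^sup>2 * ((e\<^sup>2) ^ j * nrm 0 v)" using Suc e2 by (intro mult_left_mono) auto
    finally show ?case by (simp add: mult_ac)
  qed simp
  have unit: "nrm 0 (unit_fun x) = 1 / real n" if "x < n" for x
  proof -
    have "(\<Sum>y<n. unit_fun x y * unit_fun x y) = (\<Sum>y<n. if y = x then 1 else 0)"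
      by (rule sum.cong) (auto simp: unit_fun_def)
    then show ?thesis using that by (simp add: nrm_def ip_def)
  qed
  have "2 * (l div 2) = l" using four_l by (elim dvdE) simp
  then have el: "(e\<^sup>2) ^ (l div 2) = e ^ l" by (simp flip: power_mult)
  have "nrm (l div 2) (unit_fun x) \<le> e ^ l * (1 / real n)" if "x < n" for x
    using power[of "l div 2" "unit_fun x"] unfolding el unit[OF that] .
  then have "trace_term \<le> real n * (\<Sum>x<n. e ^ l * (1 / real n))"
    unfolding trace_term_eq by (intro mult_left_mono sum_mono) auto
  also have "\<dots> = real n * e ^ l" using n_pos by simp
  finally show ?thesis .
qed

end

context oriented_cycle
begin

text \<open>All three main terms have the sign of \<open>z\<close>. The trace is simply discarded,
  and the error is absorbed by the path and pair terms.\<close>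

lemma local_sign:
  assumes z: "\<bar>z\<bar> = (1 :: real)" and four: "4 dvd l" and k: "1 \<le> k"
    and below: "\<And>j. 1 \<le> j \<Longrightarrow> j < k \<Longrightarrow> path_count j = 0"
    and none: "\<And>j. path_count k = 0 \<Longrightarrow> 1 \<le> j \<Longrightarrow> path_count j = 0"
    and pair: "0 < z * real_of_int pair_count"
    and path: "0 \<le> z * (-1) ^ k * real_of_int (path_count k)"
    and prod: "z * real_of_int (\<Prod>i<l. sg i) = 1"
  shows "\<exists>\<epsilon>>0. \<forall>n\<ge>1. \<forall>A. weighted_tournament n A \<and> lambda_max (skew_part n A) \<le> \<epsilon> * real n \<longrightarrow>
     0 \<le> z * (hom_density C A - (1 / 2) ^ l)"
proof -
  define K where "K = real l * 2 ^ l"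
  have K: "1 \<le> K"
  proof -
    have "1 * 1 \<le> real l * 2 ^ l" using l by (intro mult_mono) auto
    then show ?thesis by (simp add: K_def)
  qed
  \<comment> \<open>Then \<open>K * \<epsilon>\<^sup>2 \<le> (1 / 2) ^ l\<close>, which is at most
    each power of 1/2 in the main terms. The path coefficient is the same in \<open>err\<close> and
    in the main term, and the pair count is a nonzero integer, so the error is covered term by
    term.\<close>
  define \<epsilon> where "\<epsilon> = (1 / 2) ^ l / K"
  have \<epsilon>: "0 < \<epsilon>" "\<epsilon> \<le> 1" "K * \<epsilon> = (1 / 2) ^ l"
  proof -
    show "0 < \<epsilon>" using K by (simp add: \<epsilon>_def)
    have "(1 / 2 :: real) ^ l \<le> 1" by (rule power_le_one) auto
    then show "\<epsilon> \<le> 1" using K by (simp add: \<epsilon>_def divide_le_eq)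
    show "K * \<epsilon> = (1 / 2) ^ l" using K by (simp add: \<epsilon>_def)
  qed
  have "0 \<le> z * (hom_density C A - (1 / 2) ^ l)"
    if n: "1 \<le> n" and A: "weighted_tournament n A" and lam: "lambda_max (skew_part n A) \<le> \<epsilon> * real n" for n A
  proof -
    interpret contracting_kernel n "\<lambda>x y. (A $$ (x, y) - 1 / 2) / real n" \<epsilon>
      by (rule tournament_kernel[OF A n lam less_imp_le[OF \<epsilon>(1)] \<epsilon>(2)])
    interpret cycle_tournament l S n "\<lambda>x y. (A $$ (x, y) - 1 / 2) / real n" \<epsilon> A k
      by unfold_locales (rule A, rule refl, rule four, rule k, erule (1) below, erule (1) none)
    define g where "g = z * (-1) ^ k * real_of_int (path_count k)"
    define h where "h = z * real_of_int pair_count"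
    have g: "\<bar>real_of_int (path_count k)\<bar> = g"
    proof -
      have "\<bar>g\<bar> = \<bar>real_of_int (path_count k)\<bar>" using z by (simp add: g_def abs_mult power_abs)
      then show ?thesis using path by (simp add: g_def)
    qed
    have h: "1 \<le> h"
    proof -
      have "\<bar>h\<bar> = \<bar>real_of_int pair_count\<bar>" using z by (simp add: h_def abs_mult)
      moreover have "0 < h" using pair by (simp add: h_def)
      moreover have "1 \<le> \<bar>real_of_int pair_count\<bar>"
      proof -
        have "pair_count \<noteq> 0" using pair by auto
        then show ?thesis by linarith
      qed
      ultimately show ?thesis by linarith
    qed
    have pow: "(1 / 2 :: real) ^ l \<le> (1 / 2) ^ (l - i)" for i
      by (intro power_decreasing) auto
    have "\<epsilon>\<^sup>2 \<le> \<epsilon>" using \<epsilon> by (simp add: power2_eq_square mult_left_le)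
    then have "K * \<epsilon>\<^sup>2 \<le> (1 / 2) ^ l" using \<epsilon>(3) K by (metis mult_left_mono order_trans zero_le_one)
    then have "err \<le> (1 / 2) ^ l * (g * P k + (P 1)\<^sup>2)"
      unfolding err_def g K_def[symmetric] mult.assoc[symmetric]
      by (intro mult_right_mono) (use path in \<open>auto simp: g_def\<close>)
    also have "\<dots> = (1 / 2) ^ l * g * P k + (1 / 2) ^ l * 1 * (P 1)\<^sup>2"
      by (simp add: algebra_simps)
    also have "\<dots> \<le> (1 / 2) ^ (l - 2 * k) * g * P k + (1 / 2) ^ (l - 4) * h * (P 1)\<^sup>2"
      using h g by (intro add_mono mult_mono pow) auto
    finally have "err \<le> (1 / 2) ^ (l - 2 * k) * g * P k + (1 / 2) ^ (l - 4) * h * (P 1)\<^sup>2" .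
    then have "0 \<le> z * excess"
      using excess_lower[OF z] trace_term_nonneg unfolding prod g_def h_def by linarith
    then show ?thesis by (simp add: excess_def)
  qed
  then show ?thesis using \<epsilon>(1) by blast
qed

end

section \<open>Four-vertex tournaments\<close>

text \<open>
  The kernel \<open>\<delta> (x y\<^sup>T - y x\<^sup>T)\<close>, where \<open>x\<close> is orthogonal to \<open>y\<close> and to the all-ones vector, and the
  entries of \<open>y\<close> add up to \<open>\<tau>\<close>: thus \<open>\<delta>\<close> controls the eigenvalues and \<open>\<tau>\<close> independently scales all
  the \<open>P k\<close>.
\<close>
definition ex_x :: "nat \<Rightarrow> real" where
  "ex_x i = (if i = 0 then 1 else if i = 1 then -1 else 0)"

definition ex_y :: "real \<Rightarrow> nat \<Rightarrow> real" where
  "ex_y \<tau> i = (if i = 2 then 1 else if i = 3 then \<tau> - 1 else 0)"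

definition ex_M :: "real \<Rightarrow> real \<Rightarrow> nat \<Rightarrow> nat \<Rightarrow> real" where
  "ex_M \<delta> \<tau> i j = \<delta> * (ex_x i * ex_y \<tau> j - ex_y \<tau> i * ex_x j)"

text \<open>The factor 4 is the number of vertices and undoes the normalisation in
  \<open>M\<close>.\<close>

definition ex_A :: "real \<Rightarrow> real \<Rightarrow> real mat" where
  "ex_A \<delta> \<tau> = mat 4 4 (\<lambda>(i, j). 1 / 2 + 4 * ex_M \<delta> \<tau> i j)"

lemma sum_lessThan_4: "(\<Sum>i<4. f i) = f 0 + f 1 + f 2 + (f (3 :: nat) :: real)"
  by (simp add: eval_nat_numeral)

lemma ex_M_le:
  assumes "0 \<le> \<delta>" "0 \<le> \<tau>" "\<tau> \<le> 1"
  shows "\<bar>ex_M \<delta> \<tau> i j\<bar> \<le> \<delta>"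
proof -
  have "\<bar>ex_x i * ex_y \<tau> j - ex_y \<tau> i * ex_x j\<bar> \<le> 1"
    using assms by (auto simp: ex_x_def ex_y_def)
  then have "\<delta> * \<bar>ex_x i * ex_y \<tau> j - ex_y \<tau> i * ex_x j\<bar> \<le> \<delta> * 1"
    using assms by (intro mult_left_mono)
  then show ?thesis using assms by (simp add: ex_M_def abs_mult)
qed

text \<open>The factor \<open>\<tau>\<close> is the sum of the entries of
  \<open>ex_y \<tau>\<close>; the other part vanishes because the entries of \<open>ex_x\<close> add
  up to 0.\<close>

lemma act_ex_one: "act 4 (ex_M \<delta> \<tau>) ones = (\<lambda>j. - (\<delta> * \<tau>) * ex_x j)"
  unfolding act_def sum_lessThan_4 by (simp add: fun_eq_iff ex_M_def ex_x_def ex_y_def algebra_simps)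

lemma act_ex_x: "act 4 (ex_M \<delta> \<tau>) ex_x = (\<lambda>j. 2 * \<delta> * ex_y \<tau> j)"
  unfolding act_def sum_lessThan_4 by (simp add: fun_eq_iff ex_M_def ex_x_def ex_y_def algebra_simps)

lemma act_ex_unit: "act 4 (ex_M \<delta> \<tau>) (unit_fun 0) = (\<lambda>j. \<delta> * ex_y \<tau> j)"
  unfolding act_def sum_lessThan_4
  by (simp add: fun_eq_iff ex_M_def ex_x_def ex_y_def unit_fun_def algebra_simps)

lemma ip_ex_x: "ip 4 ex_x ex_x = 1 / 2"
  unfolding ip_def sum_lessThan_4 by (simp add: ex_x_def)

lemma ip_ex_y: "ip 4 (ex_y \<tau>) (ex_y \<tau>) = (1 + (\<tau> - 1)\<^sup>2) / 4"
  unfolding ip_def sum_lessThan_4 by (simp add: ex_y_def power2_eq_square)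

lemma ex_skew_kernel: "skew_kernel 4 (ex_M \<delta> \<tau>)"
  by unfold_locales (simp_all add: ex_M_def algebra_simps)

lemma ex_P1: "skew_kernel.P 4 (ex_M \<delta> \<tau>) 1 = \<delta>\<^sup>2 * \<tau>\<^sup>2 / 2"
proof -
  interpret skew_kernel 4 "ex_M \<delta> \<tau>" by (rule ex_skew_kernel)
  have "P 1 = (- (\<delta> * \<tau>)) * ((- (\<delta> * \<tau>)) * (1 / 2))"
    by (simp only: P_def nrm_def One_nat_def funpow.simps o_apply id_apply act_ex_one ip_scale ip_ex_x)
  then show ?thesis by (simp add: power2_eq_square)
qed

text \<open>In contrast to the step from \<open>P 0\<close> to \<open>P 1\<close>, this ratio has a
  lower bound independent of \<open>\<tau>\<close>; it starts the geometric lower bound for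
  \<open>P k\<close>.\<close>

lemma ex_P2: "\<delta>\<^sup>2 * skew_kernel.P 4 (ex_M \<delta> \<tau>) 1 \<le> skew_kernel.P 4 (ex_M \<delta> \<tau>) 2"
proof -
  interpret skew_kernel 4 "ex_M \<delta> \<tau>" by (rule ex_skew_kernel)
  have "P 2 = (- (\<delta> * \<tau>)) * ((2 * \<delta>) * ((- (\<delta> * \<tau>)) * ((2 * \<delta>) * ((1 + (\<tau> - 1)\<^sup>2) / 4))))"
    by (simp only: P_def nrm_def numeral_2_eq_2 funpow.simps o_apply id_apply act_ex_one act_scale act_ex_x
        ip_scale ip_ex_y)
  then have "P 2 = \<delta>\<^sup>2 * (\<delta>\<^sup>2 * \<tau>\<^sup>2) * (1 + (\<tau> - 1)\<^sup>2)"
    by (simp add: power2_eq_square)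
  moreover have "\<delta>\<^sup>2 * (\<delta>\<^sup>2 * \<tau>\<^sup>2) * (1 / 2) \<le> \<delta>\<^sup>2 * (\<delta>\<^sup>2 * \<tau>\<^sup>2) * (1 + (\<tau> - 1)\<^sup>2)"
  proof (rule mult_left_mono)
    have "0 \<le> (\<tau> - 1)\<^sup>2" by simp
    then show "1 / 2 \<le> 1 + (\<tau> - 1)\<^sup>2" by simp
  qed simp
  ultimately show ?thesis unfolding ex_P1 by simp
qed

text \<open>The deviation from 1/2 is at most \<open>4 * \<delta>\<close>, so
  \<open>\<delta> \<le> 1 / 8\<close> keeps the entries between 0 and 1.\<close>

lemma ex_weighted_tournament:
  assumes "0 \<le> \<delta>" "\<delta> \<le> 1 / 8" "0 \<le> \<tau>" "\<tau> \<le> 1"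
  shows "weighted_tournament 4 (ex_A \<delta> \<tau>)"
proof -
  have range: "0 \<le> 1 / 2 + 4 * ex_M \<delta> \<tau> i j \<and> 1 / 2 + 4 * ex_M \<delta> \<tau> i j \<le> 1" for i j
  proof -
    have "8 * \<delta> \<le> 1" using assms(2) by simp
    with ex_M_le[OF assms(1,3,4), of i j] have "- 1 \<le> 8 * ex_M \<delta> \<tau> i j" "8 * ex_M \<delta> \<tau> i j \<le> 1"
      by linarith+
    moreover have "1 / 2 + 4 * ex_M \<delta> \<tau> i j = (1 + 8 * ex_M \<delta> \<tau> i j) / 2" by simp
    ultimately show ?thesis by simp
  qed
  have "1 / 2 + 4 * ex_M \<delta> \<tau> i j + (1 / 2 + 4 * ex_M \<delta> \<tau> j i) = 1" for i j
    by (simp add: ex_M_def algebra_simps)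
  with range show ?thesis
    unfolding weighted_tournament_def by (simp add: ex_A_def)
qed

lemma ex_skew_part:
  assumes "i < 4" "j < 4" shows "skew_part 4 (ex_A \<delta> \<tau>) $$ (i, j) = 4 * ex_M \<delta> \<tau> i j"
  using assms by (simp add: skew_part_def ex_A_def)

lemma ex_lambda_max:
  assumes "0 \<le> \<delta>" "0 \<le> \<tau>" "\<tau> \<le> 1"
  shows "lambda_max (skew_part 4 (ex_A \<delta> \<tau>)) \<le> (4 * \<delta>) * real 4"
proof (rule lambda_max_le[OF skew_part_carrier])
  fix i j :: nat assume "i < 4" "j < 4"
  then show "\<bar>skew_part 4 (ex_A \<delta> \<tau>) $$ (i, j)\<bar> \<le> 4 * \<delta>"
    using ex_M_le[OF assms, of i j] by (simp add: ex_skew_part abs_mult)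
qed simp

lemma ex_contracting_kernel:
  assumes "0 \<le> \<delta>" "\<delta> \<le> 1 / 8" "0 \<le> \<tau>" "\<tau> \<le> 1"
  shows "contracting_kernel 4 (ex_M \<delta> \<tau>) (4 * \<delta>)"
proof -
  interpret skew_kernel 4 "ex_M \<delta> \<tau>" by (rule ex_skew_kernel)
  show ?thesis
  proof unfold_locales
    fix v
    show "ip 4 (act 4 (ex_M \<delta> \<tau>) v) (act 4 (ex_M \<delta> \<tau>) v) \<le> (4 * \<delta>)\<^sup>2 * ip 4 v v"
      by (rule contracting_of_lambda_max[OF skew_part_carrier[of 4 "ex_A \<delta> \<tau>"] _ ex_lambda_max])
        (use assms in \<open>simp_all add: ex_skew_part\<close>)
  qed (use assms in auto)
qed

lemma choose_small:
  assumes "0 < \<epsilon>" "0 < a" "0 \<le> (c :: real)"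
  obtains \<delta> where "0 < \<delta>" "\<delta> \<le> 1 / 8" "4 * \<delta> \<le> \<epsilon>" "c * \<delta>\<^sup>2 < a"
proof
  \<comment> \<open>As \<open>\<delta>\<^sup>2 \<le> \<delta>\<close>, the last bound gives
    \<open>c * \<delta>\<^sup>2 \<le> c * a / (c + 1) < a\<close>; adding 1 also avoids division by
    zero.\<close>
  define \<delta> where "\<delta> = min (1 / 8) (min (\<epsilon> / 4) (a / (c + 1)))"
  have \<delta>: "\<delta> \<le> 1 / 8" "\<delta> \<le> \<epsilon> / 4" "\<delta> \<le> a / (c + 1)"
    unfolding \<delta>_def by (rule min.cobounded1, rule min.coboundedI2, rule min.cobounded1,
        rule min.coboundedI2, rule min.cobounded2)
  show *: "0 < \<delta>" "\<delta> \<le> 1 / 8" "4 * \<delta> \<le> \<epsilon>"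
    using assms \<delta>(1,2) unfolding \<delta>_def by (simp_all add: le_divide_eq mult.commute add_nonneg_pos)
  have "\<delta> \<le> 1" using *(2) by (rule order_trans) simp
  then have "\<delta>\<^sup>2 \<le> \<delta>" using *(1) by (simp add: power2_eq_square mult_left_le)
  then have "c * \<delta>\<^sup>2 \<le> c * \<delta>" using assms by (intro mult_left_mono)
  also have "\<dots> \<le> c * (a / (c + 1))" using \<delta>(3) assms(3) by (rule mult_left_mono)
  also have "\<dots> < a" using assms by (simp add: field_simps)
  finally show "c * \<delta>\<^sup>2 < a" .
qed

section \<open>Realising a prescribed sign of the deviation\<close>

context oriented_cycle
begin

text \<open>For \<open>z = 1\<close> this refutes \<open>LTAS\<close>, for \<open>z = -1\<close> it
  refutes \<open>LTS\<close>.\<close>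

definition attains :: "real \<Rightarrow> bool" where
  "attains z \<longleftrightarrow> (\<forall>\<epsilon>>0. \<exists>n\<ge>1. \<exists>A. weighted_tournament n A \<and>
     lambda_max (skew_part n A) \<le> \<epsilon> * real n \<and> 0 < z * (hom_density C A - (1 / 2) ^ l))"

context
  fixes z :: real and k :: nat
  assumes z: "\<bar>z\<bar> = 1" and four: "4 dvd l" and k: "1 \<le> k"
    and below: "\<And>j. 1 \<le> j \<Longrightarrow> j < k \<Longrightarrow> path_count j = 0"
    and none: "\<And>j. path_count k = 0 \<Longrightarrow> 1 \<le> j \<Longrightarrow> path_count j = 0"
begin

lemma ex_cycle_tournament:
  assumes "0 \<le> \<delta>" "\<delta> \<le> 1 / 8" "0 \<le> \<tau>" "\<tau> \<le> 1"
  shows "cycle_tournament l S 4 (ex_M \<delta> \<tau>) (4 * \<delta>) (ex_A \<delta> \<tau>) k"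
proof -
  interpret contracting_kernel 4 "ex_M \<delta> \<tau>" "4 * \<delta>"
    by (rule ex_contracting_kernel[OF assms])
  show ?thesis
  proof unfold_locales
    show "weighted_tournament 4 (ex_A \<delta> \<tau>)" by (rule ex_weighted_tournament[OF assms])
    show "ex_M \<delta> \<tau> x y = (ex_A \<delta> \<tau> $$ (x, y) - 1 / 2) / real 4" if "x < 4" "y < 4" for x y
      using that by (simp add: ex_A_def)
  qed (rule four, rule k, erule (1) below, erule (1) none)
qed

text \<open>The eigenvalue bound holds for every \<open>\<tau>\<close> between 0 and 1, so
  \<open>\<tau>\<close> may be chosen after \<open>\<delta>\<close>. The condition with
  \<open>a\<close> and \<open>c\<close> is how small \<open>\<delta>\<close> must be for the leading
  term to win.\<close>

lemma attainsI:
  assumes "0 < a" "0 \<le> c"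
    and "\<And>\<delta>. 0 < \<delta> \<Longrightarrow> \<delta> \<le> 1 / 8 \<Longrightarrow> c * \<delta>\<^sup>2 < a \<Longrightarrow>
      \<exists>\<tau>. 0 \<le> \<tau> \<and> \<tau> \<le> 1 \<and> 0 < z * (hom_density C (ex_A \<delta> \<tau>) - (1 / 2) ^ l)"
  shows "attains z"
  unfolding attains_def
proof (intro allI impI)
  fix \<epsilon> :: real assume "0 < \<epsilon>"
  then obtain \<delta> where \<delta>: "0 < \<delta>" "\<delta> \<le> 1 / 8" "4 * \<delta> \<le> \<epsilon>" "c * \<delta>\<^sup>2 < a"
    using choose_small assms(1,2) by blast
  then obtain \<tau> where \<tau>: "0 \<le> \<tau>" "\<tau> \<le> 1" "0 < z * (hom_density C (ex_A \<delta> \<tau>) - (1 / 2) ^ l)"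
    using assms(3) by blast
  have "lambda_max (skew_part 4 (ex_A \<delta> \<tau>)) \<le> (4 * \<delta>) * real 4"
    using ex_lambda_max \<delta>(1) \<tau>(1,2) by simp
  also have "\<dots> \<le> \<epsilon> * real 4" using \<delta>(3) by simp
  finally show "\<exists>n\<ge>1. \<exists>A. weighted_tournament n A \<and>
      lambda_max (skew_part n A) \<le> \<epsilon> * real n \<and> 0 < z * (hom_density C A - (1 / 2) ^ l)"
    using ex_weighted_tournament[of \<delta> \<tau>] \<delta>(1,2) \<tau> by (intro exI[of _ 4]) auto
qed

text \<open>At \<open>\<tau> = 0\<close> all row sums of the kernel vanish; hence so do
  \<open>P 1\<close>, \<open>P k\<close> and the error, and only the trace is left.\<close>

lemma attains_trace:
  assumes "z * real_of_int (\<Prod>i<l. sg i) = 1"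
  shows "attains z"
proof (rule attainsI[of 1 0])
  fix \<delta> :: real assume \<delta>: "0 < \<delta>" "\<delta> \<le> 1 / 8"
  interpret cycle_tournament l S 4 "ex_M \<delta> 0" "4 * \<delta>" "ex_A \<delta> 0" k
    by (rule ex_cycle_tournament) (use \<delta> in auto)
  have P1: "P 1 = 0" using ex_P1[of \<delta> 0] by simp
  have Pk: "P k = 0"
    using P_le_P1[OF k] unfolding P1 by (rule order_antisym) simp
  have u0: "nrm 0 (unit_fun 0) = 1 / 4"
    unfolding nrm_def ip_def sum_lessThan_4 by (simp add: unit_fun_def)
  have u1: "nrm 1 (unit_fun 0) = \<delta>\<^sup>2 / 2"
    by (simp add: nrm_def act_ex_unit ip_ex_y power2_eq_square)
  \<comment> \<open>The first ratio of norms is \<open>2 * \<delta>\<^sup>2\<close>, so by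
    log-convexity no iterate of this unit vector vanishes.\<close>
  have "0 < nrm (l div 2) (unit_fun 0)"
    using nrm_ratio[of "unit_fun 0" "2 * \<delta>\<^sup>2" "l div 2"] u0 u1 \<delta> by simp
  then have "0 < trace_term"
    unfolding trace_term_eq sum_lessThan_4 by (simp add: add_pos_nonneg)
  moreover have "err = 0" unfolding err_def P1 Pk by simp
  ultimately have "0 < z * excess"
    using excess_lower[OF z] unfolding assms P1 Pk by simp
  then show "\<exists>\<tau>. 0 \<le> \<tau> \<and> \<tau> \<le> 1 \<and> 0 < z * (hom_density C (ex_A \<delta> \<tau>) - (1 / 2) ^ l)"
    unfolding excess_def by (intro exI[of _ 0]) auto
qed auto

lemma signed_lower:
  assumes "0 \<le> t" shows "- t \<le> z * real_of_int (\<Prod>i<l. sg i) * t"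
proof -
  define x where "x = z * real_of_int (\<Prod>i<l. sg i)"
  have "\<bar>real_of_int (\<Prod>i<l. sg i)\<bar> = real_of_int \<bar>\<Prod>i<l. sg i\<bar>" by (rule of_int_abs[symmetric])
  then have "\<bar>x\<bar> = 1" unfolding x_def using z by (simp only: abs_mult abs_prod_sg)
  then have "\<bar>x * t\<bar> = t" using assms by (simp add: abs_mult)
  then show ?thesis unfolding x_def[symmetric] by linarith
qed

text \<open>At \<open>\<tau> = 1\<close> the pair term has order \<open>\<delta> ^ 4\<close>. Since
  \<open>3 \<le> k\<close> and \<open>8 \<le> l\<close>, the path term and the trace are at most of
  order \<open>\<delta> ^ 6\<close>, and so is the error.\<close>

lemma attains_pair:
  assumes pair: "0 < z * real_of_int pair_count" and k3: "3 \<le> k"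
  shows "attains z"
proof -
  define K where "K = real l * 2 ^ l"
  \<comment> \<open>The three summands are the constants in front of \<open>\<delta> ^ 6\<close> in
    the bounds for the trace, the path term and \<open>err\<close>.\<close>
  define c where "c = 4 ^ 7 + 2 ^ l * 128 + 16 * (K * (2 ^ l * 128 + 1))"
  have K: "0 \<le> K" by (simp add: K_def)
  have pc: "pair_count \<noteq> 0" using pair by auto
  then have l8: "8 \<le> l" using pair_count_less four by presburger
  show ?thesis
  proof (rule attainsI[of "(1 / 2) ^ l / 4" c])
    show "0 \<le> c" using K by (simp add: c_def)
    fix \<delta> :: real assume \<delta>: "0 < \<delta>" "\<delta> \<le> 1 / 8" and small: "c * \<delta>\<^sup>2 < (1 / 2) ^ l / 4"
    interpret cycle_tournament l S 4 "ex_M \<delta> 1" "4 * \<delta>" "ex_A \<delta> 1" k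
      by (rule ex_cycle_tournament) (use \<delta> in auto)
    define h where "h = z * real_of_int pair_count"
    define p where "p = \<bar>real_of_int (path_count k)\<bar>"
    have P1: "P 1 = \<delta>\<^sup>2 / 2" using ex_P1[of \<delta> 1] by simp
    have P1sq: "(P 1)\<^sup>2 = \<delta> ^ 4 / 4" unfolding P1 by (simp add: power_divide flip: power_mult)
    have \<delta>6: "\<delta> ^ 6 \<le> \<delta> ^ 4" using \<delta> by (intro power_decreasing) auto
    have p: "0 \<le> p" "p \<le> 2 ^ l" using path_count_le by (auto simp: p_def)
    have "P k \<le> (4 * \<delta>)\<^sup>2 * P 2"
      unfolding P_def by (rule nrm_le_strict) (use k3 in auto)
    also have "\<dots> \<le> (4 * \<delta>)\<^sup>2 * ((4 * \<delta>)\<^sup>2 * P 1)"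
      unfolding P_def by (intro mult_left_mono nrm_le_strict) auto
    also have "\<dots> = 128 * \<delta> ^ 6" unfolding P1 by (simp add: eval_nat_numeral)
    finally have Pk: "P k \<le> 128 * \<delta> ^ 6" .
    have pP: "p * P k \<le> 2 ^ l * (128 * \<delta> ^ 6)"
      using p Pk by (intro mult_mono) auto
    have h: "1 \<le> h"
    proof -
      have "1 \<le> \<bar>real_of_int pair_count\<bar>" using pc by linarith
      moreover have "\<bar>h\<bar> = \<bar>real_of_int pair_count\<bar>" using z by (simp add: h_def abs_mult)
      ultimately show ?thesis using pair by (simp add: h_def)
    qed
    have T: "trace_term \<le> 4 ^ 7 * \<delta> ^ 6"
    proof -
      have "(4 * \<delta>) ^ l \<le> (4 * \<delta>) ^ 6" using \<delta> l8 by (intro power_decreasing) auto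
      then show ?thesis using trace_term_le by (simp add: power_mult_distrib)
    qed
    have "- trace_term \<le> z * real_of_int (\<Prod>i<l. sg i) * trace_term"
      by (rule signed_lower[OF trace_term_nonneg])
    moreover have "- (p * P k) \<le> (1 / 2) ^ (l - 2 * k) * (z * (-1) ^ k * real_of_int (path_count k)) * P k"
    proof -
      have "\<bar>(1 / 2) ^ (l - 2 * k) * (z * (-1) ^ k * real_of_int (path_count k)) * P k\<bar>
          = (1 / 2) ^ (l - 2 * k) * (p * P k)"
        using z by (simp add: p_def abs_mult power_abs)
      also have "\<dots> \<le> 1 * (p * P k)"
        using p by (intro mult_right_mono) (auto simp: power_le_one)
      finally show ?thesis by linarith
    qed
    moreover have "(1 / 2) ^ l * (\<delta> ^ 4 / 4) \<le> (1 / 2) ^ (l - 4) * h * (P 1)\<^sup>2"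
    proof -
      have "(1 / 2 :: real) ^ l * 1 \<le> (1 / 2) ^ (l - 4) * h"
        using h by (intro mult_mono power_decreasing) auto
      then show ?thesis unfolding P1sq by (intro mult_right_mono) auto
    qed
    moreover have "err \<le> 16 * (K * (2 ^ l * 128 + 1)) * \<delta> ^ 6"
    proof -
      have "p * P k + (P 1)\<^sup>2 \<le> (2 ^ l * 128 + 1) * \<delta> ^ 4"
      proof -
        have "p * P k \<le> 2 ^ l * 128 * \<delta> ^ 4"
          using order_trans[OF pP, of "2 ^ l * (128 * \<delta> ^ 4)"] \<delta>6 by simp
        moreover have "(P 1)\<^sup>2 \<le> \<delta> ^ 4" unfolding P1sq using \<delta> by simp
        ultimately show ?thesis by (simp add: distrib_right)
      qed
      then have "K * (16 * \<delta>\<^sup>2) * (p * P k + (P 1)\<^sup>2) \<le> K * (16 * \<delta>\<^sup>2) * ((2 ^ l * 128 + 1) * \<delta> ^ 4)"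
        using K by (intro mult_left_mono) auto
      moreover have "err = K * (16 * \<delta>\<^sup>2) * (p * P k + (P 1)\<^sup>2)"
        by (simp add: err_def K_def p_def power_mult_distrib)
      moreover have "K * (16 * \<delta>\<^sup>2) * ((2 ^ l * 128 + 1) * \<delta> ^ 4) = 16 * (K * (2 ^ l * 128 + 1)) * \<delta> ^ 6"
        by (simp add: eval_nat_numeral)
      ultimately show ?thesis by simp
    qed
    moreover have "\<delta> ^ 4 * (c * \<delta>\<^sup>2) < \<delta> ^ 4 * ((1 / 2) ^ l / 4)"
      using small \<delta> by (intro mult_strict_left_mono) auto
    moreover have "\<delta> ^ 4 * (c * \<delta>\<^sup>2) = 4 ^ 7 * \<delta> ^ 6 + 2 ^ l * (128 * \<delta> ^ 6) + 16 * (K * (2 ^ l * 128 + 1)) * \<delta> ^ 6"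
      by (simp add: c_def eval_nat_numeral algebra_simps)
    moreover have "\<delta> ^ 4 * ((1 / 2) ^ l / 4) = (1 / 2) ^ l * (\<delta> ^ 4 / 4)" by simp
    ultimately have "0 < z * excess"
      using excess_lower[OF z] T pP unfolding h_def by linarith
    then show "\<exists>\<tau>. 0 \<le> \<tau> \<and> \<tau> \<le> 1 \<and> 0 < z * (hom_density C (ex_A \<delta> \<tau>) - (1 / 2) ^ l)"
      unfolding excess_def by (intro exI[of _ 1]) auto
  qed simp
qed

text \<open>With \<open>\<tau> = \<delta> ^ (k - 1)\<close> the terms \<open>P k\<close>, \<open>(P 1)\<^sup>2\<close> and the trace have orders
  \<open>\<delta> ^ (4 * k - 2)\<close>, \<open>\<delta> ^ (4 * k)\<close> and \<open>\<delta> ^ l\<close>, so that \<open>P k\<close> dominates since \<open>4 * k \<le> l\<close>.\<close>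
lemma attains_path:
  assumes path: "0 < z * (-1) ^ k * real_of_int (path_count k)"
  shows "attains z"
proof -
  define K where "K = real l * 2 ^ l"
  \<comment> \<open>The first two summands pay for the trace and the pair term;
    \<open>16 * K\<close> makes the relative error of the path term at most a quarter, and 1 pays
    for the rest of \<open>err\<close>.\<close>
  define c where "c = 4 ^ Suc l + 2 ^ l + 1 + 16 * K"
  have K: "0 \<le> K" by (simp add: K_def)
  have pc: "path_count k \<noteq> 0" using path by auto
  then have lk: "4 * k \<le> l"
    using least_single_le[of k] k below four unfolding path_count_def by auto
  show ?thesis
  proof (rule attainsI[of "(1 / 2) ^ l / 4" c])
    show "0 \<le> c" using K by (simp add: c_def)
    fix \<delta> :: real assume \<delta>: "0 < \<delta>" "\<delta> \<le> 1 / 8" and small: "c * \<delta>\<^sup>2 < (1 / 2) ^ l / 4"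
    define \<tau> where "\<tau> = \<delta> ^ (k - 1)"
    have \<tau>: "0 < \<tau>" "\<tau> \<le> 1" using \<delta> by (auto simp: \<tau>_def power_le_one)
    interpret cycle_tournament l S 4 "ex_M \<delta> \<tau>" "4 * \<delta>" "ex_A \<delta> \<tau>" k
      by (rule ex_cycle_tournament) (use \<delta> \<tau> in auto)
    define g where "g = z * (-1) ^ k * real_of_int (path_count k)"
    have g_abs: "\<bar>real_of_int (path_count k)\<bar> = g"
    proof -
      have "\<bar>g\<bar> = \<bar>real_of_int (path_count k)\<bar>" using z by (simp add: g_def abs_mult power_abs)
      then show ?thesis using path by (simp add: g_def)
    qed
    have "1 \<le> \<bar>real_of_int (path_count k)\<bar>" using pc by linarith
    then have g: "1 \<le> g" by (simp add: g_abs)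
    \<comment> \<open>The order of \<open>P k\<close>; all competing terms are measured by
      \<open>w * \<delta>\<^sup>2\<close>.\<close>
    define w where "w = \<delta> ^ (4 * k - 2)"
    have w: "0 < w" using \<delta> by (simp add: w_def)
    have w2: "\<delta> ^ (4 * k) = w * \<delta>\<^sup>2"
    proof -
      have "4 * k = 4 * k - 2 + 2" using k by simp
      then show ?thesis unfolding w_def by (metis power_add)
    qed
    have dt: "\<delta> * \<tau> = \<delta> ^ k"
      unfolding \<tau>_def power_Suc[symmetric] using k by simp
    have P1: "P 1 = (\<delta> ^ k)\<^sup>2 / 2" 
      unfolding dt[symmetric] power_mult_distrib by (rule ex_P1)
    have P1sq: "(P 1)\<^sup>2 \<le> w * \<delta>\<^sup>2"
    proof -
      have "k * 2 * 2 = 4 * k" by simp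
      then have "((\<delta> ^ k)\<^sup>2)\<^sup>2 = \<delta> ^ (4 * k)" by (simp only: power_mult[symmetric])
      then have "(P 1)\<^sup>2 = \<delta> ^ (4 * k) / 4" unfolding P1 by (simp add: power_divide)
      then have eq: "4 * (P 1)\<^sup>2 = w * \<delta>\<^sup>2" by (simp add: w2)
      have "0 \<le> (P 1)\<^sup>2" by simp
      then show ?thesis unfolding eq[symmetric] by linarith
    qed
    have P1_pos: "0 < P 1" unfolding P1 using \<delta> by simp
    have Pk: "w / 2 \<le> P k"
    proof -
      have nrm_P: "nrm j (act 4 (ex_M \<delta> \<tau>) ones) = P (Suc j)" for j
        by (simp add: P_def nrm_def funpow_swap1)
      \<comment> \<open>The geometric growth is started from \<open>M 1\<close> and not from the
        all-ones vector, because the small factor \<open>\<tau>\<close> spoils the first ratio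
        only.\<close>
      have "(\<delta>\<^sup>2) ^ (k - 1) * nrm 0 (act 4 (ex_M \<delta> \<tau>) ones) \<le> nrm (k - 1) (act 4 (ex_M \<delta> \<tau>) ones)"
      proof (rule nrm_ge_geometric)
        show "0 < nrm 0 (act 4 (ex_M \<delta> \<tau>) ones)"
          unfolding nrm_P using P1_pos by simp
        show "\<delta>\<^sup>2 * nrm 0 (act 4 (ex_M \<delta> \<tau>) ones) \<le> nrm 1 (act 4 (ex_M \<delta> \<tau>) ones)"
          unfolding nrm_P using ex_P2[of \<delta> \<tau>] by (simp add: numeral_2_eq_2)
      qed (use \<delta> in simp)
      then have "(\<delta>\<^sup>2) ^ (k - 1) * P 1 \<le> P k"
        unfolding nrm_P using k by simp
      moreover have "(\<delta>\<^sup>2) ^ (k - 1) * (\<delta> ^ k)\<^sup>2 = w"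
      proof -
        have "(\<delta>\<^sup>2) ^ (k - 1) * (\<delta> ^ k)\<^sup>2 = \<delta> ^ (2 * (k - 1) + k * 2)"
          by (simp add: power_add power_mult)
        also have "2 * (k - 1) + k * 2 = 4 * k - 2" using k by simp
        finally show ?thesis by (simp add: w_def)
      qed
      ultimately show ?thesis unfolding P1 by simp
    qed
    have T: "trace_term \<le> 4 ^ Suc l * (w * \<delta>\<^sup>2)"
    proof -
      have "\<delta> ^ l \<le> \<delta> ^ (4 * k)" using \<delta> lk by (intro power_decreasing) auto
      then have "4 * (4 * \<delta>) ^ l \<le> 4 ^ Suc l * (w * \<delta>\<^sup>2)" by (simp add: power_mult_distrib w2)
      moreover have "trace_term \<le> 4 * (4 * \<delta>) ^ l" using trace_term_le by simp
      ultimately show ?thesis by linarith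
    qed
    define u where "u = (1 / 2 :: real) ^ l"
    have u: "0 \<le> u" "u \<le> 1" by (auto simp: u_def power_le_one)
    have small_u: "4 * (c * \<delta>\<^sup>2) < u" using small by (simp add: u_def)
    have small_K: "4 * (16 * K * \<delta>\<^sup>2) \<le> u" "16 * K * \<delta>\<^sup>2 \<le> 1"
    proof -
      have "16 * K * \<delta>\<^sup>2 \<le> c * \<delta>\<^sup>2" by (intro mult_right_mono) (auto simp: c_def)
      moreover have "0 \<le> 16 * K * \<delta>\<^sup>2" using K by simp
      ultimately show "4 * (16 * K * \<delta>\<^sup>2) \<le> u" "16 * K * \<delta>\<^sup>2 \<le> 1"
        using small_u u(2) by linarith+
    qed
    have f1: "- trace_term \<le> z * real_of_int (\<Prod>i<l. sg i) * trace_term"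
      by (rule signed_lower[OF trace_term_nonneg])
    have f2: "u * (g * P k) \<le> (1 / 2) ^ (l - 2 * k) * g * P k"
    proof -
      have "u \<le> (1 / 2) ^ (l - 2 * k)" unfolding u_def by (intro power_decreasing) auto
      then have "u * (g * P k) \<le> (1 / 2) ^ (l - 2 * k) * (g * P k)"
        using g by (intro mult_right_mono) auto
      then show ?thesis by (simp add: mult.assoc)
    qed
    have f3: "- (2 ^ l * (w * \<delta>\<^sup>2)) \<le> (1 / 2) ^ (l - 4) * (z * real_of_int pair_count) * (P 1)\<^sup>2"
    proof -
      have "\<bar>(1 / 2) ^ (l - 4) * (z * real_of_int pair_count) * (P 1)\<^sup>2\<bar>
          = ((1 / 2) ^ (l - 4) * \<bar>real_of_int pair_count\<bar>) * (P 1)\<^sup>2"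
        using z by (simp add: abs_mult power_abs)
      also have "\<dots> \<le> (1 * 2 ^ l) * (w * \<delta>\<^sup>2)"
        by (intro mult_mono pair_count_le P1sq) (auto simp: power_le_one)
      finally show ?thesis by linarith
    qed
    have f4: "4 * err \<le> u * (g * P k) + 4 * (w * \<delta>\<^sup>2)"
    proof -
      have "4 * err = 4 * (16 * K * \<delta>\<^sup>2) * (g * P k) + 4 * (16 * K * \<delta>\<^sup>2 * (P 1)\<^sup>2)"
        unfolding err_def K_def g_abs by (simp add: algebra_simps)
      also have "\<dots> \<le> u * (g * P k) + 4 * (1 * (w * \<delta>\<^sup>2))"
      proof (intro add_mono mult_left_mono)
        show "4 * (16 * K * \<delta>\<^sup>2) * (g * P k) \<le> u * (g * P k)"
          using small_K(1) g by (intro mult_right_mono) auto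
        show "16 * K * \<delta>\<^sup>2 * (P 1)\<^sup>2 \<le> 1 * (w * \<delta>\<^sup>2)"
          by (intro mult_mono small_K P1sq) auto
      qed simp
      finally show ?thesis by simp
    qed
    have f5: "u * w \<le> 2 * (u * (g * P k))"
    proof -
      have "1 * P k \<le> g * P k" using g by (intro mult_right_mono) auto
      moreover have "w \<le> 2 * P k" using Pk by simp
      ultimately have "w \<le> 2 * (g * P k)" by linarith
      then have "u * w \<le> u * (2 * (g * P k))" using u(1) by (rule mult_left_mono)
      then show ?thesis by (simp add: mult.left_commute)
    qed
    have f6: "4 * (4 ^ Suc l * (w * \<delta>\<^sup>2) + 2 ^ l * (w * \<delta>\<^sup>2) + w * \<delta>\<^sup>2) < u * w"
    proof -
      have "(4 ^ Suc l + 2 ^ l + 1) * \<delta>\<^sup>2 \<le> c * \<delta>\<^sup>2"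
        using K by (intro mult_right_mono) (auto simp: c_def)
      then have "4 * ((4 ^ Suc l + 2 ^ l + 1) * \<delta>\<^sup>2) < u" using small_u by linarith
      then have "4 * ((4 ^ Suc l + 2 ^ l + 1) * \<delta>\<^sup>2) * w < u * w" using w by (rule mult_strict_right_mono)
      then show ?thesis by (simp only: algebra_simps)
    qed
    have f7: "0 \<le> u * (g * P k)" using u(1) g by simp
    \<comment> \<open>The error takes at most a quarter of the path term \<open>a\<close>, apart
      from \<open>y\<close>, and \<open>y1 + y2 + y < b / 4 \<le> a / 2\<close>; so more than
      \<open>a / 4\<close> is left. Fresh variables make the problem linear.\<close>
    have "0 < v" if "- t \<le> x1" "a \<le> x2" "- y2 \<le> x3" "4 * r \<le> a + 4 * y" "b \<le> 2 * a"
        "4 * (y1 + y2 + y) < b" "0 \<le> a" "x1 + x2 + x3 - r \<le> v" "t \<le> y1"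
      for t x1 x2 x3 a b r y y1 y2 v :: real
      using that by argo
    from this[OF f1 f2 f3 f4 f5 f6 f7 excess_lower[OF z, folded g_def] T]
    have "0 < z * excess" .
    then show "\<exists>\<tau>. 0 \<le> \<tau> \<and> \<tau> \<le> 1 \<and> 0 < z * (hom_density C (ex_A \<delta> \<tau>) - (1 / 2) ^ l)"
      unfolding excess_def using \<tau> by (intro exI[of _ \<tau>]) auto
  qed simp
qed

end

end

theorem theorem3p19:
  fixes l t :: nat and S :: "(nat \<times> nat) set" and C :: "nat pair_pre_digraph"
  assumes "l \<ge> 3" and "t \<le> l"
    and "S \<subseteq> parcs (directed_cycle l)" and "card S = t"
    and "C = reverse_arcs S (directed_cycle l)"
    and "signed_count (directed_path 3) C = 0"
    and "signed_count (directed_path 5) C = 0"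
    and "signed_count two_P3 C \<noteq> 0"
  shows
    "let k_exists = (\<exists>k>0. signed_count (directed_path (2 * k + 1)) C \<noteq> 0);
         k = (LEAST k. k > 0 \<and> signed_count (directed_path (2 * k + 1)) C \<noteq> 0);
         hyp_i =
           (signed_count two_P3 C > 0 \<and>
            (\<not> k_exists \<or> (-1) ^ k * signed_count (directed_path (2 * k + 1)) C > 0) \<and>
            (odd l \<or> (l mod 4 = 0 \<and> even t) \<or> (l mod 4 = 2 \<and> odd t)));
         hyp_ii =
           (signed_count two_P3 C < 0 \<and>
            (\<not> k_exists \<or> (-1) ^ k * signed_count (directed_path (2 * k + 1)) C < 0) \<and>
            (odd l \<or> (l mod 4 = 0 \<and> odd t) \<or> (l mod 4 = 2 \<and> even t)))
     in (hyp_i \<longrightarrow> LTS C) \<and>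
        (hyp_ii \<longrightarrow> LTAS C) \<and>
        (\<not> hyp_i \<and> \<not> hyp_ii \<longrightarrow> \<not> LTS C \<and> \<not> LTAS C)"
proof -
  interpret oc: oriented_cycle l S by unfold_locales (use assms in auto)
  have C: "C = oc.C" using assms(5) by (simp add: oc.C_def)
  define c where "c j = signed_count (directed_path (2 * j + 1)) C" for j
  define d where "d = signed_count two_P3 C"
  have c: "oc.path_count j = c j" if "1 \<le> j" for j
    using oc.signed_count_path[of j] that by (simp add: c_def C oc.path_count_def)
  have d: "oc.pair_count = d"
    by (simp add: d_def C oc.signed_count_two_P3 oc.pair_count_def)
  have c12: "c 1 = 0" "c 2 = 0" using assms(6,7) by (simp_all add: c_def)
  have d0: "d \<noteq> 0" using assms(8) by (simp add: d_def)
  have four: "4 dvd l"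
    using oc.four_dvd c[of 1] c12 by (simp add: oc.path_count_def)
  then have l4: "l mod 4 = 0" "even l" by auto
  define k_exists where "k_exists \<longleftrightarrow> (\<exists>j>0. c j \<noteq> 0)"
  define k where "k = (LEAST j. j > 0 \<and> c j \<noteq> 0)"
  \<comment> \<open>If all path counts vanish, any positive index would satisfy \<open>none\<close>;
    the default 3 is large enough for \<open>attains_pair\<close>.\<close>
  define k' where "k' = (if k_exists then k else 3)"
  have k: "0 < k \<and> c k \<noteq> 0" if k_exists
    using LeastI_ex[of "\<lambda>j. j > 0 \<and> c j \<noteq> 0"] that by (auto simp: k_def k_exists_def)
  have k'3: "3 \<le> k'"
  proof (cases k_exists)
    case True
    have "k \<noteq> 0" "k \<noteq> 1" "k \<noteq> 2" using k[OF True] c12 by auto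
    then show ?thesis using True by (simp add: k'_def)
  qed (simp add: k'_def)
  have no_path: "oc.path_count j = 0" if "\<not> k_exists" "1 \<le> j" for j
  proof -
    have "0 < j" using that(2) by simp
    then have "c j = 0" using that(1) unfolding k_exists_def by blast
    then show ?thesis using c[OF that(2)] by simp
  qed
  have below: "oc.path_count j = 0" if "1 \<le> j" "j < k'" for j
  proof (cases k_exists)
    case True
    then have "j < (LEAST j. j > 0 \<and> c j \<noteq> 0)"
      using that(2) by (simp only: k'_def k_def if_True)
    then have "\<not> (0 < j \<and> c j \<noteq> 0)" by (rule not_less_Least)
    then show ?thesis using that(1) c[OF that(1)] by simp
  next
    case False
    then show ?thesis using no_path that(1) by blast
  qed
  have none: "oc.path_count j = 0" if "oc.path_count k' = 0" "1 \<le> j" for j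
  proof (cases k_exists)
    case True
    then have "oc.path_count k = c k" using k by (intro c) simp
    then show ?thesis using that(1) k[OF True] True by (simp add: k'_def)
  next
    case False
    then show ?thesis using no_path that(2) by blast
  qed
  have k'1: "1 \<le> k'" using k'3 by simp
  have ck': "oc.path_count k' = (if k_exists then c k else 0)"
  proof (cases k_exists)
    case True
    then show ?thesis using c[OF k'1] by (simp add: k'_def)
  next
    case False
    then show ?thesis using no_path[OF _ k'1] by simp
  qed
  \<comment> \<open>The sign of the trace term is thus the parity of \<open>t\<close>.\<close>
  have prod: "real_of_int (\<Prod>i<l. oc.sg i) = (-1) ^ t"
    unfolding oc.prod_sg assms(4) by simp
  \<comment> \<open>One of the three signs agreeing with \<open>z\<close> is enough, since each main
    term can be made dominant.\<close>
  have sign: "oc.attains z"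
    if z: "\<bar>z\<bar> = 1" and cases: "0 < z * real_of_int d \<or> (k_exists \<and> 0 < z * (-1) ^ k * real_of_int (c k)) \<or> z * (-1) ^ t = 1"
    for z
    using cases
  proof (elim disjE)
    assume "0 < z * real_of_int d"
    then show ?thesis
      using oc.attains_pair[OF z four k'1 below none _ k'3] d by simp
  next
    assume h: "k_exists \<and> 0 < z * (-1) ^ k * real_of_int (c k)"
    then have "0 < z * (-1) ^ k' * real_of_int (oc.path_count k')" using ck' by (simp add: k'_def)
    then show ?thesis using oc.attains_path[of z k'] z four k'1 below none by blast
  next
    assume "z * (-1) ^ t = 1"
    then have "z * real_of_int (\<Prod>i<l. oc.sg i) = 1" unfolding prod .
    then show ?thesis using oc.attains_trace[of z k'] z four k'1 below none by blast
  qed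
  have local: "\<exists>\<epsilon>>0. \<forall>n\<ge>1. \<forall>A. weighted_tournament n A \<and> lambda_max (skew_part n A) \<le> \<epsilon> * real n \<longrightarrow>
      0 \<le> z * (hom_density C A - (1 / 2) ^ l)"
    if "\<bar>z\<bar> = 1" "0 < z * real_of_int d" "\<not> k_exists \<or> 0 < z * (-1) ^ k * real_of_int (c k)" "z * (-1) ^ t = 1"
    for z
    unfolding C
  proof (rule oc.local_sign[OF that(1) four k'1 below none])
    show "0 < z * real_of_int oc.pair_count" using that(2) d by simp
    show "0 \<le> z * (-1) ^ k' * real_of_int (oc.path_count k')"
      using that(3) ck' by (auto simp: k'_def)
    show "z * real_of_int (\<Prod>i<l. oc.sg i) = 1" unfolding prod by (rule that(4))
  qed
  have card: "card (parcs C) = l" unfolding C by (rule oc.card_parcs_C)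
  have not_LTS: "\<not> LTS C" if "oc.attains (-1)"
    unfolding LTS_def card
  proof (intro notI, elim exE conjE)
    fix \<epsilon> :: real assume \<epsilon>: "0 < \<epsilon>" and all: "\<forall>n\<ge>1. \<forall>A. weighted_tournament n A \<and>
      lambda_max (skew_part n A) \<le> \<epsilon> * real n \<longrightarrow> hom_density C A \<ge> (1 / 2) ^ l"
    from that \<epsilon> obtain n A where "n \<ge> 1" "weighted_tournament n A"
      "lambda_max (skew_part n A) \<le> \<epsilon> * real n" "0 < (-1) * (hom_density oc.C A - (1 / 2) ^ l)"
      unfolding oc.attains_def by blast
    with all show False unfolding C by fastforce
  qed
  have not_LTAS: "\<not> LTAS C" if "oc.attains 1"
    unfolding LTAS_def card
  proof (intro notI, elim exE conjE)
    fix \<epsilon> :: real assume \<epsilon>: "0 < \<epsilon>" and all: "\<forall>n\<ge>1. \<forall>A. weighted_tournament n A \<and>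
      lambda_max (skew_part n A) \<le> \<epsilon> * real n \<longrightarrow> hom_density C A \<le> (1 / 2) ^ l"
    from that \<epsilon> obtain n A where "n \<ge> 1" "weighted_tournament n A"
      "lambda_max (skew_part n A) \<le> \<epsilon> * real n" "0 < 1 * (hom_density oc.C A - (1 / 2) ^ l)"
      unfolding oc.attains_def by blast
    with all show False unfolding C by fastforce
  qed
  have real_pos: "0 < (-1) ^ k * real_of_int (c k) \<longleftrightarrow> 0 < (-1) ^ k * c k"
    "(-1) ^ k * real_of_int (c k) < 0 \<longleftrightarrow> (-1) ^ k * c k < 0"
  proof -
    have eq: "(-1) ^ k * real_of_int (c k) = real_of_int ((-1) ^ k * c k)" by simp
    show "0 < (-1) ^ k * real_of_int (c k) \<longleftrightarrow> 0 < (-1) ^ k * c k"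
      unfolding eq by (rule of_int_0_less_iff)
    show "(-1) ^ k * real_of_int (c k) < 0 \<longleftrightarrow> (-1) ^ k * c k < 0"
      unfolding eq by (rule of_int_less_0_iff)
  qed
  \<comment> \<open>Because 4 divides \<open>l\<close>, the conditions on \<open>l\<close> and
    \<open>t\<close> in the statement come down to the parity of \<open>t\<close>.\<close>
  define I where "I \<longleftrightarrow> 0 < d \<and> (\<not> k_exists \<or> 0 < (-1) ^ k * c k) \<and> even t"
  define II where "II \<longleftrightarrow> d < 0 \<and> (\<not> k_exists \<or> (-1) ^ k * c k < 0) \<and> odd t"
  have "LTS C" if I
    using local[of 1] that real_pos unfolding LTS_def card I_def by auto
  moreover have "LTAS C" if II
  proof -
    have "(-1 :: real) * (-1) ^ t = 1" using that by (simp add: II_def)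
    then have "\<exists>\<epsilon>>0. \<forall>n\<ge>1. \<forall>A. weighted_tournament n A \<and> lambda_max (skew_part n A) \<le> \<epsilon> * real n \<longrightarrow>
      0 \<le> (-1) * (hom_density C A - (1 / 2) ^ l)"
      by (intro local) (use that real_pos in \<open>auto simp: II_def\<close>)
    then show ?thesis unfolding LTAS_def card by simp
  qed
  moreover have "\<not> LTS C" if "\<not> I"
  proof (rule not_LTS, rule sign)
    \<comment> \<open>Neither \<open>d\<close> nor an existing \<open>c k\<close> is zero, so a sign
      that fails to be positive is negative.\<close>
    have "d < 0 \<or> (k_exists \<and> (-1) ^ k * c k < 0) \<or> odd t"
    proof -
      have "(-1) ^ k * c k \<noteq> 0" if k_exists using k[OF that] by simp
      then show ?thesis using \<open>\<not> I\<close> d0 unfolding I_def by linarith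
    qed
    then show "0 < - 1 * real_of_int d \<or> (k_exists \<and> 0 < - 1 * (-1) ^ k * real_of_int (c k)) \<or> - 1 * (-1 :: real) ^ t = 1"
      using real_pos by auto
  qed simp
  moreover have "\<not> LTAS C" if "\<not> II"
  proof (rule not_LTAS, rule sign)
    have "0 < d \<or> (k_exists \<and> 0 < (-1) ^ k * c k) \<or> even t"
    proof -
      have "(-1) ^ k * c k \<noteq> 0" if k_exists using k[OF that] by simp
      then show ?thesis using \<open>\<not> II\<close> d0 unfolding II_def by linarith
    qed
    then show "0 < 1 * real_of_int d \<or> (k_exists \<and> 0 < 1 * (-1) ^ k * real_of_int (c k)) \<or> 1 * (-1 :: real) ^ t = 1"
      using real_pos by auto
  qed simp
  ultimately show ?thesis
    unfolding Let_def c_def[symmetric] d_def[symmetric] k_def[symmetric] k_exists_def[symmetric]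
    using l4 by (simp add: I_def II_def)
qed

end
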